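(* Let $K$ be a field and let $\mathbb M$ be a functor of $\mathcal K$-modules such that $\mathbb M^*$ is well defined. Let $\bar{\mathbb M}:=(\mathbb M^*(\mathcal K))^*$, where $\mathbb M^*(\mathcal K)$ is the quasi-coherent module associated with the $K$-vector space $\mathbb M^*(K)$, so that $\bar{\mathbb M}(S)=\operatorname{Hom}_K(\mathbb M^*(K),S)$. Then $\mathbb M$ is separated if and only if the natural morphism $\mathbb M\to\bar{\mathbb M}$, $m\mapsto (w\mapsto w(m))$, is injective. Therefore, $\mathbb M$ is separated if and only if it is (isomorphic to) a functor of $\mathcal K$-submodules of a $\mathcal K$-module scheme.
   Context: $K$ is a field. All functors are covariant functors on the category of commutative $K$-algebras. $\mathcal K$ is the functor of rings $\mathcal K(S)=S$. A functor of $\mathcal K$-modules $\mathbb M$ is a functor of sets with morphisms of functors $\mathbb M\times\mathbb M\to\mathbb M$, $\mathcal K\times\mathbb M\to\mathbb M$ making $\mathbb M(S)$ an $S$-module for every commutative $K$-algebra $S$. A morphism of functors of $\mathcal K$-modules is a natural transformation $f$ with every $f_S$ $S$-linear; $f$ is injective if every $f_S$ is. $\mathbb M_{|S}$ is the restriction of $\mathbb M$ to commutative $S$-algebras. The dual is $\mathbb M^*:=\mathbb{H}\mathrm{om}_{\mathcal K}(\mathbb M,\mathcal K)$, i.e. $\mathbb M^*(S)=\operatorname{Hom}_{\mathcal S}(\mathbb M_{|S},\mathcal S)$, where $\mathcal S$ is the functor $T\mapsto T$ on commutative $S$-algebras; it is well defined when these are sets for all $S$. For a $K$-vector space $V$,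 the quasi-coherent module $\mathcal V$ associated with $V$ is $\mathcal V(S)=V\otimes_K S$. A $\mathcal K$-module scheme is a functor of the form $\mathcal V^*$, so $\mathcal V^*(S)=\operatorname{Hom}_K(V,S)$. $\mathbb M$ is separated if the natural morphism $\mathbb M\to\mathbb M^{**}$, $m\mapsto\tilde m$, $\tilde m(w):=w(m)$, is injective; that is, for each commutative $K$-algebra $S$ and each $0\ne m\in\mathbb M(S)$ there exist a commutative $S$-algebra $T$ and $w\in\mathbb M^*(T)$ with $w(m)\neq 0$. *)

theory Defs
  imports "HOL-Algebra.Algebra"
begin

section \<open>The category of commutative algebras\<close>

text \<open>
  The base field and all algebras have their carriers in one type \<open>'u\<close>, which plays the role of the
  universe: the algebras over \<open>K\<close> are all \<open>S :: ('u, 'u) module\<close> with \<^term>\<open>comm_alg K S\<close>, and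
  \<open>K\<close> itself is the object \<open>self_alg K\<close>. Two algebras need not be equal if they agree on their
  carriers; they are then isomorphic via the identity. For infinite \<open>'u\<close> the category is closed under
  tensor products over \<open>K\<close>.

  The library locale \<^locale>\<open>algebra\<close> describes commutative unital algebras. Making the scalar
  multiplication extensional costs no generality, and it makes restriction of scalars strictly
  functorial: restricting \<open>self_alg S\<close> back to \<open>K\<close> gives \<open>S\<close> itself, and not just an isomorphic copy.
\<close>

definition comm_alg :: "('a, 'b) ring_scheme \<Rightarrow> ('a, 'c) module \<Rightarrow> bool" where
  "comm_alg A S \<longleftrightarrow> algebra A S \<and> smult S \<in> extensional (carrier A) \<and>
     (\<forall>a\<in>carrier A. smult S a \<in> extensional (carrier S))"

definition alg_hom ::
    "('a, 'b) ring_scheme \<Rightarrow> ('a, 'c) module \<Rightarrow> ('a, 'd) module \<Rightarrow> ('c \<Rightarrow> 'd) set" where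
  "alg_hom A S T = {f \<in> ring_hom S T \<inter> extensional (carrier S).
     \<forall>a\<in>carrier A. \<forall>x\<in>carrier S. f (a \<odot>\<^bsub>S\<^esub> x) = a \<odot>\<^bsub>T\<^esub> f x}"

definition mod_hom ::
    "('a, 'b) ring_scheme \<Rightarrow> ('a, 'c, 'e) module_scheme \<Rightarrow> ('a, 'd, 'f) module_scheme \<Rightarrow> ('c \<Rightarrow> 'd) set" where
  "mod_hom A M N = {f \<in> (carrier M \<rightarrow> carrier N) \<inter> extensional (carrier M).
     (\<forall>x\<in>carrier M. \<forall>y\<in>carrier M. f (x \<oplus>\<^bsub>M\<^esub> y) = f x \<oplus>\<^bsub>N\<^esub> f y) \<and>
     (\<forall>a\<in>carrier A. \<forall>x\<in>carrier M. f (a \<odot>\<^bsub>M\<^esub> x) = a \<odot>\<^bsub>N\<^esub> f x)}"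

definition self_alg :: "('a, 'b) ring_scheme \<Rightarrow> ('a, 'a) module" where
  "self_alg R = \<lparr>carrier = carrier R, monoid.mult = monoid.mult R, one = one R, ring.zero = ring.zero R,
     ring.add = ring.add R, smult = (\<lambda>a\<in>carrier R. \<lambda>x\<in>carrier R. a \<otimes>\<^bsub>R\<^esub> x)\<rparr>"

definition unit_map :: "('a, 'b) ring_scheme \<Rightarrow> ('a, 'c) module \<Rightarrow> 'a \<Rightarrow> 'c" where
  "unit_map A S = (\<lambda>a\<in>carrier A. a \<odot>\<^bsub>S\<^esub> \<one>\<^bsub>S\<^esub>)"

definition restrict_scalars ::
    "('a, 'b) ring_scheme \<Rightarrow> ('a \<Rightarrow> 'c) \<Rightarrow> ('c, 'd) module \<Rightarrow> ('a, 'd) module" where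
  "restrict_scalars A f T = \<lparr>carrier = carrier T, monoid.mult = monoid.mult T, one = one T,
     ring.zero = ring.zero T, ring.add = ring.add T, smult = (\<lambda>a\<in>carrier A. \<lambda>x\<in>carrier T. f a \<odot>\<^bsub>T\<^esub> x)\<rparr>"

section \<open>Functors of modules\<close>

record ('u, 'm) alg_functor =
  fobj :: "('u, 'u) module \<Rightarrow> ('u, 'm) module"
  farr :: "('u, 'u) module \<Rightarrow> ('u, 'u) module \<Rightarrow> ('u \<Rightarrow> 'u) \<Rightarrow> 'm \<Rightarrow> 'm"

text \<open>
  The semilinearity condition is the naturality of addition and of scalar multiplication
  \<open>\<K> \<times> \<M> \<rightarrow> \<M>\<close>. A \<^typ>\<open>('u, 'm) module\<close> record also has ring fields \<open>mult\<close> and \<open>one\<close>; the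
  locale \<^locale>\<open>module\<close> ignores them.
\<close>

definition module_functor :: "('u, 'b) ring_scheme \<Rightarrow> ('u, 'm) alg_functor \<Rightarrow> bool" where
  "module_functor A F \<longleftrightarrow>
     (\<forall>S. comm_alg A S \<longrightarrow> module S (fobj F S)) \<and>
     (\<forall>S T f. comm_alg A S \<and> comm_alg A T \<and> f \<in> alg_hom A S T \<longrightarrow>
        farr F S T f \<in> carrier (fobj F S) \<rightarrow> carrier (fobj F T) \<and>
        (\<forall>m\<in>carrier (fobj F S). \<forall>n\<in>carrier (fobj F S).
           farr F S T f (m \<oplus>\<^bsub>fobj F S\<^esub> n) = farr F S T f m \<oplus>\<^bsub>fobj F T\<^esub> farr F S T f n) \<and>
        (\<forall>s\<in>carrier S. \<forall>m\<in>carrier (fobj F S).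
           farr F S T f (s \<odot>\<^bsub>fobj F S\<^esub> m) = f s \<odot>\<^bsub>fobj F T\<^esub> farr F S T f m)) \<and>
     (\<forall>S. comm_alg A S \<longrightarrow>
        (\<forall>m\<in>carrier (fobj F S). farr F S S (\<lambda>x\<in>carrier S. x) m = m)) \<and>
     (\<forall>S T U f g. comm_alg A S \<and> comm_alg A T \<and> comm_alg A U \<and>
        f \<in> alg_hom A S T \<and> g \<in> alg_hom A T U \<longrightarrow>
        (\<forall>m\<in>carrier (fobj F S).
           farr F S U (compose (carrier S) g f) m = farr F T U g (farr F S T f m)))"

definition functor_hom ::
    "('u, 'b) ring_scheme \<Rightarrow> ('u, 'm) alg_functor \<Rightarrow> ('u, 'n) alg_functor
       \<Rightarrow> (('u, 'u) module \<Rightarrow> 'm \<Rightarrow> 'n) set" where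
  "functor_hom A F G = {w \<in> extensional {S. comm_alg A S}.
     (\<forall>S. comm_alg A S \<longrightarrow> w S \<in> mod_hom S (fobj F S) (fobj G S)) \<and>
     (\<forall>S T f. comm_alg A S \<and> comm_alg A T \<and> f \<in> alg_hom A S T \<longrightarrow>
        (\<forall>m\<in>carrier (fobj F S). w T (farr F S T f m) = farr G S T f (w S m)))}"

definition functor_inj ::
    "('u, 'b) ring_scheme \<Rightarrow> ('u, 'm) alg_functor \<Rightarrow> (('u, 'u) module \<Rightarrow> 'm \<Rightarrow> 'n) \<Rightarrow> bool" where
  "functor_inj A F w \<longleftrightarrow> (\<forall>S. comm_alg A S \<longrightarrow> inj_on (w S) (carrier (fobj F S)))"

definition functor_iso ::
    "('u, 'b) ring_scheme \<Rightarrow> ('u, 'm) alg_functor \<Rightarrow> ('u, 'n) alg_functor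
       \<Rightarrow> (('u, 'u) module \<Rightarrow> 'm \<Rightarrow> 'n) set" where
  "functor_iso A F G = {w \<in> functor_hom A F G.
     \<forall>S. comm_alg A S \<longrightarrow> bij_betw (w S) (carrier (fobj F S)) (carrier (fobj G S))}"

text \<open>A functor of submodules of \<open>F\<close> is given by its family of carriers.\<close>

definition submodule_functor ::
    "('u, 'b) ring_scheme \<Rightarrow> ('u, 'm) alg_functor \<Rightarrow> (('u, 'u) module \<Rightarrow> 'm set) \<Rightarrow> bool" where
  "submodule_functor A F N \<longleftrightarrow>
     (\<forall>S. comm_alg A S \<longrightarrow> submodule (N S) S (fobj F S)) \<and>
     (\<forall>S T f. comm_alg A S \<and> comm_alg A T \<and> f \<in> alg_hom A S T \<longrightarrow> farr F S T f ` N S \<subseteq> N T)"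

definition sub_functor ::
    "('u, 'm) alg_functor \<Rightarrow> (('u, 'u) module \<Rightarrow> 'm set) \<Rightarrow> ('u, 'm) alg_functor" where
  "sub_functor F N = \<lparr>fobj = (\<lambda>S. (fobj F S)\<lparr>carrier := N S\<rparr>), farr = farr F\<rparr>"

section \<open>Duals\<close>

definition base_functor :: "('u, 'u) alg_functor" where
  "base_functor = \<lparr>fobj = self_alg, farr = (\<lambda>S T f. f)\<rparr>"

definition restrict_functor ::
    "('u, 'b) ring_scheme \<Rightarrow> ('u, 'u) module \<Rightarrow> ('u, 'm) alg_functor \<Rightarrow> ('u, 'm) alg_functor" where
  "restrict_functor K S F =
     \<lparr>fobj = (\<lambda>T. fobj F (restrict_scalars K (unit_map K S) T)),
      farr = (\<lambda>T T'. farr F (restrict_scalars K (unit_map K S) T)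
                          (restrict_scalars K (unit_map K S) T'))\<rparr>"

text \<open>
  The fields \<open>mult\<close> and \<open>one\<close> of the module records below are irrelevant. The functor
  \<^term>\<open>dual K F\<close> is always well defined here, since the morphisms between two functors form a set.
\<close>

definition dual ::
    "('u, 'b) ring_scheme \<Rightarrow> ('u, 'm) alg_functor \<Rightarrow> ('u, ('u, 'u) module \<Rightarrow> 'm \<Rightarrow> 'u) alg_functor" where
  "dual K F =
     \<lparr>fobj = (\<lambda>S. let D = restrict_functor K S F in
        \<lparr>carrier = functor_hom S D base_functor, monoid.mult = undefined, one = undefined,
         ring.zero = (\<lambda>T\<in>{T. comm_alg S T}. \<lambda>m\<in>carrier (fobj D T). \<zero>\<^bsub>T\<^esub>),
         ring.add = (\<lambda>w w'. \<lambda>T\<in>{T. comm_alg S T}. \<lambda>m\<in>carrier (fobj D T). w T m \<oplus>\<^bsub>T\<^esub> w' T m),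
         smult = (\<lambda>s w. \<lambda>T\<in>{T. comm_alg S T}. \<lambda>m\<in>carrier (fobj D T). s \<odot>\<^bsub>T\<^esub> w T m)\<rparr>),
      farr = (\<lambda>S S' f w. \<lambda>T\<in>{T. comm_alg S' T}. w (restrict_scalars S f T))\<rparr>"

text \<open>
  For \<open>m\<close> in \<open>F(S)\<close>, an \<open>S\<close>-algebra \<open>T\<close> and \<open>w\<close> in \<open>F\<^sup>*(T)\<close>, the element \<open>w(m)\<close> of \<open>T\<close> is obtained by
  applying the component of \<open>w\<close> at the \<open>T\<close>-algebra \<open>T\<close> to the image of \<open>m\<close> in \<open>F(T)\<close>.
\<close>

definition bidual_map ::
    "('u, 'b) ring_scheme \<Rightarrow> ('u, 'm) alg_functor
       \<Rightarrow> ('u, 'u) module \<Rightarrow> 'm \<Rightarrow> (('u, 'u) module \<Rightarrow> (('u, 'u) module \<Rightarrow> 'm \<Rightarrow> 'u) \<Rightarrow> 'u)" where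
  "bidual_map K F = (\<lambda>S\<in>{S. comm_alg K S}. \<lambda>m\<in>carrier (fobj F S).
     \<lambda>T\<in>{T. comm_alg S T}. \<lambda>w\<in>carrier (fobj (restrict_functor K S (dual K F)) T).
       w (self_alg T) (farr F S (restrict_scalars K (unit_map K S) T) (unit_map S T) m))"

definition separated :: "('u, 'b) ring_scheme \<Rightarrow> ('u, 'm) alg_functor \<Rightarrow> bool" where
  "separated K F \<longleftrightarrow> functor_inj K F (bidual_map K F)"

section \<open>Quasi-coherent modules and module schemes\<close>

text \<open>
  The tensor product of a \<open>K\<close>-vector space \<open>V\<close> with a \<open>K\<close>-algebra \<open>S\<close>, as the free abelian group on
  the pairs modulo the subgroup generated by the relations.
\<close>

abbreviation tensor_free ::
    "('a, 'v) module \<Rightarrow> ('a, 'c) module \<Rightarrow> ('v \<times> 'c \<Rightarrow>\<^sub>0 int) monoid" where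
  "tensor_free V S \<equiv> free_Abelian_group (carrier V \<times> carrier S)"

definition tensor_rel ::
    "('a, 'b) ring_scheme \<Rightarrow> ('a, 'v) module \<Rightarrow> ('a, 'c) module \<Rightarrow> ('v \<times> 'c \<Rightarrow>\<^sub>0 int) set" where
  "tensor_rel K V S = generate (tensor_free V S)
     ({frag_of (v \<oplus>\<^bsub>V\<^esub> v', s) - frag_of (v, s) - frag_of (v', s) | v v' s.
         v \<in> carrier V \<and> v' \<in> carrier V \<and> s \<in> carrier S} \<union>
      {frag_of (v, s \<oplus>\<^bsub>S\<^esub> s') - frag_of (v, s) - frag_of (v, s') | v s s'.
         v \<in> carrier V \<and> s \<in> carrier S \<and> s' \<in> carrier S} \<union>
      {frag_of (a \<odot>\<^bsub>V\<^esub> v, s) - frag_of (v, a \<odot>\<^bsub>S\<^esub> s) | a v s.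
         a \<in> carrier K \<and> v \<in> carrier V \<and> s \<in> carrier S})"

definition pure_tensor ::
    "('a, 'b) ring_scheme \<Rightarrow> ('a, 'v) module \<Rightarrow> ('a, 'c) module \<Rightarrow> 'v \<Rightarrow> 'c
       \<Rightarrow> ('v \<times> 'c \<Rightarrow>\<^sub>0 int) set" where
  "pure_tensor K V S v s = tensor_rel K V S #>\<^bsub>tensor_free V S\<^esub> frag_of (v, s)"

text \<open>
  The map \<open>id \<otimes> g\<close> for a \<open>K\<close>-linear map \<open>g\<close> from \<open>S\<close> to \<open>T\<close>. All members of the union are the same
  coset, because \<open>g\<close> respects the relations.
\<close>

definition tensor_map ::
    "('a, 'b) ring_scheme \<Rightarrow> ('a, 'v) module \<Rightarrow> ('a, 'd) module \<Rightarrow> ('c \<Rightarrow> 'd)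
       \<Rightarrow> ('v \<times> 'c \<Rightarrow>\<^sub>0 int) set \<Rightarrow> ('v \<times> 'd \<Rightarrow>\<^sub>0 int) set" where
  "tensor_map K V T g x =
     (\<Union>c\<in>x. tensor_rel K V T #>\<^bsub>tensor_free V T\<^esub> frag_extend (\<lambda>(v, s). frag_of (v, g s)) c)"

definition tensor_module ::
    "('a, 'b) ring_scheme \<Rightarrow> ('a, 'v) module \<Rightarrow> ('a, 'c) module
       \<Rightarrow> ('c, ('v \<times> 'c \<Rightarrow>\<^sub>0 int) set) module" where
  "tensor_module K V S = (let Q = tensor_free V S Mod tensor_rel K V S in
     \<lparr>carrier = carrier Q, monoid.mult = undefined, one = undefined,
      ring.zero = \<one>\<^bsub>Q\<^esub>, ring.add = monoid.mult Q,
      smult = (\<lambda>s. tensor_map K V S (\<lambda>t. s \<otimes>\<^bsub>S\<^esub> t))\<rparr>)"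

definition quasi_coherent ::
    "('u, 'b) ring_scheme \<Rightarrow> ('u, 'v) module \<Rightarrow> ('u, ('v \<times> 'u \<Rightarrow>\<^sub>0 int) set) alg_functor" where
  "quasi_coherent K V =
     \<lparr>fobj = tensor_module K V, farr = (\<lambda>S T f. tensor_map K V T f)\<rparr>"

definition module_scheme ::
    "('u, 'b) ring_scheme \<Rightarrow> ('u, 'v) module
       \<Rightarrow> ('u, ('u, 'u) module \<Rightarrow> ('v \<times> 'u \<Rightarrow>\<^sub>0 int) set \<Rightarrow> 'u) alg_functor" where
  "module_scheme K V = dual K (quasi_coherent K V)"

text \<open>The functor \<open>S \<mapsto> Hom\<^sub>K(V, S)\<close>, and the map from the module scheme of \<open>V\<close> to it.\<close>

definition lin_functor :: "('u, 'b) ring_scheme \<Rightarrow> ('u, 'v) module \<Rightarrow> ('u, 'v \<Rightarrow> 'u) alg_functor" where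
  "lin_functor K V =
     \<lparr>fobj = (\<lambda>S. \<lparr>carrier = mod_hom K V S, monoid.mult = undefined, one = undefined,
         ring.zero = (\<lambda>v\<in>carrier V. \<zero>\<^bsub>S\<^esub>),
         ring.add = (\<lambda>h h'. \<lambda>v\<in>carrier V. h v \<oplus>\<^bsub>S\<^esub> h' v),
         smult = (\<lambda>s h. \<lambda>v\<in>carrier V. s \<otimes>\<^bsub>S\<^esub> h v)\<rparr>),
      farr = (\<lambda>S T f h. \<lambda>v\<in>carrier V. f (h v))\<rparr>"

definition scheme_to_lin ::
    "('u, 'b) ring_scheme \<Rightarrow> ('u, 'v) module
       \<Rightarrow> ('u, 'u) module \<Rightarrow> (('u, 'u) module \<Rightarrow> ('v \<times> 'u \<Rightarrow>\<^sub>0 int) set \<Rightarrow> 'u) \<Rightarrow> 'v \<Rightarrow> 'u" where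
  "scheme_to_lin K V = (\<lambda>S\<in>{S. comm_alg K S}. \<lambda>\<phi>\<in>carrier (fobj (module_scheme K V) S).
     \<lambda>v\<in>carrier V. \<phi> (self_alg S) (pure_tensor K V S v \<one>\<^bsub>S\<^esub>))"

section \<open>The natural morphism into the module scheme of the dual\<close>

definition dual_space ::
    "('u, 'b) ring_scheme \<Rightarrow> ('u, 'm) alg_functor \<Rightarrow> ('u, ('u, 'u) module \<Rightarrow> 'm \<Rightarrow> 'u) module" where
  "dual_space K F = fobj (dual K F) (self_alg K)"

definition bar_functor where
  "bar_functor K F = module_scheme K (dual_space K F)"

text \<open>
  The element of \<^term>\<open>bar_functor K F\<close> at \<open>S\<close> that the bijection \<^term>\<open>scheme_to_lin K (dual_space K F) S\<close>
  identifies with the linear map \<open>w \<mapsto> w(m)\<close>.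
\<close>

definition bar_map where
  "bar_map K F = (\<lambda>S\<in>{S. comm_alg K S}. \<lambda>m\<in>carrier (fobj F S).
     inv_into (carrier (fobj (bar_functor K F) S)) (scheme_to_lin K (dual_space K F) S)
       (\<lambda>w\<in>carrier (dual_space K F). w S m))"

definition submodule_of_scheme ::
    "('u, 'b) ring_scheme \<Rightarrow> ('u, 'm) alg_functor \<Rightarrow> ('u, 'v) module \<Rightarrow> bool" where
  "submodule_of_scheme K F V \<longleftrightarrow>
     (\<exists>N. submodule_functor K (module_scheme K V) N \<and>
          functor_iso K F (sub_functor (module_scheme K V) N) \<noteq> {})"

end

theory Submission
  imports Defs
begin

text \<open>
  The proposition comes down to one fact: if some \<open>w\<close> in \<open>M\<^sup>*(T)\<close>, for an \<open>S\<close>-algebra \<open>T\<close>, takes different values at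
  two elements of \<open>M(S)\<close>, then so does some element of \<open>M\<^sup>*(K)\<close>. This is the lemma \<open>dual_separates_over_base\<close>. For
  every \<open>K\<close>-algebra \<open>U\<close>, sending \<open>m\<close> to \<open>w\<close> applied to its image in \<open>M(T \<otimes> U)\<close> is a map \<open>M(U) \<rightarrow> T \<otimes> U\<close> that is linear
  over \<open>U\<close> and natural in \<open>U\<close>. Hence \<open>w\<close> and a \<open>K\<close>-linear functional \<open>\<phi>\<close> on \<open>T\<close> together give the element
  \<open>(\<phi> \<otimes> id) \<circ> w\<close> of \<open>M\<^sup>*(K)\<close>. At \<open>U = S\<close> nothing is lost: the multiplication \<open>T \<otimes> S \<rightarrow> T\<close> recovers the original
  values, so the two elements have different images in \<open>T \<otimes> S\<close>; and as \<open>K\<close> is a field, the maps \<open>\<phi> \<otimes> id\<close> separate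
  the points of \<open>T \<otimes> S\<close> (\<open>contract_separates_points\<close>).

  Consequently \<open>M\<close> is separated iff \<open>M\<^sup>*(K)\<close> separates the points of every \<open>M(S)\<close> (\<open>separated_iff\<close>), which is injectivity
  of \<open>m \<mapsto> (w \<mapsto> w(m))\<close>. The target of this map is identified with the module scheme of \<open>M\<^sup>*(K)\<close> by the universal
  property of the tensor product (\<open>scheme_to_lin_iso\<close>). If the map is injective, its image is a copy of \<open>M\<close> in that
  module scheme. Conversely, a functor that embeds into the module scheme of a vector space \<open>V\<close> is separated, since evaluations at the
  elements of \<open>V\<close> belong to \<open>M\<^sup>*(K)\<close> and separate points (\<open>submodule_of_scheme_separated\<close>).

  The functor \<open>M\<close> is only defined on algebras with carrier in \<open>'u\<close>. So the tensor product of two algebras has to be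
  transported into \<open>'u\<close>, which is possible for cardinality reasons as \<open>'u\<close> is infinite (\<open>inj_on_coset_code\<close>).
\<close>

section \<open>Commutative algebras and restriction of scalars\<close>

lemma cring_cong:
  assumes "cring R" "carrier R' = carrier R" "monoid.mult R' = monoid.mult R" "one R' = one R"
    "ring.zero R' = ring.zero R" "ring.add R' = ring.add R"
  shows "cring R'"
proof -
  interpret cring R by fact
  show ?thesis
  proof (rule cringI)
    show "abelian_group R'"
      by (rule abelian_groupI) (auto simp: assms(2-) a_ac intro: bexI[of _ "\<ominus>\<^bsub>R\<^esub> _"] l_neg)
    show "comm_monoid R'"
      by (rule comm_monoidI) (auto simp: assms(2-) m_ac)
  qed (auto simp: assms(2-) l_distr)
qed

lemma comm_algD:
  assumes "comm_alg A S"
  shows "algebra A S" "module A S" "cring A" "cring S"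
  using assms unfolding comm_alg_def
  by (auto intro: algebra.module algebra.R_cring algebra.M_cring)

lemma comm_algI:
  assumes "cring A" "cring S" "smult S \<in> extensional (carrier A)"
    "\<And>a. a \<in> carrier A \<Longrightarrow> smult S a \<in> extensional (carrier S)"
    "\<eta> \<in> ring_hom A S" "\<And>a x. a \<in> carrier A \<Longrightarrow> x \<in> carrier S \<Longrightarrow> a \<odot>\<^bsub>S\<^esub> x = \<eta> a \<otimes>\<^bsub>S\<^esub> x"
  shows "comm_alg A S"
proof -
  interpret A: cring A by fact
  interpret S: cring S by fact
  have [simp]: "\<eta> a \<in> carrier S" if "a \<in> carrier A" for a
    using assms(5) that by (rule ring_hom_closed)
  have "algebra A S"
    by (rule algebraI)
       (use assms(5) in \<open>auto simp: assms(6) A.cring_axioms S.cring_axioms S.l_distr S.r_distr S.m_assoc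
         ring_hom_add ring_hom_mult ring_hom_one\<close>)
  then show ?thesis using assms(3,4) by (auto simp: comm_alg_def)
qed

lemma comm_alg_change_base:
  assumes "comm_alg R S" "carrier R' = carrier R" "monoid.mult R' = monoid.mult R" "one R' = one R"
    "ring.zero R' = ring.zero R" "ring.add R' = ring.add R"
  shows "comm_alg R' S"
proof -
  interpret algebra R S using assms(1) by (rule comm_algD)
  have "algebra R' S"
    by (rule algebraI)
       (auto simp: assms(2-) smult_l_distr smult_r_distr smult_assoc1 smult_assoc2 M_cring
          intro!: cring_cong[OF R_cring])
  then show ?thesis using assms by (simp add: comm_alg_def)
qed

text \<open>
  Self algebras and restrictions of scalars change the record of the base ring but none of its ring
  operations, and the category of algebras over a ring depends on these only.
\<close>

lemma comm_alg_cong: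
  assumes "carrier R' = carrier R" "monoid.mult R' = monoid.mult R" "one R' = one R"
    "ring.zero R' = ring.zero R" "ring.add R' = ring.add R"
  shows "comm_alg R' S = comm_alg R S"
  using comm_alg_change_base[of R S R'] comm_alg_change_base[of R' S R] assms by metis

lemma ring_simps_self_alg [simp]:
  "carrier (self_alg R) = carrier R" "monoid.mult (self_alg R) = monoid.mult R"
  "one (self_alg R) = one R" "ring.zero (self_alg R) = ring.zero R" "ring.add (self_alg R) = ring.add R"
  by (simp_all add: self_alg_def)

lemma smult_self_alg [simp]:
  "a \<in> carrier R \<Longrightarrow> x \<in> carrier R \<Longrightarrow> a \<odot>\<^bsub>self_alg R\<^esub> x = a \<otimes>\<^bsub>R\<^esub> x"
  by (simp add: self_alg_def)

lemma ring_simps_restrict_scalars [simp]: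
  "carrier (restrict_scalars A f T) = carrier T"
  "monoid.mult (restrict_scalars A f T) = monoid.mult T"
  "one (restrict_scalars A f T) = one T" "ring.zero (restrict_scalars A f T) = ring.zero T"
  "ring.add (restrict_scalars A f T) = ring.add T"
  by (simp_all add: restrict_scalars_def)

lemma smult_restrict_scalars [simp]:
  "a \<in> carrier A \<Longrightarrow> x \<in> carrier T \<Longrightarrow> a \<odot>\<^bsub>restrict_scalars A f T\<^esub> x = f a \<odot>\<^bsub>T\<^esub> x"
  by (simp add: restrict_scalars_def)

lemma comm_alg_self_alg_base [simp]: "comm_alg (self_alg R) = comm_alg R"
  by (intro ext comm_alg_cong) simp_all

lemma comm_alg_restrict_scalars_base [simp]: "comm_alg (restrict_scalars A f T) = comm_alg T"
  by (intro ext comm_alg_cong) simp_all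

lemma self_alg_restrict_scalars [simp]: "self_alg (restrict_scalars A f T) = self_alg T"
  by (simp add: self_alg_def)

lemma comm_alg_self_alg: "cring R \<Longrightarrow> comm_alg R (self_alg R)"
  by (rule comm_algI[where \<eta>="\<lambda>x. x"])
     (auto simp: self_alg_def ring_hom_def intro: cring_cong)

lemma unit_map_hom: "comm_alg A S \<Longrightarrow> unit_map A S \<in> ring_hom A S"
proof -
  assume *: "comm_alg A S"
  interpret algebra A S using * by (rule comm_algD)
  show ?thesis
    by (auto simp: unit_map_def ring_hom_def smult_l_distr smult_assoc2 smult_assoc1)
qed

lemma unit_map_closed [simp]:
  "comm_alg A S \<Longrightarrow> a \<in> carrier A \<Longrightarrow> unit_map A S a \<in> carrier S"
  by (meson unit_map_hom ring_hom_closed)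

lemma unit_map_mult:
  assumes "comm_alg A S" "a \<in> carrier A" "x \<in> carrier S"
  shows "unit_map A S a \<otimes>\<^bsub>S\<^esub> x = a \<odot>\<^bsub>S\<^esub> x"
proof -
  interpret algebra A S using assms(1) by (rule comm_algD)
  show ?thesis using assms by (simp add: unit_map_def smult_assoc2)
qed

lemma module_eqI:
  fixes S T :: "('a, 'b) module"
  assumes "carrier S = carrier T" "monoid.mult S = monoid.mult T" "one S = one T"
    "ring.zero S = ring.zero T" "ring.add S = ring.add T" "smult S = smult T"
  shows "S = T"
  using assms by (cases S; cases T) simp

text \<open>
  Because scalar multiplication is extensional, two algebras on the same ring are equal, and not just
  isomorphic, as soon as the scalar multiplications agree on the carriers. All the strictness
  statements about restriction of scalars below come from here.
\<close>

lemma comm_alg_eqI: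
  fixes S T :: "('a, 'b) module"
  assumes "comm_alg A S" "comm_alg A T" "carrier S = carrier T" "monoid.mult S = monoid.mult T"
    "one S = one T" "ring.zero S = ring.zero T" "ring.add S = ring.add T"
    "\<And>a x. a \<in> carrier A \<Longrightarrow> x \<in> carrier S \<Longrightarrow> a \<odot>\<^bsub>S\<^esub> x = a \<odot>\<^bsub>T\<^esub> x"
  shows "S = T"
proof (rule module_eqI)
  show "smult S = smult T"
  proof (rule extensionalityI)
    fix a assume a: "a \<in> carrier A"
    show "smult S a = smult T a"
      by (rule extensionalityI[where A="carrier S"]) (use a assms in \<open>auto simp: comm_alg_def\<close>)
  qed (use assms in \<open>auto simp: comm_alg_def\<close>)
qed (use assms in auto)

lemma comm_alg_restrict_scalars:
  assumes "cring A" "f \<in> ring_hom A S" "comm_alg S T"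
  shows "comm_alg A (restrict_scalars A f T)"
proof (rule comm_algI[where \<eta>="\<lambda>a. unit_map S T (f a)"])
  show "cring (restrict_scalars A f T)"
    by (rule cring_cong[OF comm_algD(4)[OF assms(3)]]) simp_all
  show "(\<lambda>a. unit_map S T (f a)) \<in> ring_hom A (restrict_scalars A f T)"
    using assms(2) unit_map_hom[OF assms(3)]
    by (auto simp: ring_hom_def Pi_iff)
qed (use assms in \<open>auto simp: ring_hom_closed unit_map_mult restrict_scalars_def\<close>)

lemma comm_alg_restrict_unit:
  assumes "comm_alg K S" "comm_alg S T"
  shows "comm_alg K (restrict_scalars K (unit_map K S) T)"
  using comm_alg_restrict_scalars[OF comm_algD(3)[OF assms(1)] unit_map_hom[OF assms(1)] assms(2)] .

lemma alg_homD:
  assumes "f \<in> alg_hom A S T"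
  shows "f \<in> ring_hom S T" "f \<in> extensional (carrier S)" "x \<in> carrier S \<Longrightarrow> f x \<in> carrier T"
    "a \<in> carrier A \<Longrightarrow> x \<in> carrier S \<Longrightarrow> f (a \<odot>\<^bsub>S\<^esub> x) = a \<odot>\<^bsub>T\<^esub> f x"
  using assms by (auto simp: alg_hom_def ring_hom_closed)

text \<open>
  Scalar multiplication is multiplication by the image of the unit map, so a ring homomorphism
  is linear as soon as it commutes with the unit maps.
\<close>

lemma alg_homI:
  assumes "comm_alg A S" "comm_alg A T" "f \<in> ring_hom S T" "f \<in> extensional (carrier S)"
    "\<And>a. a \<in> carrier A \<Longrightarrow> f (unit_map A S a) = unit_map A T a"
  shows "f \<in> alg_hom A S T"
proof -
  have "f (a \<odot>\<^bsub>S\<^esub> x) = a \<odot>\<^bsub>T\<^esub> f x" if "a \<in> carrier A" "x \<in> carrier S" for a x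
    using that assms ring_hom_mult[OF assms(3), of "unit_map A S a" x] ring_hom_closed[OF assms(3)]
    by (simp add: unit_map_mult)
  then show ?thesis using assms by (auto simp: alg_hom_def)
qed

lemma alg_hom_unit_map:
  assumes "comm_alg A S" "comm_alg A T" "f \<in> alg_hom A S T" "a \<in> carrier A"
  shows "f (unit_map A S a) = unit_map A T a"
proof -
  interpret S: algebra A S by (rule comm_algD) fact
  show ?thesis using alg_homD(4)[OF assms(3,4), of "\<one>\<^bsub>S\<^esub>"] assms(4) alg_homD(1)[OF assms(3)]
    by (simp add: unit_map_def ring_hom_one)
qed

lemma alg_hom_self_alg [simp]: "alg_hom (self_alg K) = alg_hom K"
  by (intro ext) (simp add: alg_hom_def)

lemma self_alg_self_alg [simp]: "self_alg (self_alg R) = self_alg R"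
  by (simp add: self_alg_def)

lemma unit_map_self_alg_base [simp]: "unit_map (self_alg K) = unit_map K"
  by (intro ext) (simp add: unit_map_def)

lemma unit_map_self_alg:
  assumes "cring R"
  shows "unit_map R (self_alg R) = (\<lambda>x\<in>carrier R. x)"
proof -
  interpret cring R by fact
  show ?thesis by (auto simp: unit_map_def intro!: restrict_ext)
qed

lemma restrict_scalars_unit_self_alg [simp]:
  assumes "comm_alg K S"
  shows "restrict_scalars K (unit_map K S) (self_alg S) = S"
proof (rule comm_alg_eqI[where A=K])
  show "comm_alg K (restrict_scalars K (unit_map K S) (self_alg S))"
    using assms comm_algD comm_alg_self_alg comm_alg_restrict_unit by blast
qed (use assms in \<open>auto simp: unit_map_mult\<close>)

lemma restrict_scalars_unit_base [simp]:
  assumes "comm_alg K S"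
  shows "restrict_scalars K (unit_map K (self_alg K)) S = S"
proof -
  have K: "cring K" using assms by (rule comm_algD)
  show ?thesis
  proof (rule comm_alg_eqI[where A=K])
    show "comm_alg K (restrict_scalars K (unit_map K (self_alg K)) S)"
      using comm_alg_restrict_unit[OF comm_alg_self_alg[OF K], of S] assms by simp
  qed (use assms K in \<open>auto simp: unit_map_self_alg\<close>)
qed

text \<open>
  Restriction along \<open>K \<rightarrow> S \<rightarrow> S'\<close> in two steps and in one step gives the same algebra. This
  equality is what makes \<^term>\<open>farr (dual K F)\<close> land in the right functor.
\<close>

lemma restrict_scalars_alg_hom:
  assumes "comm_alg K S" "comm_alg K S'" "f \<in> alg_hom K S S'" "comm_alg S' T"
  shows "restrict_scalars K (unit_map K S) (restrict_scalars S f T)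
    = restrict_scalars K (unit_map K S') T"
proof (rule comm_alg_eqI[where A=K])
  have T: "comm_alg S (restrict_scalars S f T)"
    using assms alg_homD(1) comm_algD(4) comm_alg_restrict_scalars by blast
  show "comm_alg K (restrict_scalars K (unit_map K S) (restrict_scalars S f T))"
    using comm_alg_restrict_unit[OF assms(1) T] .
  show "comm_alg K (restrict_scalars K (unit_map K S') T)"
    using comm_alg_restrict_unit[OF assms(2,4)] .
qed (use assms in \<open>auto simp: alg_hom_unit_map\<close>)

lemma unit_map_restrict_scalars:
  assumes "comm_alg K T" "comm_alg T U" "a \<in> carrier K"
  shows "unit_map K (restrict_scalars K (unit_map K T) U) a = unit_map T U (unit_map K T a)"
proof -
  interpret U: algebra T U using assms(2) by (rule comm_algD)
  have "unit_map K T a \<in> carrier T" using assms by simp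
  then show ?thesis using assms(3)
    unfolding unit_map_def[of K "restrict_scalars K (unit_map K T) U"] unit_map_def[of T U] by simp
qed

lemma unit_map_alg_hom:
  assumes "comm_alg K S" "comm_alg S T"
  shows "unit_map S T \<in> alg_hom K S (restrict_scalars K (unit_map K S) T)"
proof (rule alg_homI)
  show "comm_alg K (restrict_scalars K (unit_map K S) T)"
    using assms by (rule comm_alg_restrict_unit)
  show "unit_map S T \<in> ring_hom S (restrict_scalars K (unit_map K S) T)"
    using unit_map_hom[OF assms(2)] by (simp add: ring_hom_def)
  show "unit_map S T (unit_map K S a) = unit_map K (restrict_scalars K (unit_map K S) T) a"
    if "a \<in> carrier K" for a
    using unit_map_restrict_scalars[OF assms that] by simp
qed (use assms in \<open>auto simp: unit_map_def\<close>)

lemma unit_map_alg_hom_self: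
  assumes "comm_alg S T"
  shows "unit_map S T \<in> alg_hom S (self_alg S) T"
  using unit_map_alg_hom[OF comm_alg_self_alg[OF comm_algD(3)[OF assms]], of T] assms by simp

lemma alg_hom_restrict_scalars:
  assumes "cring A" "f \<in> ring_hom A S" "comm_alg S T" "comm_alg S U" "g \<in> alg_hom S T U"
  shows "g \<in> alg_hom A (restrict_scalars A f T) (restrict_scalars A f U)"
  using assms unfolding alg_hom_def by (auto simp: ring_hom_def Pi_iff)

lemma alg_hom_id:
  assumes "comm_alg A S"
  shows "(\<lambda>x\<in>carrier S. x) \<in> alg_hom A S S"
proof -
  interpret algebra A S using assms by (rule comm_algD)
  show ?thesis by (auto simp: alg_hom_def ring_hom_def)
qed

lemma alg_hom_compose:
  assumes "comm_alg A S" "f \<in> alg_hom A S T" "g \<in> alg_hom A T U"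
  shows "compose (carrier S) g f \<in> alg_hom A S U"
proof -
  interpret algebra A S using assms(1) by (rule comm_algD)
  show ?thesis using assms(2,3)
    by (auto simp: alg_hom_def ring_hom_def compose_eq Pi_iff)
qed

lemma restrict_scalars_id:
  assumes "comm_alg S T"
  shows "restrict_scalars S (\<lambda>x\<in>carrier S. x) T = T"
proof (rule comm_alg_eqI[where A=S])
  have S: "cring S" using assms by (rule comm_algD)
  have "(\<lambda>x\<in>carrier S. x) \<in> ring_hom S S"
    using alg_homD(1)[OF alg_hom_id[OF comm_alg_self_alg[OF S]]] by (simp add: ring_hom_def)
  then show "comm_alg S (restrict_scalars S (\<lambda>x\<in>carrier S. x) T)"
    using S assms by (intro comm_alg_restrict_scalars)
qed (use assms in auto)

lemma restrict_scalars_compose: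
  assumes S: "comm_alg K S" and S': "comm_alg K S'" and f: "f \<in> alg_hom K S S'"
    and g: "g \<in> alg_hom K S' U" and T: "comm_alg U T"
  shows "restrict_scalars S f (restrict_scalars S' g T) =
    restrict_scalars S (compose (carrier S) g f) T"
proof (rule comm_alg_eqI[where A=S])
  have cS: "cring S" "cring S'" using S S' by (simp_all add: comm_algD)
  show "comm_alg S (restrict_scalars S f (restrict_scalars S' g T))"
    by (rule comm_alg_restrict_scalars[OF cS(1) alg_homD(1)[OF f]
          comm_alg_restrict_scalars[OF cS(2) alg_homD(1)[OF g] T]])
  show "comm_alg S (restrict_scalars S (compose (carrier S) g f) T)"
    by (rule comm_alg_restrict_scalars[OF cS(1) alg_homD(1)[OF alg_hom_compose[OF S f g]] T])
qed (use alg_homD(3)[OF f] in \<open>auto simp: compose_eq\<close>)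

section \<open>Functors of modules and their duals\<close>

lemma module_change_base:
  assumes "module R S" "carrier R' = carrier R" "monoid.mult R' = monoid.mult R" "one R' = one R"
    "ring.zero R' = ring.zero R" "ring.add R' = ring.add R"
  shows "module R' S"
proof -
  interpret module R S by fact
  show ?thesis
    by (rule moduleI)
       (auto simp: assms(2-) smult_l_distr smult_r_distr smult_assoc1 abelian_group_axioms
          intro!: cring_cong[OF R.cring_axioms])
qed

lemma module_functorD:
  assumes "module_functor A F" "comm_alg A S"
  shows "module S (fobj F S)"
    "m \<in> carrier (fobj F S) \<Longrightarrow> farr F S S (\<lambda>x\<in>carrier S. x) m = m"
  using assms by (simp_all add: module_functor_def)

lemma module_functor_arr:
  assumes "module_functor A F" "comm_alg A S" "comm_alg A T" "f \<in> alg_hom A S T"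
  shows "m \<in> carrier (fobj F S) \<Longrightarrow> farr F S T f m \<in> carrier (fobj F T)"
    "m \<in> carrier (fobj F S) \<Longrightarrow> n \<in> carrier (fobj F S) \<Longrightarrow>
       farr F S T f (m \<oplus>\<^bsub>fobj F S\<^esub> n) = farr F S T f m \<oplus>\<^bsub>fobj F T\<^esub> farr F S T f n"
    "s \<in> carrier S \<Longrightarrow> m \<in> carrier (fobj F S) \<Longrightarrow>
       farr F S T f (s \<odot>\<^bsub>fobj F S\<^esub> m) = f s \<odot>\<^bsub>fobj F T\<^esub> farr F S T f m"
  using assms unfolding module_functor_def by (metis (no_types, lifting) Pi_mem)+

lemma module_functor_comp:
  assumes "module_functor A F" "comm_alg A S" "comm_alg A T" "comm_alg A U"
    "f \<in> alg_hom A S T" "g \<in> alg_hom A T U" "m \<in> carrier (fobj F S)"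
  shows "farr F T U g (farr F S T f m) = farr F S U (compose (carrier S) g f) m"
  using assms unfolding module_functor_def by (metis (no_types, lifting))

lemma base_functor_simps [simp]: "fobj base_functor = self_alg" "farr base_functor S T f = f"
  by (simp_all add: base_functor_def)

lemma restrict_functor_simps [simp]:
  "fobj (restrict_functor K S F) T = fobj F (restrict_scalars K (unit_map K S) T)"
  "farr (restrict_functor K S F) T T' =
     farr F (restrict_scalars K (unit_map K S) T) (restrict_scalars K (unit_map K S) T')"
  by (simp_all add: restrict_functor_def)

lemma module_functor_restrict:
  assumes S: "comm_alg K S" and F: "module_functor K F"
  shows "module_functor S (restrict_functor K S F)"
proof -
  let ?r = "restrict_scalars K (unit_map K S)"
  have r: "comm_alg K (?r T)" if "comm_alg S T" for T
    using comm_alg_restrict_unit[OF S that] .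
  have h: "f \<in> alg_hom K (?r T) (?r U)" if "comm_alg S T" "comm_alg S U" "f \<in> alg_hom S T U" for T U f
    using alg_hom_restrict_scalars[OF comm_algD(3)[OF S] unit_map_hom[OF S] that] .
  note a = module_functor_arr[OF F r r h]
  note c = module_functor_comp[OF F r r r h h, symmetric]
  have m: "module T (fobj F (?r T))" if "comm_alg S T" for T
    using module_functorD(1)[OF F r[OF that]] by (rule module_change_base) simp_all
  show ?thesis
    unfolding module_functor_def restrict_functor_simps
    using a c m module_functorD(2)[OF F r] by (auto simp: Pi_iff)
qed

lemma functor_hom_eqI:
  fixes A :: "('u, 'b) ring_scheme"
  assumes "w \<in> functor_hom A F G" "w' \<in> functor_hom A F G"
    "\<And>S m. comm_alg A S \<Longrightarrow> m \<in> carrier (fobj F S) \<Longrightarrow> w S m = w' S m"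
  shows "w = w'"
proof (rule extensionalityI)
  fix S :: "('u, 'u) module" assume "S \<in> {S. comm_alg A S}"
  then show "w S = w' S"
    using assms by (intro extensionalityI[of _ "carrier (fobj F S)"]) (auto simp: functor_hom_def mod_hom_def)
qed (use assms in \<open>auto simp: functor_hom_def\<close>)

lemma functor_homD:
  assumes "w \<in> functor_hom A F G" "comm_alg A S"
  shows "m \<in> carrier (fobj F S) \<Longrightarrow> w S m \<in> carrier (fobj G S)"
    "m \<in> carrier (fobj F S) \<Longrightarrow> n \<in> carrier (fobj F S) \<Longrightarrow>
      w S (m \<oplus>\<^bsub>fobj F S\<^esub> n) = w S m \<oplus>\<^bsub>fobj G S\<^esub> w S n"
    "s \<in> carrier S \<Longrightarrow> m \<in> carrier (fobj F S) \<Longrightarrow>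
      w S (s \<odot>\<^bsub>fobj F S\<^esub> m) = s \<odot>\<^bsub>fobj G S\<^esub> w S m"
    "w S \<in> extensional (carrier (fobj F S))"
  using assms by (auto simp: functor_hom_def mod_hom_def)

lemma functor_hom_natural:
  assumes "w \<in> functor_hom A F G" "comm_alg A S" "comm_alg A T" "f \<in> alg_hom A S T"
    "m \<in> carrier (fobj F S)"
  shows "w T (farr F S T f m) = farr G S T f (w S m)"
  using assms by (auto simp: functor_hom_def)

lemma functor_homI:
  assumes "\<And>S m. comm_alg A S \<Longrightarrow> m \<in> carrier (fobj F S) \<Longrightarrow> w S m \<in> carrier (fobj G S)"
    "\<And>S m n. comm_alg A S \<Longrightarrow> m \<in> carrier (fobj F S) \<Longrightarrow> n \<in> carrier (fobj F S) \<Longrightarrow>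
      w S (m \<oplus>\<^bsub>fobj F S\<^esub> n) = w S m \<oplus>\<^bsub>fobj G S\<^esub> w S n"
    "\<And>S s m. comm_alg A S \<Longrightarrow> s \<in> carrier S \<Longrightarrow> m \<in> carrier (fobj F S) \<Longrightarrow>
      w S (s \<odot>\<^bsub>fobj F S\<^esub> m) = s \<odot>\<^bsub>fobj G S\<^esub> w S m"
    "\<And>S T f m. comm_alg A S \<Longrightarrow> comm_alg A T \<Longrightarrow> f \<in> alg_hom A S T \<Longrightarrow> m \<in> carrier (fobj F S) \<Longrightarrow>
      w T (farr F S T f m) = farr G S T f (w S m)"
    "w \<in> extensional {S. comm_alg A S}"
    "\<And>S. comm_alg A S \<Longrightarrow> w S \<in> extensional (carrier (fobj F S))"
  shows "w \<in> functor_hom A F G"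
  using assms by (auto simp: functor_hom_def mod_hom_def)

lemma base_homD:
  assumes "w \<in> functor_hom A F base_functor" "comm_alg A S"
  shows "m \<in> carrier (fobj F S) \<Longrightarrow> w S m \<in> carrier S"
    "m \<in> carrier (fobj F S) \<Longrightarrow> n \<in> carrier (fobj F S) \<Longrightarrow>
      w S (m \<oplus>\<^bsub>fobj F S\<^esub> n) = w S m \<oplus>\<^bsub>S\<^esub> w S n"
    "s \<in> carrier S \<Longrightarrow> m \<in> carrier (fobj F S) \<Longrightarrow>
      w S (s \<odot>\<^bsub>fobj F S\<^esub> m) = s \<otimes>\<^bsub>S\<^esub> w S m"
  using functor_homD[OF assms] by simp_all

text \<open>
  Elements of a dual are given by a formula \<open>w\<close>. The restrictions add the extensionality, and
  closure of \<open>F\<close> under its operations ensures that they do not disturb the other conditions.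
\<close>

lemma base_homI:
  assumes F: "module_functor A F"
    and "\<And>S m. comm_alg A S \<Longrightarrow> m \<in> carrier (fobj F S) \<Longrightarrow> w S m \<in> carrier S"
    "\<And>S m n. comm_alg A S \<Longrightarrow> m \<in> carrier (fobj F S) \<Longrightarrow> n \<in> carrier (fobj F S) \<Longrightarrow>
      w S (m \<oplus>\<^bsub>fobj F S\<^esub> n) = w S m \<oplus>\<^bsub>S\<^esub> w S n"
    "\<And>S s m. comm_alg A S \<Longrightarrow> s \<in> carrier S \<Longrightarrow> m \<in> carrier (fobj F S) \<Longrightarrow>
      w S (s \<odot>\<^bsub>fobj F S\<^esub> m) = s \<otimes>\<^bsub>S\<^esub> w S m"
    "\<And>S T f m. comm_alg A S \<Longrightarrow> comm_alg A T \<Longrightarrow> f \<in> alg_hom A S T \<Longrightarrow> m \<in> carrier (fobj F S) \<Longrightarrow>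
      w T (farr F S T f m) = f (w S m)"
  shows "(\<lambda>S\<in>{S. comm_alg A S}. \<lambda>m\<in>carrier (fobj F S). w S m) \<in> functor_hom A F base_functor"
proof -
  have c: "m \<oplus>\<^bsub>fobj F S\<^esub> n \<in> carrier (fobj F S)" "s \<odot>\<^bsub>fobj F S\<^esub> m \<in> carrier (fobj F S)"
    if "comm_alg A S" "m \<in> carrier (fobj F S)" "n \<in> carrier (fobj F S)" "s \<in> carrier S" for S s m n
  proof -
    interpret module S "fobj F S" using module_functorD(1)[OF F that(1)] .
    show "m \<oplus>\<^bsub>fobj F S\<^esub> n \<in> carrier (fobj F S)" "s \<odot>\<^bsub>fobj F S\<^esub> m \<in> carrier (fobj F S)"
      using that by auto
  qed
  have "m \<oplus>\<^bsub>fobj F S\<^esub> n \<in> carrier (fobj F S)"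
    if "comm_alg A S" "m \<in> carrier (fobj F S)" "n \<in> carrier (fobj F S)" for S m n
    using c(1)[OF that] comm_algD(4)[OF that(1)] cring.cring_simprules(2) by blast
  with c show ?thesis
    using assms(2-) module_functor_arr(1)[OF F] by (intro functor_homI) simp_all
qed

lemma dual_simps [simp]:
  "carrier (fobj (dual K F) S) = functor_hom S (restrict_functor K S F) base_functor"
  "farr (dual K F) S S' f w = (\<lambda>T\<in>{T. comm_alg S' T}. w (restrict_scalars S f T))"
  by (simp_all add: dual_def Let_def)

lemma dual_apply:
  assumes "comm_alg S T" "m \<in> carrier (fobj F (restrict_scalars K (unit_map K S) T))"
  shows "\<zero>\<^bsub>fobj (dual K F) S\<^esub> T m = \<zero>\<^bsub>T\<^esub>"
    "(w \<oplus>\<^bsub>fobj (dual K F) S\<^esub> w') T m = w T m \<oplus>\<^bsub>T\<^esub> w' T m"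
    "(s \<odot>\<^bsub>fobj (dual K F) S\<^esub> w) T m = s \<odot>\<^bsub>T\<^esub> w T m"
  using assms by (simp_all add: dual_def Let_def)

text \<open>
  The operations are pointwise in algebras, so the axioms are those of each algebra \<open>T\<close>; the work is to
  see that sums and multiples of morphisms are again morphisms.
\<close>

lemma module_dual:
  assumes S: "comm_alg K S" and F: "module_functor K F"
  shows "module S (fobj (dual K F) S)"
proof -
  let ?D = "fobj (dual K F) S"
  let ?F = "restrict_functor K S F"
  have F': "module_functor S ?F" using S F by (rule module_functor_restrict)
  have S': "cring S" using S by (rule comm_algD)
  interpret S: cring S by fact
  have zero: "\<zero>\<^bsub>?D\<^esub> \<in> carrier ?D"
  proof -
    have "(\<lambda>T\<in>{T. comm_alg S T}. \<lambda>m\<in>carrier (fobj ?F T). \<zero>\<^bsub>T\<^esub>) \<in> functor_hom S ?F base_functor"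
    proof (rule base_homI[OF F'], goal_cases)
      case (1 T m) then interpret algebra S T by (simp add: comm_algD)
      show ?case by simp
    next
      case (2 T m) then interpret algebra S T by (simp add: comm_algD)
      show ?case by simp
    next
      case (3 T m) then interpret algebra S T by (simp add: comm_algD)
      show ?case using 3 by simp
    next
      case (4 T U f m)
      then show ?case using alg_homD(1) comm_algD(4)[of S, THEN cring.axioms(1)] ring_hom_zero
        by (metis)
    qed
    then show ?thesis by (simp add: dual_def Let_def)
  qed
  have add: "w \<oplus>\<^bsub>?D\<^esub> w' \<in> carrier ?D" if "w \<in> carrier ?D" "w' \<in> carrier ?D" for w w'
  proof -
    have ww: "w \<in> functor_hom S ?F base_functor" "w' \<in> functor_hom S ?F base_functor"
      using that by simp_all
    note d = base_homD[OF ww(1)] base_homD[OF ww(2)]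
    have "(\<lambda>T\<in>{T. comm_alg S T}. \<lambda>m\<in>carrier (fobj ?F T). w T m \<oplus>\<^bsub>T\<^esub> w' T m)
        \<in> functor_hom S ?F base_functor"
    proof (rule base_homI[OF F'], goal_cases)
      case (1 T m) then interpret algebra S T by (simp add: comm_algD)
      show ?case using 1 d by simp
    next
      case (2 T m n) then interpret algebra S T by (simp add: comm_algD)
      show ?case using 2 d[OF 2(1)] by (simp add: M.add.m_ac del: restrict_functor_simps)
    next
      case (3 T t m) then interpret T: cring T by (simp add: comm_algD)
      show ?case using 3 d[OF 3(1)] by (simp add: T.r_distr del: restrict_functor_simps)
    next
      case (4 T U f m)
      then show ?case
        using functor_hom_natural[OF ww(1) 4] functor_hom_natural[OF ww(2) 4] d[OF 4(1)]
          ring_hom_add[OF alg_homD(1)[OF 4(3)]] by (simp del: restrict_functor_simps)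
    qed
    then show ?thesis by (simp add: dual_def Let_def)
  qed
  have smult: "s \<odot>\<^bsub>?D\<^esub> w \<in> carrier ?D" if "s \<in> carrier S" "w \<in> carrier ?D" for s w
  proof -
    have ww: "w \<in> functor_hom S ?F base_functor"
      using that by simp
    note d = base_homD[OF ww]
    have "(\<lambda>T\<in>{T. comm_alg S T}. \<lambda>m\<in>carrier (fobj ?F T). s \<odot>\<^bsub>T\<^esub> w T m)
        \<in> functor_hom S ?F base_functor"
    proof (rule base_homI[OF F'], goal_cases)
      case (1 T m) then interpret algebra S T by (simp add: comm_algD)
      show ?case using 1 d \<open>s \<in> carrier S\<close> by simp
    next
      case (2 T m n) then interpret algebra S T by (simp add: comm_algD)
      show ?case using 2 d[OF 2(1)] \<open>s \<in> carrier S\<close> by (simp add: smult_r_distr del: restrict_functor_simps)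
    next
      case (3 T t m)
      interpret T: cring T using 3 by (simp add: comm_algD)
      interpret algebra S T using 3 by (simp add: comm_algD)
      show ?case using 3 d[OF 3(1)] \<open>s \<in> carrier S\<close>
        by (metis T.m_comm smult_assoc2 smult_closed)
    next
      case (4 T U f m)
      then show ?case
        using functor_hom_natural[OF ww 4] d[OF 4(1)] \<open>s \<in> carrier S\<close>
          alg_homD(4)[OF 4(3)] by (simp del: restrict_functor_simps)
    qed
    then show ?thesis by (simp add: dual_def Let_def)
  qed
  have eqI: "w = w'" if "w \<in> carrier ?D" "w' \<in> carrier ?D"
    "\<And>T m. \<lbrakk>comm_alg S T; m \<in> carrier (fobj ?F T)\<rbrakk> \<Longrightarrow> w T m = w' T m" for w w'
    using that by (auto intro: functor_hom_eqI[of _ S ?F base_functor])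
  have d: "w T m \<in> carrier T" if "w \<in> carrier ?D" "comm_alg S T" "m \<in> carrier (fobj ?F T)" for w T m
    using base_homD(1)[of w S ?F T m] that by simp
  note dual_apply = dual_apply[where F=F and K=K, folded restrict_functor_simps]
  have alg: "algebra S T" if "comm_alg S T" for T using that by (rule comm_algD)
  have T: "cring T" if "comm_alg S T" for T using that by (rule comm_algD)
  have neg: "(\<ominus>\<^bsub>S\<^esub> \<one>\<^bsub>S\<^esub>) \<odot>\<^bsub>T\<^esub> x \<oplus>\<^bsub>T\<^esub> x = \<zero>\<^bsub>T\<^esub>" if "comm_alg S T" "x \<in> carrier T" for T x
  proof -
    interpret algebra S T using that by (simp add: comm_algD)
    show ?thesis using that by (simp add: smult_l_minus M.l_neg)
  qed
  note [simp del] = dual_simps restrict_functor_simps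
  show ?thesis
  proof (rule moduleI[OF S'])
    show "abelian_group ?D"
    proof (rule abelian_groupI)
      fix x assume x: "x \<in> carrier ?D"
      show "\<exists>y\<in>carrier ?D. y \<oplus>\<^bsub>?D\<^esub> x = \<zero>\<^bsub>?D\<^esub>"
        by (rule bexI[of _ "(\<ominus>\<^bsub>S\<^esub> \<one>\<^bsub>S\<^esub>) \<odot>\<^bsub>?D\<^esub> x"])
           (use x d[OF x] in \<open>auto intro!: eqI add zero smult simp: dual_apply neg\<close>)
      show "\<zero>\<^bsub>?D\<^esub> \<oplus>\<^bsub>?D\<^esub> x = x"
        by (rule eqI)
           (use x d[OF x] in \<open>auto intro!: add zero smult cring.cring_simprules T simp: dual_apply\<close>)
      fix y assume y: "y \<in> carrier ?D"
      show "x \<oplus>\<^bsub>?D\<^esub> y = y \<oplus>\<^bsub>?D\<^esub> x"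
        by (rule eqI)
           (use x y d[OF x] d[OF y] in \<open>auto intro!: add cring.cring_simprules(10) T simp: dual_apply\<close>)
      fix z assume z: "z \<in> carrier ?D"
      show "(x \<oplus>\<^bsub>?D\<^esub> y) \<oplus>\<^bsub>?D\<^esub> z = x \<oplus>\<^bsub>?D\<^esub> (y \<oplus>\<^bsub>?D\<^esub> z)"
        by (rule eqI)
           (use x y z d[OF x] d[OF y] d[OF z] in \<open>auto intro!: add cring.cring_simprules(7) T simp: dual_apply\<close>)
    qed (auto intro: add zero)
  next
    fix a b x assume x: "a \<in> carrier S" "b \<in> carrier S" "x \<in> carrier ?D"
    show "(a \<oplus>\<^bsub>S\<^esub> b) \<odot>\<^bsub>?D\<^esub> x = a \<odot>\<^bsub>?D\<^esub> x \<oplus>\<^bsub>?D\<^esub> b \<odot>\<^bsub>?D\<^esub> x"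
      by (rule eqI)
         (use x d[OF x(3)] in \<open>auto intro!: add smult simp: dual_apply module.smult_l_distr[OF algebra.module[OF alg]]\<close>)
    show "(a \<otimes>\<^bsub>S\<^esub> b) \<odot>\<^bsub>?D\<^esub> x = a \<odot>\<^bsub>?D\<^esub> (b \<odot>\<^bsub>?D\<^esub> x)"
      by (rule eqI)
         (use x d[OF x(3)] in \<open>auto intro!: add smult simp: dual_apply module.smult_assoc1[OF algebra.module[OF alg]]\<close>)
  next
    fix a x y assume x: "a \<in> carrier S" "x \<in> carrier ?D" "y \<in> carrier ?D"
    show "a \<odot>\<^bsub>?D\<^esub> (x \<oplus>\<^bsub>?D\<^esub> y) = a \<odot>\<^bsub>?D\<^esub> x \<oplus>\<^bsub>?D\<^esub> a \<odot>\<^bsub>?D\<^esub> y"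
      by (rule eqI)
         (use x d[OF x(2)] d[OF x(3)] in \<open>auto intro!: add smult simp: dual_apply module.smult_r_distr[OF algebra.module[OF alg]]\<close>)
  next
    fix x assume x: "x \<in> carrier ?D"
    show "\<one>\<^bsub>S\<^esub> \<odot>\<^bsub>?D\<^esub> x = x"
      by (rule eqI)
         (use x d[OF x] in \<open>auto intro!: smult simp: dual_apply module.smult_one[OF algebra.module[OF alg]]\<close>)
  qed (auto intro: smult)
qed

lemma dual_arr_closed:
  assumes S: "comm_alg K S" and S': "comm_alg K S'" and f: "f \<in> alg_hom K S S'"
    and F: "module_functor K F" and w: "w \<in> functor_hom S (restrict_functor K S F) base_functor"
  shows "(\<lambda>T\<in>{T. comm_alg S' T}. w (restrict_scalars S f T))
    \<in> functor_hom S' (restrict_functor K S' F) base_functor"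
proof -
  let ?r = "restrict_scalars S f" and ?F = "restrict_functor K S F" and ?F' = "restrict_functor K S' F"
  have fS: "f \<in> ring_hom S S'" using f by (rule alg_homD)
  have cS: "cring S" using S by (rule comm_algD)
  have r: "comm_alg S (?r T)" if "comm_alg S' T" for T
    using comm_alg_restrict_scalars[OF cS fS that] .
  have obj: "fobj ?F (?r T) = fobj ?F' T" if "comm_alg S' T" for T
    using restrict_scalars_alg_hom[OF S S' f that] by simp
  have arr: "farr ?F (?r T) (?r U) g = farr ?F' T U g" if "comm_alg S' T" "comm_alg S' U" for T U g
    using restrict_scalars_alg_hom[OF S S' f that(1)] restrict_scalars_alg_hom[OF S S' f that(2)] by simp
  have h: "g \<in> alg_hom S (?r T) (?r U)" if "comm_alg S' T" "comm_alg S' U" "g \<in> alg_hom S' T U" for g T U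
    using alg_hom_restrict_scalars[OF cS fS that] .
  note d = functor_homD[OF w r] 
  note n = functor_hom_natural[OF w r r h]
  show ?thesis
    using d n by (intro functor_homI) (auto simp: obj arr simp del: restrict_functor_simps)
qed

lemma module_functor_dual:
  assumes F: "module_functor K F"
  shows "module_functor K (dual K F)"
  unfolding module_functor_def
proof (intro conjI allI impI ballI; (elim conjE)?)
  let ?D = "fobj (dual K F)"
  show "module S (?D S)" if "comm_alg K S" for S
    using that F by (rule module_dual)
  show "farr (dual K F) S S (\<lambda>x\<in>carrier S. x) w = w"
    if "comm_alg K S" "w \<in> carrier (?D S)" for S w
    using that by (auto simp: functor_hom_def restrict_scalars_id intro!: extensionalityI[where A="{T. comm_alg S T}"])
  fix S S' :: "('a, 'a) module" and f
  assume S: "comm_alg K S" and S': "comm_alg K S'" and f: "f \<in> alg_hom K S S'"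
  let ?f = "farr (dual K F) S S' f"
  note closed = dual_arr_closed[OF S S' f F]
  show "?f \<in> carrier (?D S) \<rightarrow> carrier (?D S')"
    using closed by (simp del: restrict_functor_simps)
  interpret D: module S "?D S" using S F by (rule module_dual)
  interpret D': module S' "?D S'" using S' F by (rule module_dual)
  have r: "comm_alg S (restrict_scalars S f T)" if "comm_alg S' T"
    for T :: "('a, 'a) module"
    using comm_alg_restrict_scalars[OF comm_algD(4)[OF S] alg_homD(1)[OF f] that] .
  note rr = restrict_scalars_alg_hom[OF S S' f]
  fix w assume w: "w \<in> carrier (?D S)"
  have wc: "w (restrict_scalars S f T) m \<in> carrier T"
    if "w \<in> carrier (?D S)" "comm_alg S' T"
      "m \<in> carrier (fobj F (restrict_scalars K (unit_map K S') T))" for T m w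
    using base_homD(1)[of w S "restrict_functor K S F" "restrict_scalars S f T" m] that
      r[OF that(2)] rr[OF that(2)] by simp
  show "?f (w \<oplus>\<^bsub>?D S\<^esub> w') =
      ?f w \<oplus>\<^bsub>?D S'\<^esub> ?f w'"
    if w': "w' \<in> carrier (?D S)" for w'
  proof (rule functor_hom_eqI[where A=S' and F="restrict_functor K S' F" and G=base_functor])
    show "?f (w \<oplus>\<^bsub>?D S\<^esub> w') \<in> functor_hom S' (restrict_functor K S' F) base_functor"
      using closed[of "w \<oplus>\<^bsub>?D S\<^esub> w'"] D.a_closed[OF w w'] by (simp del: restrict_functor_simps)
    show "?f w \<oplus>\<^bsub>?D S'\<^esub> ?f w'
        \<in> functor_hom S' (restrict_functor K S' F) base_functor"
      using closed[of w] closed[of w'] w w' D'.a_closed by (simp del: restrict_functor_simps)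
    fix T m assume T: "comm_alg S' T" and m: "m \<in> carrier (fobj (restrict_functor K S' F) T)"
    then show "?f (w \<oplus>\<^bsub>?D S\<^esub> w') T m =
      (?f w \<oplus>\<^bsub>?D S'\<^esub> ?f w') T m"
      using dual_apply(2)[OF r[OF T], of m F K w w'] by (simp add: dual_apply rr)
  qed
  show "?f (s \<odot>\<^bsub>?D S\<^esub> w) =
      f s \<odot>\<^bsub>?D S'\<^esub> ?f w"
    if s: "s \<in> carrier S" for s
  proof (rule functor_hom_eqI[where A=S' and F="restrict_functor K S' F" and G=base_functor])
    show "?f (s \<odot>\<^bsub>?D S\<^esub> w) \<in> functor_hom S' (restrict_functor K S' F) base_functor"
      using closed[of "s \<odot>\<^bsub>?D S\<^esub> w"] D.smult_closed[OF s w] by (simp del: restrict_functor_simps)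
    show "f s \<odot>\<^bsub>?D S'\<^esub> ?f w
        \<in> functor_hom S' (restrict_functor K S' F) base_functor"
      using closed[of w] w D'.smult_closed alg_homD(3)[OF f s] by (simp del: restrict_functor_simps)
    fix T m assume T: "comm_alg S' T" and m: "m \<in> carrier (fobj (restrict_functor K S' F) T)"
    then show "?f (s \<odot>\<^bsub>?D S\<^esub> w) T m =
      (f s \<odot>\<^bsub>?D S'\<^esub> ?f w) T m"
      using dual_apply(3)[OF r[OF T], of m F K s w] s wc[OF w T, of m] by (simp add: dual_apply rr)
  qed
  show "farr (dual K F) S U (compose (carrier S) g f) w =
      farr (dual K F) S' U g (?f w)"
    if U: "comm_alg K U" and g: "g \<in> alg_hom K S' U" for U g
  proof -
    have "comm_alg S' (restrict_scalars S' g T)" if "comm_alg U T" for T :: "('a, 'a) module"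
      using comm_alg_restrict_scalars[OF comm_algD(4)[OF S'] alg_homD(1)[OF g] that] .
    then show ?thesis
      by (auto simp: restrict_scalars_compose[OF S S' f g] intro!: restrict_ext)
  qed
qed

text \<open>
  Restriction of scalars along \<open>K \<rightarrow> K\<close> does nothing, so \<open>F\<^sup>*(K)\<close> consists literally of the morphisms
  from \<open>F\<close> to the base functor over \<open>K\<close>.
\<close>

lemma carrier_dual_space:
  "carrier (dual_space K F) = functor_hom K F base_functor"
  unfolding dual_space_def dual_simps functor_hom_def
  by auto

lemma dual_space_apply:
  assumes "comm_alg K S" "m \<in> carrier (fobj F S)"
  shows "(w \<oplus>\<^bsub>dual_space K F\<^esub> w') S m = w S m \<oplus>\<^bsub>S\<^esub> w' S m"
    "(a \<odot>\<^bsub>dual_space K F\<^esub> w) S m = a \<odot>\<^bsub>S\<^esub> w S m"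
  unfolding dual_space_def using assms by (subst dual_apply; simp)+

lemma module_dual_space:
  assumes "cring K" "module_functor K F"
  shows "module K (dual_space K F)"
  unfolding dual_space_def using module_dual[OF comm_alg_self_alg[OF assms(1)] assms(2)]
  by (rule module_change_base) simp_all

section \<open>The tensor product of a vector space and an algebra\<close>

abbreviation tensor_quot ::
    "('a, 'b) ring_scheme \<Rightarrow> ('a, 'v) module \<Rightarrow> ('a, 'c) module \<Rightarrow> ('v \<times> 'c \<Rightarrow>\<^sub>0 int) set monoid" where
  "tensor_quot K V S \<equiv> tensor_free V S Mod tensor_rel K V S"

text \<open>
  The generators of \<^const>\<open>tensor_rel\<close>: a homomorphism is tested on them alone.
\<close>

definition tensor_gens ::
    "('a, 'b) ring_scheme \<Rightarrow> ('a, 'v) module \<Rightarrow> ('a, 'c) module \<Rightarrow> ('v \<times> 'c \<Rightarrow>\<^sub>0 int) set" where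
  "tensor_gens K V S =
     {frag_of (v \<oplus>\<^bsub>V\<^esub> v', s) - frag_of (v, s) - frag_of (v', s) | v v' s.
         v \<in> carrier V \<and> v' \<in> carrier V \<and> s \<in> carrier S} \<union>
      {frag_of (v, s \<oplus>\<^bsub>S\<^esub> s') - frag_of (v, s) - frag_of (v, s') | v s s'.
         v \<in> carrier V \<and> s \<in> carrier S \<and> s' \<in> carrier S} \<union>
      {frag_of (a \<odot>\<^bsub>V\<^esub> v, s) - frag_of (v, a \<odot>\<^bsub>S\<^esub> s) | a v s.
         a \<in> carrier K \<and> v \<in> carrier V \<and> s \<in> carrier S}"

lemma tensor_gensI:
  "v \<in> carrier V \<Longrightarrow> v' \<in> carrier V \<Longrightarrow> s \<in> carrier S \<Longrightarrow>
     frag_of (v \<oplus>\<^bsub>V\<^esub> v', s) - frag_of (v, s) - frag_of (v', s) \<in> tensor_gens K V S"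
  "v \<in> carrier V \<Longrightarrow> s \<in> carrier S \<Longrightarrow> s' \<in> carrier S \<Longrightarrow>
     frag_of (v, s \<oplus>\<^bsub>S\<^esub> s') - frag_of (v, s) - frag_of (v, s') \<in> tensor_gens K V S"
  "a \<in> carrier K \<Longrightarrow> v \<in> carrier V \<Longrightarrow> s \<in> carrier S \<Longrightarrow>
     frag_of (a \<odot>\<^bsub>V\<^esub> v, s) - frag_of (v, a \<odot>\<^bsub>S\<^esub> s) \<in> tensor_gens K V S"
  unfolding tensor_gens_def by blast+

lemma tensor_rel_eq: "tensor_rel K V S = generate (tensor_free V S) (tensor_gens K V S)"
  by (simp add: tensor_rel_def tensor_gens_def)

lemma tensor_gens_rel: "r \<in> tensor_gens K V S \<Longrightarrow> r \<in> tensor_rel K V S"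
  unfolding tensor_rel_eq by (rule generate.incl)

lemma free_Abelian_group_closed:
  assumes "a \<in> carrier (free_Abelian_group A)" "b \<in> carrier (free_Abelian_group A)"
  shows "a + b \<in> carrier (free_Abelian_group A)" "a - b \<in> carrier (free_Abelian_group A)"
  using assms keys_add[of a b] keys_diff[of a b] by auto

lemma tensor_gens_subset:
  assumes "module K V" "module K S"
  shows "tensor_gens K V S \<subseteq> carrier (tensor_free V S)"
proof -
  interpret V: module K V by fact
  interpret S: module K S by fact
  show ?thesis
    unfolding tensor_gens_def
    by (auto intro!: free_Abelian_group_closed simp del: carrier_free_Abelian_group_iff)
qed

lemma tensor_rel_normal:
  assumes "module K V" "module K S"
  shows "tensor_rel K V S \<lhd> tensor_free V S"
  using group.generate_is_subgroup[OF group_free_Abelian_group tensor_gens_subset[OF assms]]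
    abelian_free_Abelian_group comm_group.subgroup_imp_normal
  unfolding tensor_rel_eq by blast

lemma comm_group_tensor_quot:
  assumes "module K V" "module K S"
  shows "comm_group (tensor_quot K V S)"
  using comm_group.abelian_FactGroup[OF abelian_free_Abelian_group] tensor_rel_normal[OF assms]
    normal_imp_subgroup by blast

lemma tensor_module_simps:
  "carrier (tensor_module K V S) = carrier (tensor_quot K V S)"
  "\<zero>\<^bsub>tensor_module K V S\<^esub> = \<one>\<^bsub>tensor_quot K V S\<^esub>"
  "x \<oplus>\<^bsub>tensor_module K V S\<^esub> y = x \<otimes>\<^bsub>tensor_quot K V S\<^esub> y"
  "s \<odot>\<^bsub>tensor_module K V S\<^esub> x = tensor_map K V S (\<lambda>t. s \<otimes>\<^bsub>S\<^esub> t) x"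
  by (simp_all add: tensor_module_def Let_def)

lemma abelian_group_tensor:
  assumes "module K V" "module K S"
  shows "abelian_group (tensor_module K V S)"
proof -
  interpret Q: comm_group "tensor_quot K V S" using assms by (rule comm_group_tensor_quot)
  show ?thesis
    by (rule abelian_groupI)
       (auto simp: tensor_module_simps Q.m_ac intro: bexI[of _ "inv\<^bsub>tensor_quot K V S\<^esub> _"]
        simp del: mult_FactGroup one_FactGroup)
qed

abbreviation tcoset ::
  "('a, 'b) ring_scheme \<Rightarrow> ('a, 'v) module \<Rightarrow> ('a, 'c) module \<Rightarrow> ('v \<times> 'c \<Rightarrow>\<^sub>0 int) \<Rightarrow> ('v \<times> 'c \<Rightarrow>\<^sub>0 int) set"
  where "tcoset K V S c \<equiv> tensor_rel K V S #>\<^bsub>tensor_free V S\<^esub> c"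

lemma tcoset_hom:
  assumes "module K V" "module K S"
  shows "tcoset K V S \<in> hom (tensor_free V S) (tensor_quot K V S)"
  using normal.r_coset_hom_Mod[OF tensor_rel_normal[OF assms]] .

lemma tcoset_add:
  assumes "module K V" "module K S" "c \<in> carrier (tensor_free V S)" "d \<in> carrier (tensor_free V S)"
  shows "tcoset K V S (c + d) = tcoset K V S c \<oplus>\<^bsub>tensor_module K V S\<^esub> tcoset K V S d"
  using hom_mult[OF tcoset_hom[OF assms(1,2)] assms(3,4)] by (simp add: tensor_module_simps)

lemma tensor_carrierE:
  assumes "x \<in> carrier (tensor_module K V S)"
  obtains c where "c \<in> carrier (tensor_free V S)" "x = tcoset K V S c"
  using assms by (auto simp: tensor_module_simps FactGroup_def RCOSETS_def)

lemma tcoset_closed: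
  "c \<in> carrier (tensor_free V S) \<Longrightarrow> tcoset K V S c \<in> carrier (tensor_module K V S)"
  by (auto simp: tensor_module_simps FactGroup_def RCOSETS_def)

lemma tcoset_eqI:
  assumes "module K V" "module K S" "c \<in> carrier (tensor_free V S)" "d \<in> carrier (tensor_free V S)"
    "c - d \<in> tensor_rel K V S"
  shows "tcoset K V S c = tcoset K V S d"
proof -
  interpret F: group "tensor_free V S" by simp
  have N: "subgroup (tensor_rel K V S) (tensor_free V S)"
    using tensor_rel_normal[OF assms(1,2)] by (rule normal_imp_subgroup)
  have "c = (c - d) \<otimes>\<^bsub>tensor_free V S\<^esub> d" by simp
  then have "c \<in> tcoset K V S d" using assms(5) unfolding r_coset_def by blast
  then show ?thesis using F.repr_independence[OF _ _ N, of c d] assms(4) by simp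
qed

context
  fixes K :: "('a, 'b) ring_scheme" and V :: "('a, 'v) module" and S :: "('a, 'c) module"
  assumes V: "module K V" and S: "module K S"
begin

private abbreviation (input) "VS \<equiv> tensor_module K V S"

interpretation V: module K V by (rule V)
interpretation S: module K S by (rule S)

lemma pure_tensor_closed:
  assumes "v \<in> carrier V" "s \<in> carrier S"
  shows "pure_tensor K V S v s \<in> carrier VS"
  unfolding pure_tensor_def by (rule tcoset_closed) (use assms in simp)

lemma pure_tensor_add_left:
  assumes "v \<in> carrier V" "v' \<in> carrier V" "s \<in> carrier S"
  shows "pure_tensor K V S (v \<oplus>\<^bsub>V\<^esub> v') s =
    pure_tensor K V S v s \<oplus>\<^bsub>VS\<^esub> pure_tensor K V S v' s"
proof -
  have "pure_tensor K V S (v \<oplus>\<^bsub>V\<^esub> v') s = tcoset K V S (frag_of (v, s) + frag_of (v', s))"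
    unfolding pure_tensor_def
  proof (rule tcoset_eqI[OF V S])
    show "frag_of (v \<oplus>\<^bsub>V\<^esub> v', s) - (frag_of (v, s) + frag_of (v', s)) \<in> tensor_rel K V S"
      using tensor_gens_rel[OF tensor_gensI(1)[OF assms]] by (simp add: diff_diff_eq)
    show "frag_of (v, s) + frag_of (v', s) \<in> carrier (tensor_free V S)"
      using assms by (intro free_Abelian_group_closed) simp_all
  qed (use assms in simp)
  then show ?thesis using assms by (simp add: tcoset_add[OF V S] pure_tensor_def)
qed

lemma pure_tensor_add_right:
  assumes "v \<in> carrier V" "s' \<in> carrier S" "s \<in> carrier S"
  shows "pure_tensor K V S v (s \<oplus>\<^bsub>S\<^esub> s') =
    pure_tensor K V S v s \<oplus>\<^bsub>VS\<^esub> pure_tensor K V S v s'"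
proof -
  have "pure_tensor K V S v (s \<oplus>\<^bsub>S\<^esub> s') = tcoset K V S (frag_of (v, s) + frag_of (v, s'))"
    unfolding pure_tensor_def
  proof (rule tcoset_eqI[OF V S])
    show "frag_of (v, s \<oplus>\<^bsub>S\<^esub> s') - (frag_of (v, s) + frag_of (v, s')) \<in> tensor_rel K V S"
      using tensor_gens_rel[OF tensor_gensI(2)[OF assms(1,3,2)]] by (simp add: diff_diff_eq)
    show "frag_of (v, s) + frag_of (v, s') \<in> carrier (tensor_free V S)"
      using assms by (intro free_Abelian_group_closed) simp_all
  qed (use assms in simp)
  then show ?thesis using assms by (simp add: tcoset_add[OF V S] pure_tensor_def)
qed

lemma pure_tensor_smult:
  assumes "a \<in> carrier K" "v \<in> carrier V" "s \<in> carrier S"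
  shows "pure_tensor K V S (a \<odot>\<^bsub>V\<^esub> v) s = pure_tensor K V S v (a \<odot>\<^bsub>S\<^esub> s)"
  unfolding pure_tensor_def
  by (rule tcoset_eqI[OF V S])
     (use assms tensor_gens_rel[OF tensor_gensI(3)[OF assms]] in simp_all)

lemma pure_tensor_zero:
  assumes "v \<in> carrier V"
  shows "pure_tensor K V S v \<zero>\<^bsub>S\<^esub> = \<zero>\<^bsub>VS\<^esub>"
proof -
  interpret X: abelian_group "VS" using V S by (rule abelian_group_tensor)
  show ?thesis
    using pure_tensor_add_right[of v "\<zero>\<^bsub>S\<^esub>" "\<zero>\<^bsub>S\<^esub>"] assms
      pure_tensor_closed[OF assms S.zero_closed] X.add.r_cancel_one' by simp
qed

lemma pure_tensor_neg:
  assumes "v \<in> carrier V" "s \<in> carrier S"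
  shows "pure_tensor K V S v (\<ominus>\<^bsub>S\<^esub> s) = \<ominus>\<^bsub>VS\<^esub> pure_tensor K V S v s"
proof -
  interpret X: abelian_group "VS" using V S by (rule abelian_group_tensor)
  show ?thesis
    using pure_tensor_add_right[of v s "\<ominus>\<^bsub>S\<^esub> s"] assms
      pure_tensor_closed[of v s] pure_tensor_closed[of v "\<ominus>\<^bsub>S\<^esub> s"] pure_tensor_zero[of v]
    by (simp add: S.l_neg X.minus_equality)
qed

text \<open>
  Every element is a finite sum of pure tensors: a formal integral combination of pairs maps to
  such a sum, as the negative of a pure tensor is pure.
\<close>

lemma tensor_induct [consumes 1, case_names pure add]:
  assumes x: "x \<in> carrier VS"
    and pure: "\<And>v s. v \<in> carrier V \<Longrightarrow> s \<in> carrier S \<Longrightarrow> P (pure_tensor K V S v s)"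
    and add: "\<And>x y. \<lbrakk>x \<in> carrier VS; y \<in> carrier VS; P x; P y\<rbrakk>
      \<Longrightarrow> P (x \<oplus>\<^bsub>VS\<^esub> y)"
  shows "P x"
proof -
  interpret X: abelian_group "VS" using V S by (rule abelian_group_tensor)
  obtain c where c: "c \<in> carrier (tensor_free V S)" "x = tcoset K V S c"
    using x by (rule tensor_carrierE)
  have h: "group_hom (tensor_free V S) (tensor_quot K V S) (tcoset K V S)"
    using tcoset_hom[OF V S] comm_group_tensor_quot[OF V S]
    by (simp add: group_hom_def group_hom_axioms_def comm_group_def)
  \<comment> \<open>Negation is carried along, because negatives of pure tensors are pure.\<close>
  have "c \<in> carrier (tensor_free V S) \<and> P (tcoset K V S c) \<and> P (tcoset K V S (- c))"
    using c(1) unfolding carrier_free_Abelian_group_iff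
  proof (induction c rule: frag_induction)
    case zero
    have "tcoset K V S 0 = \<zero>\<^bsub>VS\<^esub>"
      using group_hom.hom_one[OF h] by (simp add: tensor_module_simps)
    then show ?case
      using pure[of "\<zero>\<^bsub>V\<^esub>" "\<zero>\<^bsub>S\<^esub>"] by (simp add: pure_tensor_zero)
  next
    case (one p)
    then obtain v s where p: "p = (v, s)" "v \<in> carrier V" "s \<in> carrier S" by auto
    have "tcoset K V S (- frag_of (v, s)) = inv\<^bsub>tensor_quot K V S\<^esub> tcoset K V S (frag_of (v, s))"
      using group_hom.hom_inv[OF h, of "frag_of (v, s)"] p by (simp add: keys_frag_of)
    also have "\<dots> = \<ominus>\<^bsub>VS\<^esub> pure_tensor K V S v s"
      by (simp add: pure_tensor_def a_inv_def tensor_module_simps m_inv_def)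
    also have "\<dots> = pure_tensor K V S v (\<ominus>\<^bsub>S\<^esub> s)" using p by (simp add: pure_tensor_neg)
    finally have "P (tcoset K V S (- frag_of (v, s)))" using pure p by simp
    then show ?case using pure[of v s] p by (simp add: pure_tensor_def keys_frag_of)
  next
    case (diff a b)
    then have F: "a \<in> carrier (tensor_free V S)" "b \<in> carrier (tensor_free V S)"
       "- a \<in> carrier (tensor_free V S)" "- b \<in> carrier (tensor_free V S)" by simp_all
    have "P (tcoset K V S (a + - b))"
      unfolding tcoset_add[OF V S F(1,4)]
      using diff F by (intro add tcoset_closed) simp_all
    moreover have "P (tcoset K V S (b + - a))"
      unfolding tcoset_add[OF V S F(2,3)]
      using diff F by (intro add tcoset_closed) simp_all
    moreover have "a - b \<in> carrier (tensor_free V S)"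
      using F(1,2) by (rule free_Abelian_group_closed)
    ultimately show ?case by simp
  qed
  then show ?thesis using c(2) by simp
qed

text \<open>
  The free abelian group provides a homomorphism with the prescribed values on pairs, and it
  descends to the quotient since it kills the generators of the relations.
\<close>

lemma tensor_universal:
  assumes H: "abelian_group H"
    and closed: "\<And>v s. v \<in> carrier V \<Longrightarrow> s \<in> carrier S \<Longrightarrow> \<beta> v s \<in> carrier H"
    and add_left: "\<And>v v' s. v \<in> carrier V \<Longrightarrow> v' \<in> carrier V \<Longrightarrow> s \<in> carrier S \<Longrightarrow>
      \<beta> (v \<oplus>\<^bsub>V\<^esub> v') s = \<beta> v s \<oplus>\<^bsub>H\<^esub> \<beta> v' s"
    and add_right: "\<And>v s s'. v \<in> carrier V \<Longrightarrow> s \<in> carrier S \<Longrightarrow> s' \<in> carrier S \<Longrightarrow>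
      \<beta> v (s \<oplus>\<^bsub>S\<^esub> s') = \<beta> v s \<oplus>\<^bsub>H\<^esub> \<beta> v s'"
    and balanced: "\<And>a v s. a \<in> carrier K \<Longrightarrow> v \<in> carrier V \<Longrightarrow> s \<in> carrier S \<Longrightarrow>
      \<beta> (a \<odot>\<^bsub>V\<^esub> v) s = \<beta> v (a \<odot>\<^bsub>S\<^esub> s)"
  obtains h where
    "\<And>x. x \<in> carrier VS \<Longrightarrow> h x \<in> carrier H"
    "\<And>x y. x \<in> carrier VS \<Longrightarrow> y \<in> carrier VS \<Longrightarrow>
      h (x \<oplus>\<^bsub>VS\<^esub> y) = h x \<oplus>\<^bsub>H\<^esub> h y"
    "\<And>v s. v \<in> carrier V \<Longrightarrow> s \<in> carrier S \<Longrightarrow> h (pure_tensor K V S v s) = \<beta> v s"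
proof -
  interpret H: abelian_group H by fact
  have cH: "comm_group (add_monoid H)" by (rule H.a_comm_group)
  obtain g where g: "g \<in> hom (tensor_free V S) (add_monoid H)"
    and gb: "\<And>p. p \<in> carrier V \<times> carrier S \<Longrightarrow> g (frag_of p) = (case p of (v, s) \<Rightarrow> \<beta> v s)"
    by (rule comm_group.free_Abelian_group_universal[OF cH, of "\<lambda>p. case p of (v, s) \<Rightarrow> \<beta> v s"
        "carrier V \<times> carrier S"]) (use closed in auto)
  interpret g: group_hom "tensor_free V S" "add_monoid H" g
    using g cH by (simp add: group_hom_def group_hom_axioms_def comm_group_def)
  have gd: "g (a - b) = g a \<ominus>\<^bsub>H\<^esub> g b" if "a \<in> carrier (tensor_free V S)" "b \<in> carrier (tensor_free V S)" for a b
    using g.hom_mult[of a "- b"] g.hom_inv[of b] that by (simp add: a_minus_def a_inv_def)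
  have fr: "frag_of (v, s) - frag_of (v', s') \<in> carrier (tensor_free V S)" "frag_of (v, s) \<in> carrier (tensor_free V S)"
    if "v \<in> carrier V" "s \<in> carrier S" "v' \<in> carrier V" "s' \<in> carrier S" for v s v' s'
    using that by (auto intro!: free_Abelian_group_closed simp del: carrier_free_Abelian_group_iff)
  have arith: "(x \<oplus>\<^bsub>H\<^esub> y) \<ominus>\<^bsub>H\<^esub> x \<ominus>\<^bsub>H\<^esub> y = \<zero>\<^bsub>H\<^esub>" "x \<ominus>\<^bsub>H\<^esub> x = \<zero>\<^bsub>H\<^esub>"
    if "x \<in> carrier H" "y \<in> carrier H" for x y
    using that by (simp_all add: a_minus_def H.a_assoc H.r_neg)
      (metis H.a_comm H.a_inv_closed H.add.m_closed H.minus_add H.r_neg H.a_assoc)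
  have "tensor_gens K V S \<subseteq> kernel (tensor_free V S) (add_monoid H) g"
  proof
    fix r assume r: "r \<in> tensor_gens K V S"
    then have rF: "r \<in> carrier (tensor_free V S)" using tensor_gens_subset[OF V S] by blast
    have "g r = \<zero>\<^bsub>H\<^esub>"
      using r unfolding tensor_gens_def
      by (auto simp: gd fr gb closed add_left add_right balanced arith arith(2)[OF closed closed]
          simp del: carrier_free_Abelian_group_iff)
    then show "r \<in> kernel (tensor_free V S) (add_monoid H) g" using rF by (simp add: kernel_def)
  qed
  then have "tensor_rel K V S \<subseteq> kernel (tensor_free V S) (add_monoid H) g"
    unfolding tensor_rel_eq
    by (intro group.generate_subgroup_incl group_free_Abelian_group g.subgroup_kernel)
  then obtain h where h: "h \<in> hom (tensor_quot K V S) (add_monoid H)"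
    and hg: "\<And>x. x \<in> carrier (tensor_free V S) \<Longrightarrow> h (tcoset K V S x) = g x"
    using g.FactGroup_universal_kernel[OF tensor_rel_normal[OF V S]] by blast
  show thesis
  proof (rule that[of h])
    fix x y assume "x \<in> carrier VS" "y \<in> carrier VS"
    then show "h (x \<oplus>\<^bsub>VS\<^esub> y) = h x \<oplus>\<^bsub>H\<^esub> h y"
      using hom_mult[OF h] by (simp add: tensor_module_simps del: mult_FactGroup)
  next
    fix x assume "x \<in> carrier VS"
    then show "h x \<in> carrier H"
      using hom_in_carrier[OF h] by (simp add: tensor_module_simps)
  next
    fix v s assume "v \<in> carrier V" "s \<in> carrier S"
    then show "h (pure_tensor K V S v s) = \<beta> v s"
      using hg[of "frag_of (v, s)"] gb[of "(v, s)"] by (simp add: pure_tensor_def)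
  qed
qed

text \<open>
  The map induced on the free groups sends generators of the relations to generators. Hence the union
  in \<^const>\<open>tensor_map\<close> is one coset, and the value can be computed from any representative.
\<close>

lemma tensor_map_hom:
  assumes T: "module K T"
    and g: "\<And>s. s \<in> carrier S \<Longrightarrow> g s \<in> carrier T"
      "\<And>s s'. s \<in> carrier S \<Longrightarrow> s' \<in> carrier S \<Longrightarrow> g (s \<oplus>\<^bsub>S\<^esub> s') = g s \<oplus>\<^bsub>T\<^esub> g s'"
      "\<And>a s. a \<in> carrier K \<Longrightarrow> s \<in> carrier S \<Longrightarrow> g (a \<odot>\<^bsub>S\<^esub> s) = a \<odot>\<^bsub>T\<^esub> g s"
  shows "x \<in> carrier VS \<Longrightarrow> tensor_map K V T g x \<in> carrier (tensor_module K V T)"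
    "x \<in> carrier VS \<Longrightarrow> y \<in> carrier VS \<Longrightarrow>
      tensor_map K V T g (x \<oplus>\<^bsub>VS\<^esub> y) =
      tensor_map K V T g x \<oplus>\<^bsub>tensor_module K V T\<^esub> tensor_map K V T g y"
    "v \<in> carrier V \<Longrightarrow> s \<in> carrier S \<Longrightarrow>
      tensor_map K V T g (pure_tensor K V S v s) = pure_tensor K V T v (g s)"
proof -
  interpret T: module K T by fact
  let ?G = "frag_extend (\<lambda>(v, s). frag_of (v, g s))"
  have Gc: "?G c \<in> carrier (tensor_free V T)" if "c \<in> carrier (tensor_free V S)" for c
  proof -
    have "Poly_Mapping.keys (?G c) \<subseteq> (\<Union>x\<in>Poly_Mapping.keys c. Poly_Mapping.keys (case x of (v, s) \<Rightarrow> frag_of (v, g s)))"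
      by (rule keys_frag_extend)
    also have "\<dots> \<subseteq> carrier V \<times> carrier T" using that g(1) by (force simp: keys_frag_of)
    finally show ?thesis by simp
  qed
  have G: "group_hom (tensor_free V S) (tensor_free V T) ?G"
    using Gc by (auto simp: group_hom_def group_hom_axioms_def hom_def frag_extend_add simp del: carrier_free_Abelian_group_iff)
  have "?G ` tensor_gens K V S \<subseteq> tensor_gens K V T"
  proof
    fix x assume "x \<in> ?G ` tensor_gens K V S"
    then obtain r where r: "r \<in> tensor_gens K V S" and x: "x = ?G r" by blast
    from r show "x \<in> tensor_gens K V T"
      unfolding x tensor_gens_def[of K V S]
      by (auto simp: frag_extend_diff g intro!: tensor_gensI)
  qed
  then have rel: "?G r \<in> tensor_rel K V T" if "r \<in> tensor_rel K V S" for r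
    using group_hom.generate_img[OF G tensor_gens_subset[OF V S]] that
      group.mono_generate[OF group_free_Abelian_group \<open>?G ` tensor_gens K V S \<subseteq> tensor_gens K V T\<close>]
    unfolding tensor_rel_eq by (metis (no_types, lifting) imageI subsetD)
  have map: "tensor_map K V T g (tcoset K V S c) = tcoset K V T (?G c)" if c: "c \<in> carrier (tensor_free V S)" for c
  proof -
    have "tcoset K V T (?G d) = tcoset K V T (?G c)" if d: "d \<in> tcoset K V S c" for d
    proof -
      obtain r where r: "r \<in> tensor_rel K V S" "d = r + c" using d by (auto simp: r_coset_def)
      have "r \<in> carrier (tensor_free V S)"
        using subgroup.mem_carrier[OF normal_imp_subgroup[OF tensor_rel_normal[OF V S]] r(1)] .
      then have "d \<in> carrier (tensor_free V S)"
        unfolding r(2) using c by (rule free_Abelian_group_closed)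
      then show ?thesis
        using rel[OF r(1)] r(2) by (intro tcoset_eqI[OF V T] Gc c) (simp_all add: frag_extend_add)
    qed
    moreover have "c \<in> tcoset K V S c"
      using group.rcos_self[OF group_free_Abelian_group c normal_imp_subgroup[OF tensor_rel_normal[OF V S]]] .
    ultimately show ?thesis unfolding tensor_map_def by blast
  qed
  show "tensor_map K V T g x \<in> carrier (tensor_module K V T)" if "x \<in> carrier VS"
    using that by (elim tensor_carrierE) (simp only: map Gc tcoset_closed)
  show "tensor_map K V T g (x \<oplus>\<^bsub>VS\<^esub> y) =
      tensor_map K V T g x \<oplus>\<^bsub>tensor_module K V T\<^esub> tensor_map K V T g y"
    if xy: "x \<in> carrier VS" "y \<in> carrier VS"
  proof -
    obtain c where c: "c \<in> carrier (tensor_free V S)" "x = tcoset K V S c"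
      using xy(1) by (rule tensor_carrierE)
    obtain d where d: "d \<in> carrier (tensor_free V S)" "y = tcoset K V S d"
      using xy(2) by (rule tensor_carrierE)
    have cd: "c + d \<in> carrier (tensor_free V S)"
      using c(1) d(1) by (rule free_Abelian_group_closed)
    show ?thesis
      unfolding c(2) d(2) tcoset_add[OF V S c(1) d(1), symmetric] map[OF c(1)] map[OF d(1)] map[OF cd]
      by (simp only: frag_extend_add tcoset_add[OF V T Gc[OF c(1)] Gc[OF d(1)]])
  qed
  show "tensor_map K V T g (pure_tensor K V S v s) = pure_tensor K V T v (g s)"
    if "v \<in> carrier V" "s \<in> carrier S"
    using map[of "frag_of (v, s)"] that by (simp add: pure_tensor_def)
qed

end

text \<open>
  The uniqueness half of the universal property.
\<close>

lemma tensor_hom_eq: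
  assumes V: "module K V" and S: "module K S" and "x \<in> carrier (tensor_module K V S)"
    and "\<And>v s. v \<in> carrier V \<Longrightarrow> s \<in> carrier S \<Longrightarrow> h (pure_tensor K V S v s) = k (pure_tensor K V S v s)"
    and "\<And>x y. x \<in> carrier (tensor_module K V S) \<Longrightarrow> y \<in> carrier (tensor_module K V S) \<Longrightarrow>
      h (x \<oplus>\<^bsub>tensor_module K V S\<^esub> y) = h x \<oplus>\<^bsub>H\<^esub> h y"
    and "\<And>x y. x \<in> carrier (tensor_module K V S) \<Longrightarrow> y \<in> carrier (tensor_module K V S) \<Longrightarrow>
      k (x \<oplus>\<^bsub>tensor_module K V S\<^esub> y) = k x \<oplus>\<^bsub>H\<^esub> k y"
  shows "h x = k x"
  using assms(3) by (induction rule: tensor_induct[OF V S, consumes 1, case_names pure add]) (simp_all add: assms(4-))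

context
  fixes K :: "('a, 'b) ring_scheme" and V :: "('a, 'v) module"
  assumes V: "module K V"
begin

private abbreviation (input) "VT \<equiv> tensor_module K V"

lemma tensor_map_alg_hom:
  assumes S: "comm_alg K S" and T: "comm_alg K T" and f: "f \<in> alg_hom K S T"
  shows "x \<in> carrier (VT S) \<Longrightarrow> tensor_map K V T f x \<in> carrier (VT T)"
    "x \<in> carrier (VT S) \<Longrightarrow> y \<in> carrier (VT S) \<Longrightarrow>
      tensor_map K V T f (x \<oplus>\<^bsub>VT S\<^esub> y) =
      tensor_map K V T f x \<oplus>\<^bsub>VT T\<^esub> tensor_map K V T f y"
    "v \<in> carrier V \<Longrightarrow> s \<in> carrier S \<Longrightarrow>
      tensor_map K V T f (pure_tensor K V S v s) = pure_tensor K V T v (f s)"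
  by (rule tensor_map_hom[OF V comm_algD(2)[OF S] comm_algD(2)[OF T]];
      use f in \<open>simp add: alg_hom_def ring_hom_def Pi_iff\<close>)+

lemma tensor_smult:
  assumes S: "comm_alg K S" and a: "a \<in> carrier S"
  shows "x \<in> carrier (VT S) \<Longrightarrow>
      a \<odot>\<^bsub>VT S\<^esub> x \<in> carrier (VT S)"
    "x \<in> carrier (VT S) \<Longrightarrow> y \<in> carrier (VT S) \<Longrightarrow>
      a \<odot>\<^bsub>VT S\<^esub> (x \<oplus>\<^bsub>VT S\<^esub> y) =
      a \<odot>\<^bsub>VT S\<^esub> x \<oplus>\<^bsub>VT S\<^esub> a \<odot>\<^bsub>VT S\<^esub> y"
    "v \<in> carrier V \<Longrightarrow> s \<in> carrier S \<Longrightarrow>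
      a \<odot>\<^bsub>VT S\<^esub> pure_tensor K V S v s = pure_tensor K V S v (a \<otimes>\<^bsub>S\<^esub> s)"
proof -
  interpret S: algebra K S using S by (rule comm_algD)
  have lin: "a \<otimes>\<^bsub>S\<^esub> (k \<odot>\<^bsub>S\<^esub> x) = k \<odot>\<^bsub>S\<^esub> (a \<otimes>\<^bsub>S\<^esub> x)" if "k \<in> carrier K" "x \<in> carrier S" for k x
    using that a S.m_comm[of a "k \<odot>\<^bsub>S\<^esub> x"] S.m_comm[of a x] by (simp add: S.smult_assoc2)
  note h = tensor_map_hom[OF V S.module S.module, of "\<lambda>t. a \<otimes>\<^bsub>S\<^esub> t", folded tensor_module_simps(4)]
  show "x \<in> carrier (VT S) \<Longrightarrow>
      a \<odot>\<^bsub>VT S\<^esub> x \<in> carrier (VT S)"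
    by (rule h(1)) (simp_all add: a lin S.r_distr)
  show "x \<in> carrier (VT S) \<Longrightarrow> y \<in> carrier (VT S) \<Longrightarrow>
      a \<odot>\<^bsub>VT S\<^esub> (x \<oplus>\<^bsub>VT S\<^esub> y) =
      a \<odot>\<^bsub>VT S\<^esub> x \<oplus>\<^bsub>VT S\<^esub> a \<odot>\<^bsub>VT S\<^esub> y"
    by (rule h(2)) (simp_all add: a lin S.r_distr)
  show "v \<in> carrier V \<Longrightarrow> s \<in> carrier S \<Longrightarrow>
      a \<odot>\<^bsub>VT S\<^esub> pure_tensor K V S v s = pure_tensor K V S v (a \<otimes>\<^bsub>S\<^esub> s)"
    by (rule h(3)) (simp_all add: a lin S.r_distr)
qed

text \<open>
  Scalars act through the algebra factor, and each axiom holds on pure tensors.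
\<close>

lemma module_tensor:
  assumes S: "comm_alg K S"
  shows "module S (VT S)"
proof -
  interpret S: algebra K S using S by (rule comm_algD)
  interpret X: abelian_group "VT S" using V S.module by (rule abelian_group_tensor)
  note sm = tensor_smult[OF S]
  note induct = tensor_induct[OF V S.module, consumes 1, case_names pure add]
  show ?thesis
  proof (rule moduleI)
    show "cring S" by (rule S.M_cring)
    show "abelian_group (VT S)" by (rule X.abelian_group_axioms)
    fix a x assume a: "a \<in> carrier S" and x: "x \<in> carrier (VT S)"
    show "a \<odot>\<^bsub>VT S\<^esub> x \<in> carrier (VT S)"
      using sm a x by blast
    show "a \<odot>\<^bsub>VT S\<^esub> (x \<oplus>\<^bsub>VT S\<^esub> y) =
        a \<odot>\<^bsub>VT S\<^esub> x \<oplus>\<^bsub>VT S\<^esub> a \<odot>\<^bsub>VT S\<^esub> y"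
      if "y \<in> carrier (VT S)" for y
      using sm a x that by blast
    fix b assume b: "b \<in> carrier S"
    show "(a \<oplus>\<^bsub>S\<^esub> b) \<odot>\<^bsub>VT S\<^esub> x =
        a \<odot>\<^bsub>VT S\<^esub> x \<oplus>\<^bsub>VT S\<^esub> b \<odot>\<^bsub>VT S\<^esub> x"
      using x by (induction rule: induct)
        (simp_all add: a b sm S.l_distr X.a_ac pure_tensor_add_right[OF V S.module])
    show "(a \<otimes>\<^bsub>S\<^esub> b) \<odot>\<^bsub>VT S\<^esub> x =
        a \<odot>\<^bsub>VT S\<^esub> (b \<odot>\<^bsub>VT S\<^esub> x)"
      using x by (induction rule: induct) (simp_all add: a b sm S.m_assoc)
  next
    fix x assume "x \<in> carrier (VT S)"
    then show "\<one>\<^bsub>S\<^esub> \<odot>\<^bsub>VT S\<^esub> x = x"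
      by (induction rule: induct) (simp_all add: sm)
  qed
qed

lemma quasi_coherent_simps [simp]:
  "fobj (quasi_coherent K V) S = VT S"
  "farr (quasi_coherent K V) S T f = tensor_map K V T f"
  by (simp_all add: quasi_coherent_def)

lemma module_functor_quasi_coherent: "module_functor K (quasi_coherent K V)"
proof -
  note h = tensor_map_alg_hom
  show ?thesis
    unfolding module_functor_def quasi_coherent_simps
  proof (intro conjI allI impI ballI; (elim conjE)?)
    show "module S (VT S)" if "comm_alg K S" for S
      using that by (rule module_tensor)
    show "tensor_map K V S (\<lambda>x\<in>carrier S. x) m = m"
      if S: "comm_alg K S" and m: "m \<in> carrier (VT S)" for S m
      by (rule tensor_hom_eq[OF V comm_algD(2)[OF S] m, where H="VT S"
            and h="tensor_map K V S (\<lambda>x\<in>carrier S. x)" and k="\<lambda>x. x"])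
         (simp_all add: h[OF S S alg_hom_id[OF S]])
    fix S T :: "('a, 'a) module" and f
    assume S: "comm_alg K S" and T: "comm_alg K T" and f: "f \<in> alg_hom K S T"
    show "tensor_map K V T f \<in> carrier (VT S) \<rightarrow> carrier (VT T)"
      using h(1)[OF S T f] by simp
    fix m assume m: "m \<in> carrier (VT S)"
    show "tensor_map K V T f (m \<oplus>\<^bsub>VT S\<^esub> n) =
        tensor_map K V T f m \<oplus>\<^bsub>VT T\<^esub> tensor_map K V T f n"
      if "n \<in> carrier (VT S)" for n
      using h(2)[OF S T f m that] .
    show "tensor_map K V T f (s \<odot>\<^bsub>VT S\<^esub> m) =
        f s \<odot>\<^bsub>VT T\<^esub> tensor_map K V T f m" if s: "s \<in> carrier S" for s
    proof -
      interpret S: cring S using S by (rule comm_algD)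
      show ?thesis using m
        by (induction rule: tensor_induct[OF V comm_algD(2)[OF S], consumes 1, case_names pure add])
           (simp_all add: tensor_smult[OF S] tensor_smult[OF T] h[OF S T f] alg_homD(3)[OF f] s
             ring_hom_mult[OF alg_homD(1)[OF f]])
    qed
    show "tensor_map K V U (compose (carrier S) g f) m = tensor_map K V U g (tensor_map K V T f m)"
      if U: "comm_alg K U" and g: "g \<in> alg_hom K T U" for U g
      by (rule tensor_hom_eq[OF V comm_algD(2)[OF S] m, where H="VT U"
            and h="tensor_map K V U (compose (carrier S) g f)"
            and k="\<lambda>x. tensor_map K V U g (tensor_map K V T f x)"])
         (simp_all add: h[OF S U alg_hom_compose[OF S f g]] h[OF S T f] h[OF T U g]
           alg_homD(3)[OF f] compose_eq)
  qed
qed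

end

section \<open>The tensor product of two algebras\<close>

text \<open>
  The integral monoid ring. For algebras \<open>T\<close> and \<open>U\<close> the free abelian group on pairs is the monoid ring
  of \<open>T \<times> U\<close>, so the product on the tensor product is obtained by passing to a quotient ring.
\<close>

definition monoid_ring :: "('a, 'b) monoid_scheme \<Rightarrow> ('a \<Rightarrow>\<^sub>0 int) ring" where
  "monoid_ring G = \<lparr>carrier = carrier (free_Abelian_group (carrier G)),
     monoid.mult = (\<lambda>x y. frag_extend (\<lambda>p. frag_extend (\<lambda>q. frag_of (p \<otimes>\<^bsub>G\<^esub> q)) y) x),
     one = frag_of \<one>\<^bsub>G\<^esub>, ring.zero = 0, ring.add = (+)\<rparr>"

lemma frag_extend_fun_add: "frag_extend (\<lambda>p. f p + g p) x = frag_extend f x + frag_extend g x"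
  by (simp add: frag_extend_def frag_cmul_distrib2 sum.distrib)

lemma monoid_ring_simps [simp]:
  "carrier (monoid_ring G) = carrier (free_Abelian_group (carrier G))"
  "x \<oplus>\<^bsub>monoid_ring G\<^esub> y = x + y" "\<zero>\<^bsub>monoid_ring G\<^esub> = 0" "\<one>\<^bsub>monoid_ring G\<^esub> = frag_of \<one>\<^bsub>G\<^esub>"
  "frag_of p \<otimes>\<^bsub>monoid_ring G\<^esub> frag_of q = frag_of (p \<otimes>\<^bsub>G\<^esub> q)"
  by (simp_all add: monoid_ring_def)

lemma monoid_ring_mult_zero [simp]:
  "0 \<otimes>\<^bsub>monoid_ring G\<^esub> z = 0" "z \<otimes>\<^bsub>monoid_ring G\<^esub> 0 = 0"
  by (simp_all add: monoid_ring_def frag_extend_def)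

lemma monoid_ring_mult_add:
  "(x + y) \<otimes>\<^bsub>monoid_ring G\<^esub> z = x \<otimes>\<^bsub>monoid_ring G\<^esub> z + y \<otimes>\<^bsub>monoid_ring G\<^esub> z"
  "z \<otimes>\<^bsub>monoid_ring G\<^esub> (x + y) = z \<otimes>\<^bsub>monoid_ring G\<^esub> x + z \<otimes>\<^bsub>monoid_ring G\<^esub> y"
  by (simp_all add: monoid_ring_def frag_extend_add frag_extend_fun_add)

lemma monoid_ring_mult_diff:
  "(x - y) \<otimes>\<^bsub>monoid_ring G\<^esub> z = x \<otimes>\<^bsub>monoid_ring G\<^esub> z - y \<otimes>\<^bsub>monoid_ring G\<^esub> z"
  "z \<otimes>\<^bsub>monoid_ring G\<^esub> (x - y) = z \<otimes>\<^bsub>monoid_ring G\<^esub> x - z \<otimes>\<^bsub>monoid_ring G\<^esub> y"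
  using monoid_ring_mult_add(1)[where x="x - y" and y=y and z=z and G=G]
    monoid_ring_mult_add(2)[where x="x - y" and y=y and z=z and G=G] by simp_all

lemma free_Abelian_group_uminus_closed:
  "a \<in> carrier (free_Abelian_group A) \<Longrightarrow> - a \<in> carrier (free_Abelian_group A)"
  by simp

lemma cring_monoid_ring:
  assumes "comm_monoid G"
  shows "cring (monoid_ring G)"
proof -
  interpret G: comm_monoid G by fact
  let ?F = "free_Abelian_group (carrier G)" and ?R = "monoid_ring G"
  have ind: "P x" if "x \<in> carrier ?F" "P 0" "\<And>p. p \<in> carrier G \<Longrightarrow> P (frag_of p)"
    "\<And>a b. P a \<Longrightarrow> P b \<Longrightarrow> P (a - b)" for P x
    using that(1)[unfolded carrier_free_Abelian_group_iff] that(2-) by (rule frag_induction)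
  note bi = monoid_ring_mult_diff monoid_ring_mult_add
  have zero: "0 \<in> carrier ?F" by simp
  have cl: "x \<otimes>\<^bsub>?R\<^esub> y \<in> carrier ?F" if "x \<in> carrier ?F" "y \<in> carrier ?F" for x y
    using that(1)
  proof (rule ind)
    fix p assume p: "p \<in> carrier G"
    show "frag_of p \<otimes>\<^bsub>?R\<^esub> y \<in> carrier ?F"
      by (rule ind[OF that(2)]) (use p in \<open>auto simp: bi zero free_Abelian_group_closed simp del: carrier_free_Abelian_group_iff\<close>)
  qed (auto simp: bi zero free_Abelian_group_closed simp del: carrier_free_Abelian_group_iff)
  have assoc: "(x \<otimes>\<^bsub>?R\<^esub> y) \<otimes>\<^bsub>?R\<^esub> z = x \<otimes>\<^bsub>?R\<^esub> (y \<otimes>\<^bsub>?R\<^esub> z)"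
    if "x \<in> carrier ?F" "y \<in> carrier ?F" "z \<in> carrier ?F" for x y z
    using that(1)
  proof (rule ind)
    fix p assume p: "p \<in> carrier G"
    show "(frag_of p \<otimes>\<^bsub>?R\<^esub> y) \<otimes>\<^bsub>?R\<^esub> z = frag_of p \<otimes>\<^bsub>?R\<^esub> (y \<otimes>\<^bsub>?R\<^esub> z)"
      using that(2)
    proof (rule ind)
      fix q assume q: "q \<in> carrier G"
      show "(frag_of p \<otimes>\<^bsub>?R\<^esub> frag_of q) \<otimes>\<^bsub>?R\<^esub> z = frag_of p \<otimes>\<^bsub>?R\<^esub> (frag_of q \<otimes>\<^bsub>?R\<^esub> z)"
        using that(3) by (rule ind) (use p q in \<open>simp_all add: bi G.m_assoc\<close>)
    qed (simp_all add: bi)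
  qed (simp_all add: bi)
  have comm: "x \<otimes>\<^bsub>?R\<^esub> y = y \<otimes>\<^bsub>?R\<^esub> x" if "x \<in> carrier ?F" "y \<in> carrier ?F" for x y
    using that(1)
  proof (rule ind)
    fix p assume p: "p \<in> carrier G"
    show "frag_of p \<otimes>\<^bsub>?R\<^esub> y = y \<otimes>\<^bsub>?R\<^esub> frag_of p"
      using that(2) by (rule ind) (use p in \<open>simp_all add: bi G.m_comm\<close>)
  qed (simp_all add: bi)
  have one: "frag_of \<one>\<^bsub>G\<^esub> \<otimes>\<^bsub>?R\<^esub> x = x" if "x \<in> carrier ?F" for x
    using that by (rule ind) (simp_all add: bi)
  show ?thesis
  proof (rule cringI)
    show "abelian_group ?R"
      by (rule abelian_groupI)
         (auto simp: zero free_Abelian_group_closed add.commute add.left_commute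
          intro: bexI[OF _ free_Abelian_group_uminus_closed] simp del: carrier_free_Abelian_group_iff)
    show "comm_monoid ?R"
      by (rule comm_monoidI; unfold monoid_ring_simps)
        (blast intro: cl assoc comm one frag_of_in_free_Abelian_group[THEN iffD2] G.one_closed)+
  qed (simp add: bi)
qed

lemma comm_monoid_DirProd:
  assumes "comm_monoid G" "comm_monoid H"
  shows "comm_monoid (G \<times>\<times> H)"
proof -
  interpret G: comm_monoid G by fact
  interpret H: comm_monoid H by fact
  show ?thesis by (rule comm_monoidI) (auto simp: G.m_assoc H.m_assoc intro: G.m_comm H.m_comm)
qed

text \<open>
  A pair times a generator of the relations is again a generator, by distributivity in one of
  the two factors. By additivity the relations absorb all multiples.
\<close>

lemma tensor_rel_ideal:
  assumes T: "comm_alg K T" and U: "comm_alg K U"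
  shows "ideal (tensor_rel K T U) (monoid_ring (T \<times>\<times> U))"
proof -
  interpret T: algebra K T using T by (rule comm_algD)
  interpret U: algebra K U using U by (rule comm_algD)
  let ?R = "monoid_ring (T \<times>\<times> U)" and ?F = "tensor_free T U" and ?I = "tensor_rel K T U"
  have cm: "comm_monoid (T \<times>\<times> U)"
    using comm_algD(4)[OF T] comm_algD(4)[OF U] by (intro comm_monoid_DirProd cring.axioms(2))
  interpret R: cring ?R using cm by (rule cring_monoid_ring)
  have sub: "subgroup ?I ?F"
    using normal_imp_subgroup[OF tensor_rel_normal[OF T.module U.module]] .
  interpret I: subgroup ?I ?F by fact
  have I_diff: "a - b \<in> ?I" if "a \<in> ?I" "b \<in> ?I" for a b
    using I.m_closed[OF that(1) I.m_inv_closed[OF that(2)]] I.mem_carrier[OF that(2)] by simp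
  have gens: "frag_of p \<otimes>\<^bsub>?R\<^esub> r \<in> ?I" if pc: "p \<in> carrier (T \<times>\<times> U)" and r: "r \<in> tensor_gens K T U" for p r
  proof -
    obtain t u where p: "p = (t, u)" "t \<in> carrier T" "u \<in> carrier U"
      using pc by (cases p) simp
    have Ta: "t \<otimes>\<^bsub>T\<^esub> (a \<odot>\<^bsub>T\<^esub> v) = a \<odot>\<^bsub>T\<^esub> (t \<otimes>\<^bsub>T\<^esub> v)" if "a \<in> carrier K" "v \<in> carrier T" for a v
      using that p by (metis T.m_comm T.smult_assoc2 T.smult_closed)
    have Ua: "u \<otimes>\<^bsub>U\<^esub> (a \<odot>\<^bsub>U\<^esub> v) = a \<odot>\<^bsub>U\<^esub> (u \<otimes>\<^bsub>U\<^esub> v)" if "a \<in> carrier K" "v \<in> carrier U" for a v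
      using that p by (metis U.m_comm U.smult_assoc2 U.smult_closed)
    have "frag_of p \<otimes>\<^bsub>?R\<^esub> r \<in> tensor_gens K T U"
      using r[unfolded tensor_gens_def] p
      by (auto simp: monoid_ring_mult_diff T.r_distr U.r_distr Ta Ua intro!: tensor_gensI)
    then show ?thesis by (rule tensor_gens_rel)
  qed
  have gens': "x \<otimes>\<^bsub>?R\<^esub> r \<in> ?I" if x: "x \<in> carrier ?F" and r: "r \<in> tensor_gens K T U" for x r
    using x[unfolded carrier_free_Abelian_group_iff]
  proof (rule frag_induction)
    show "0 \<otimes>\<^bsub>?R\<^esub> r \<in> ?I" using I.one_closed by simp
  qed (use gens r I_diff in \<open>auto simp: monoid_ring_mult_diff\<close>)
  have l: "x \<otimes>\<^bsub>?R\<^esub> a \<in> ?I" if a: "a \<in> ?I" and x: "x \<in> carrier ?R" for a x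
  proof -
    have h: "group_hom ?F ?F (\<lambda>r. x \<otimes>\<^bsub>?R\<^esub> r)"
      using x R.m_closed[OF x] by (auto simp: group_hom_def group_hom_axioms_def hom_def monoid_ring_mult_add
         simp del: carrier_free_Abelian_group_iff)
    have "(\<lambda>r. x \<otimes>\<^bsub>?R\<^esub> r) ` generate ?F (tensor_gens K T U) \<subseteq> ?I"
      unfolding group_hom.generate_img[OF h tensor_gens_subset[OF T.module U.module], symmetric]
      by (rule group.generate_subgroup_incl[OF group_free_Abelian_group _ sub])
         (use gens' x in auto)
    then show ?thesis using a unfolding tensor_rel_eq by blast
  qed
  show ?thesis
  proof (rule idealI)
    show "ring ?R" by (rule R.ring_axioms)
    show "subgroup ?I (add_monoid ?R)"
      using sub by (simp add: monoid_ring_def free_Abelian_group_def)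
  next
    fix a x assume "a \<in> ?I" "x \<in> carrier ?R"
    then show "x \<otimes>\<^bsub>?R\<^esub> a \<in> ?I" "a \<otimes>\<^bsub>?R\<^esub> x \<in> ?I"
      using l[of a x] R.m_comm[of a x] I.mem_carrier[of a] by auto
  qed
qed

definition tensor_ring ::
    "('a, 'b) ring_scheme \<Rightarrow> ('a, 'c) module \<Rightarrow> ('a, 'd) module \<Rightarrow> ('c \<times> 'd \<Rightarrow>\<^sub>0 int) set ring" where
  "tensor_ring K T U = monoid_ring (T \<times>\<times> U) Quot tensor_rel K T U"

text \<open>
  Cosets of the ideal are cosets of the subgroup, so \<^const>\<open>tensor_ring\<close> puts a ring structure on the
  module \<^term>\<open>tensor_module K T U\<close>.
\<close>

lemma tensor_ring_ops:
  assumes T: "comm_alg K T" and U: "comm_alg K U"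
  shows "cring (tensor_ring K T U)"
    "carrier (tensor_ring K T U) = carrier (tensor_module K T U)"
    "x \<oplus>\<^bsub>tensor_ring K T U\<^esub> y = x \<oplus>\<^bsub>tensor_module K T U\<^esub> y"
    "\<one>\<^bsub>tensor_ring K T U\<^esub> = pure_tensor K T U \<one>\<^bsub>T\<^esub> \<one>\<^bsub>U\<^esub>"
    "\<lbrakk>t \<in> carrier T; u \<in> carrier U; t' \<in> carrier T; u' \<in> carrier U\<rbrakk> \<Longrightarrow>
      pure_tensor K T U t u \<otimes>\<^bsub>tensor_ring K T U\<^esub> pure_tensor K T U t' u' =
      pure_tensor K T U (t \<otimes>\<^bsub>T\<^esub> t') (u \<otimes>\<^bsub>U\<^esub> u')"
proof -
  let ?R = "monoid_ring (T \<times>\<times> U)"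
  interpret I: ideal "tensor_rel K T U" ?R using T U by (rule tensor_rel_ideal)
  interpret Tr: cring T using T by (rule comm_algD)
  interpret Ur: cring U using U by (rule comm_algD)
  have cm: "comm_monoid (T \<times>\<times> U)"
    using comm_algD(4)[OF T] comm_algD(4)[OF U] by (intro comm_monoid_DirProd cring.axioms(2))
  show "cring (tensor_ring K T U)"
    unfolding tensor_ring_def by (rule I.quotient_is_cring[OF cring_monoid_ring[OF cm]])
  have coset: "tensor_rel K T U +>\<^bsub>?R\<^esub> c = tcoset K T U c" for c
    by (simp add: a_r_coset_def r_coset_def)
  show "carrier (tensor_ring K T U) = carrier (tensor_module K T U)"
    by (simp add: tensor_ring_def FactRing_def tensor_module_simps FactGroup_def A_RCOSETS_def RCOSETS_def r_coset_def)
  show "x \<oplus>\<^bsub>tensor_ring K T U\<^esub> y = x \<oplus>\<^bsub>tensor_module K T U\<^esub> y"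
    by (simp add: tensor_ring_def FactRing_def tensor_module_simps FactGroup_def set_add_def set_mult_def)
  show "\<one>\<^bsub>tensor_ring K T U\<^esub> = pure_tensor K T U \<one>\<^bsub>T\<^esub> \<one>\<^bsub>U\<^esub>"
    by (simp add: tensor_ring_def FactRing_def pure_tensor_def coset)
  show "pure_tensor K T U t u \<otimes>\<^bsub>tensor_ring K T U\<^esub> pure_tensor K T U t' u' =
      pure_tensor K T U (t \<otimes>\<^bsub>T\<^esub> t') (u \<otimes>\<^bsub>U\<^esub> u')"
    if "t \<in> carrier T" "u \<in> carrier U" "t' \<in> carrier T" "u' \<in> carrier U"
    using ring_hom_mult[OF I.rcos_ring_hom, of "frag_of (t, u)" "frag_of (t', u')"] that
    by (simp add: tensor_ring_def pure_tensor_def coset)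
qed

section \<open>Transporting tensor products into the universe\<close>

lemma infinite_inj_prod:
  assumes "infinite (UNIV :: 'u set)"
  shows "\<exists>j :: 'u \<times> 'u \<Rightarrow> 'u. inj j"
proof -
  have "|(UNIV :: 'u set) \<times> (UNIV :: 'u set)| \<le>o |UNIV :: 'u set|"
    using card_of_Times_same_infinite[OF assms] ordIso_imp_ordLeq by blast
  then show ?thesis unfolding card_of_ordLeq[symmetric] by auto
qed

lemma infinite_inj_list:
  assumes "infinite (UNIV :: 'u set)"
  shows "\<exists>j :: 'u list \<Rightarrow> 'u. inj j"
proof -
  obtain p :: "'u \<times> 'u \<Rightarrow> 'u" where p: "inj p" using infinite_inj_prod[OF assms] by blast
  obtain a b :: 'u where ab: "a \<noteq> b"
    by (metis (full_types) assms ex_new_if_finite finite.intros(1,2) infinite_imp_nonempty insertI1)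
  \<comment> \<open>Nested pairs; the first component \<open>a\<close> or \<open>b\<close> tells whether the list is empty.\<close>
  define e where "e = rec_list (p (a, a)) (\<lambda>x _ r. p (b, p (x, r)))"
  have e: "e [] = p (a, a)" "e (x # xs) = p (b, p (x, e xs))" for x xs
    by (simp_all add: e_def)
  have "xs = ys" if "e xs = e ys" for xs ys
    using that
  proof (induction xs arbitrary: ys)
    case Nil
    then show ?case using ab by (cases ys) (auto simp: e dest!: injD[OF p])
  next
    case (Cons x xs)
    then show ?case using ab by (cases ys) (auto simp: e dest!: injD[OF p])
  qed
  then have "inj e" by (rule injI)
  then show ?thesis by blast
qed

text \<open>
  An element of the free abelian group is determined by the finite list of its support together
  with the coefficients.
\<close>

lemma infinite_inj_frag:
  assumes "infinite (UNIV :: 'u set)"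
  shows "\<exists>j :: ('u \<times> 'u \<Rightarrow>\<^sub>0 int) \<Rightarrow> 'u. inj j"
proof -
  obtain p :: "'u \<times> 'u \<Rightarrow> 'u" where p: "inj p" using infinite_inj_prod[OF assms] by blast
  obtain l :: "'u list \<Rightarrow> 'u" where l: "inj l" using infinite_inj_list[OF assms] by blast
  obtain n :: "nat \<Rightarrow> 'u" where n: "inj n" using infinite_countable_subset[OF assms] by blast
  define ks :: "('u \<times> 'u \<Rightarrow>\<^sub>0 int) \<Rightarrow> ('u \<times> 'u) list" where
    "ks c = (SOME xs. set xs = Poly_Mapping.keys c)" for c
  have ks: "set (ks c) = Poly_Mapping.keys c" for c
    unfolding ks_def by (rule someI_ex) (simp add: finite_list)
  define tab where "tab c = map (\<lambda>k. (k, Poly_Mapping.lookup c k)) (ks c)" for c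
  have tab: "c = d" if "tab c = tab d" for c d
  proof (rule poly_mapping_eqI)
    fix k
    have iff: "(k, v) \<in> set (tab c) \<longleftrightarrow> v \<noteq> 0 \<and> v = Poly_Mapping.lookup c k" for c v
      by (auto simp: tab_def ks in_keys_iff)
    then show "Poly_Mapping.lookup c k = Poly_Mapping.lookup d k"
      using that iff[of "Poly_Mapping.lookup c k" c] iff[of "Poly_Mapping.lookup d k" d]
        iff[of "Poly_Mapping.lookup c k" d] iff[of "Poly_Mapping.lookup d k" c] by auto
  qed
  define q where "q = (\<lambda>(k, z). p (p k, n (int_encode z)))"
  have q: "inj q"
    by (rule injI) (auto simp: q_def dest!: injD[OF p] injD[OF n] injD[OF inj_int_encode])
  have "inj (\<lambda>c. l (map q (tab c)))"
    by (rule injI) (auto dest!: injD[OF l] simp: inj_map_eq_map[OF q] intro: tab)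
  then show ?thesis by blast
qed

text \<open>
  An encoding of cosets in \<open>'u\<close>, which is injective on a tensor product if \<open>'u\<close> is infinite.
\<close>

definition coset_code :: "('u \<times> 'u \<Rightarrow>\<^sub>0 int) set \<Rightarrow> 'u" where
  "coset_code x = (SOME j. inj j) (SOME c. c \<in> x)"

lemma inj_on_coset_code:
  fixes T U :: "('u, 'u) module"
  assumes inf: "infinite (UNIV :: 'u set)" and T: "module K T" and U: "module K U"
  shows "inj_on coset_code (carrier (tensor_module K T U))"
proof (rule inj_onI)
  have N: "subgroup (tensor_rel K T U) (tensor_free T U)"
    using normal_imp_subgroup[OF tensor_rel_normal[OF T U]] .
  have some: "(SOME c. c \<in> x) \<in> x" if x: "x \<in> carrier (tensor_module K T U)" for x
  proof -
    obtain c where "c \<in> carrier (tensor_free T U)" "x = tcoset K T U c"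
      by (rule tensor_carrierE[OF x])
    then have "c \<in> x" using group.rcos_self[OF group_free_Abelian_group _ N] by blast
    then show ?thesis by (rule someI)
  qed
  have eq: "x = tcoset K T U c" if "x \<in> carrier (tensor_module K T U)" "c \<in> x" for x c
    using that(1)
  proof (rule tensor_carrierE)
    fix d assume d: "d \<in> carrier (tensor_free T U)" "x = tcoset K T U d"
    then show ?thesis using group.repr_independence[OF group_free_Abelian_group _ d(1) N, of c] that(2) by simp
  qed
  have "inj (SOME j :: ('u \<times> 'u \<Rightarrow>\<^sub>0 int) \<Rightarrow> 'u. inj j)"
    using infinite_inj_frag[OF inf] by (rule someI_ex)
  note inj = this
  fix x y assume x: "x \<in> carrier (tensor_module K T U)" and y: "y \<in> carrier (tensor_module K T U)"
    and xy: "coset_code x = coset_code y"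
  have "(SOME c. c \<in> x) = (SOME c. c \<in> y)"
    using injD[OF inj xy[unfolded coset_code_def]] .
  then show "x = y" using eq[OF x some[OF x]] eq[OF y some[OF y]] by simp
qed

definition tens_pure ::
    "('u, 'b) ring_scheme \<Rightarrow> ('u, 'u) module \<Rightarrow> ('u, 'u) module \<Rightarrow> 'u \<Rightarrow> 'u \<Rightarrow> 'u" where
  "tens_pure K T U t u = coset_code (pure_tensor K T U t u)"

text \<open>
  The tensor product as an object of the category: the ring \<^const>\<open>tensor_ring\<close> carried over to the
  universe \<open>'u\<close> along \<^const>\<open>coset_code\<close>, and regarded as an algebra over the first factor.
\<close>

definition tens ::
    "('u, 'b) ring_scheme \<Rightarrow> ('u, 'u) module \<Rightarrow> ('u, 'u) module \<Rightarrow> ('u, 'u) module" where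
  "tens K T U = (let R = image_ring coset_code (tensor_ring K T U) in
     \<lparr>carrier = carrier R, monoid.mult = monoid.mult R, one = one R, ring.zero = ring.zero R,
      ring.add = ring.add R,
      smult = (\<lambda>t\<in>carrier T. \<lambda>x\<in>carrier R. tens_pure K T U t \<one>\<^bsub>U\<^esub> \<otimes>\<^bsub>R\<^esub> x)\<rparr>)"

context
  fixes K :: "('u, 'b) ring_scheme" and T U :: "('u, 'u) module"
  assumes inf: "infinite (UNIV :: 'u set)" and T: "comm_alg K T" and U: "comm_alg K U"
begin

private abbreviation (input) "TU \<equiv> tens K T U"

interpretation T: algebra K T using T by (rule comm_algD)
interpretation U: algebra K U using U by (rule comm_algD)

lemma coset_code_iso: "coset_code \<in> ring_iso (tensor_ring K T U) TU"
  using inj_imp_image_ring_iso[of coset_code "tensor_ring K T U"]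
    inj_on_coset_code[OF inf T.module U.module]
  by (simp add: tensor_ring_ops(2)[OF T U] ring_iso_def ring_hom_def tens_def Let_def)

lemma cring_tens: "cring TU"
proof -
  interpret R: cring "tensor_ring K T U" using T U by (rule tensor_ring_ops)
  have "cring (image_ring coset_code (tensor_ring K T U))"
    using R.ring_iso_imp_img_cring[OF inj_imp_image_ring_iso[of coset_code "tensor_ring K T U"]]
      inj_on_coset_code[OF inf T.module U.module]
    by (simp add: tensor_ring_ops(2)[OF T U] image_ring_def image_group_def monoid.defs)
  then show ?thesis by (rule cring_cong) (simp_all add: tens_def Let_def)
qed

interpretation A: cring "TU" by (rule cring_tens)

lemma coset_code_hom: "coset_code \<in> ring_hom (tensor_ring K T U) TU"
  using coset_code_iso by (simp add: ring_iso_def)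

lemma carrier_tens: "carrier TU = coset_code ` carrier (tensor_module K T U)"
  using coset_code_iso by (simp add: ring_iso_def bij_betw_def tensor_ring_ops(2)[OF T U])

lemma coset_code_add:
  assumes "x \<in> carrier (tensor_module K T U)" "y \<in> carrier (tensor_module K T U)"
  shows "coset_code (x \<oplus>\<^bsub>tensor_module K T U\<^esub> y) = coset_code x \<oplus>\<^bsub>TU\<^esub> coset_code y"
  using ring_hom_add[OF coset_code_hom] assms by (simp add: tensor_ring_ops[OF T U])

lemma tens_pure_closed:
  "t \<in> carrier T \<Longrightarrow> u \<in> carrier U \<Longrightarrow> tens_pure K T U t u \<in> carrier TU"
  unfolding tens_pure_def carrier_tens
  using pure_tensor_closed[OF T.module U.module] by blast

lemma tens_pure_add:
  "\<lbrakk>t \<in> carrier T; t' \<in> carrier T; u \<in> carrier U\<rbrakk> \<Longrightarrow>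
    tens_pure K T U (t \<oplus>\<^bsub>T\<^esub> t') u = tens_pure K T U t u \<oplus>\<^bsub>TU\<^esub> tens_pure K T U t' u"
  "\<lbrakk>t \<in> carrier T; u \<in> carrier U; u' \<in> carrier U\<rbrakk> \<Longrightarrow>
    tens_pure K T U t (u \<oplus>\<^bsub>U\<^esub> u') = tens_pure K T U t u \<oplus>\<^bsub>TU\<^esub> tens_pure K T U t u'"
  unfolding tens_pure_def
  by (simp_all add: coset_code_add[symmetric] pure_tensor_closed[OF T.module U.module]
      pure_tensor_add_left[OF T.module U.module] pure_tensor_add_right[OF T.module U.module])

lemma tens_pure_smult:
  "\<lbrakk>a \<in> carrier K; t \<in> carrier T; u \<in> carrier U\<rbrakk> \<Longrightarrow>
    tens_pure K T U (a \<odot>\<^bsub>T\<^esub> t) u = tens_pure K T U t (a \<odot>\<^bsub>U\<^esub> u)"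
  unfolding tens_pure_def by (simp add: pure_tensor_smult[OF T.module U.module])

lemma tens_pure_one: "\<one>\<^bsub>TU\<^esub> = tens_pure K T U \<one>\<^bsub>T\<^esub> \<one>\<^bsub>U\<^esub>"
  using ring_hom_one[OF coset_code_hom] by (simp add: tensor_ring_ops[OF T U] tens_pure_def)

lemma tens_pure_mult:
  "\<lbrakk>t \<in> carrier T; u \<in> carrier U; t' \<in> carrier T; u' \<in> carrier U\<rbrakk> \<Longrightarrow>
    tens_pure K T U t u \<otimes>\<^bsub>TU\<^esub> tens_pure K T U t' u' =
    tens_pure K T U (t \<otimes>\<^bsub>T\<^esub> t') (u \<otimes>\<^bsub>U\<^esub> u')"
  unfolding tens_pure_def
  using ring_hom_mult[OF coset_code_hom, of "pure_tensor K T U t u" "pure_tensor K T U t' u'"]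
  by (simp add: tensor_ring_ops[OF T U] pure_tensor_closed[OF T.module U.module])

lemma tens_induct:
  assumes "x \<in> carrier TU"
    and pure: "\<And>t u. t \<in> carrier T \<Longrightarrow> u \<in> carrier U \<Longrightarrow> P (tens_pure K T U t u)"
    and add: "\<And>x y. \<lbrakk>x \<in> carrier TU; y \<in> carrier TU; P x; P y\<rbrakk>
      \<Longrightarrow> P (x \<oplus>\<^bsub>TU\<^esub> y)"
  shows "P x"
proof -
  obtain z where z: "z \<in> carrier (tensor_module K T U)" "x = coset_code z"
    using assms(1) carrier_tens by blast
  have "P (coset_code z)"
    using z(1)
  proof (rule tensor_induct[OF T.module U.module])
    fix x y assume "x \<in> carrier (tensor_module K T U)" "y \<in> carrier (tensor_module K T U)"
      "P (coset_code x)" "P (coset_code y)"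
    then show "P (coset_code (x \<oplus>\<^bsub>tensor_module K T U\<^esub> y))"
      using add[of "coset_code x" "coset_code y"] by (simp add: coset_code_add carrier_tens)
  qed (use pure in \<open>simp add: tens_pure_def\<close>)
  then show ?thesis using z by simp
qed

lemma tens_universal:
  assumes H: "abelian_group H"
    and "\<And>v s. v \<in> carrier T \<Longrightarrow> s \<in> carrier U \<Longrightarrow> \<beta> v s \<in> carrier H"
    and "\<And>v v' s. v \<in> carrier T \<Longrightarrow> v' \<in> carrier T \<Longrightarrow> s \<in> carrier U \<Longrightarrow>
      \<beta> (v \<oplus>\<^bsub>T\<^esub> v') s = \<beta> v s \<oplus>\<^bsub>H\<^esub> \<beta> v' s"
    and "\<And>v s s'. v \<in> carrier T \<Longrightarrow> s \<in> carrier U \<Longrightarrow> s' \<in> carrier U \<Longrightarrow>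
      \<beta> v (s \<oplus>\<^bsub>U\<^esub> s') = \<beta> v s \<oplus>\<^bsub>H\<^esub> \<beta> v s'"
    and "\<And>a v s. a \<in> carrier K \<Longrightarrow> v \<in> carrier T \<Longrightarrow> s \<in> carrier U \<Longrightarrow>
      \<beta> (a \<odot>\<^bsub>T\<^esub> v) s = \<beta> v (a \<odot>\<^bsub>U\<^esub> s)"
  obtains h where
    "\<And>x. x \<in> carrier TU \<Longrightarrow> h x \<in> carrier H"
    "\<And>x y. x \<in> carrier TU \<Longrightarrow> y \<in> carrier TU \<Longrightarrow>
      h (x \<oplus>\<^bsub>TU\<^esub> y) = h x \<oplus>\<^bsub>H\<^esub> h y"
    "\<And>t u. t \<in> carrier T \<Longrightarrow> u \<in> carrier U \<Longrightarrow> h (tens_pure K T U t u) = \<beta> t u"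
proof -
  let ?X = "tensor_module K T U"
  interpret X: abelian_group ?X using T.module U.module by (rule abelian_group_tensor)
  obtain g where g: "\<And>x. x \<in> carrier ?X \<Longrightarrow> g x \<in> carrier H"
    "\<And>x y. x \<in> carrier ?X \<Longrightarrow> y \<in> carrier ?X \<Longrightarrow> g (x \<oplus>\<^bsub>?X\<^esub> y) = g x \<oplus>\<^bsub>H\<^esub> g y"
    "\<And>t u. t \<in> carrier T \<Longrightarrow> u \<in> carrier U \<Longrightarrow> g (pure_tensor K T U t u) = \<beta> t u"
    by (rule tensor_universal[OF T.module U.module H, of \<beta>]) (use assms(2-) in auto)
  define d where "d = inv_into (carrier ?X) coset_code"
  have d: "d (coset_code x) = x" if "x \<in> carrier ?X" for x
    unfolding d_def using inj_on_coset_code[OF inf T.module U.module] that by (rule inv_into_f_f)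
  show thesis
  proof (rule that[of "\<lambda>x. g (d x)"])
    show "g (d x) \<in> carrier H" if "x \<in> carrier TU" for x
      using that by (auto simp: carrier_tens d g)
    show "g (d (x \<oplus>\<^bsub>TU\<^esub> y)) = g (d x) \<oplus>\<^bsub>H\<^esub> g (d y)"
      if "x \<in> carrier TU" "y \<in> carrier TU" for x y
      using that by (auto simp: carrier_tens d g coset_code_add[symmetric])
    show "g (d (tens_pure K T U t u)) = \<beta> t u" if "t \<in> carrier T" "u \<in> carrier U" for t u
      using that pure_tensor_closed[OF T.module U.module] by (simp add: tens_pure_def d g)
  qed
qed

lemma tens_smult:
  "t \<in> carrier T \<Longrightarrow> x \<in> carrier TU \<Longrightarrow>
    t \<odot>\<^bsub>TU\<^esub> x = tens_pure K T U t \<one>\<^bsub>U\<^esub> \<otimes>\<^bsub>TU\<^esub> x"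
  unfolding tens_def Let_def by simp

lemma comm_alg_tens: "comm_alg T TU"
proof (rule comm_algI[where \<eta>="\<lambda>t. tens_pure K T U t \<one>\<^bsub>U\<^esub>"])
  show "(\<lambda>t. tens_pure K T U t \<one>\<^bsub>U\<^esub>) \<in> ring_hom T TU"
    by (rule ring_hom_memI)
       (simp_all add: tens_pure_closed tens_pure_mult tens_pure_add tens_pure_one)
  show "cring T" by (rule T.M_cring)
  show "cring TU" by (rule cring_tens)
  show "smult TU \<in> extensional (carrier T)"
    unfolding tens_def Let_def by simp
  show "smult TU a \<in> extensional (carrier TU)" if "a \<in> carrier T" for a
    unfolding tens_def Let_def using that by simp
  show "a \<odot>\<^bsub>TU\<^esub> x = tens_pure K T U a \<one>\<^bsub>U\<^esub> \<otimes>\<^bsub>TU\<^esub> x"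
    if "a \<in> carrier T" "x \<in> carrier TU" for a x
    using that by (rule tens_smult)
qed

lemma unit_map_tens: "t \<in> carrier T \<Longrightarrow> unit_map T TU t = tens_pure K T U t \<one>\<^bsub>U\<^esub>"
proof -
  assume t: "t \<in> carrier T"
  have "t \<odot>\<^bsub>TU\<^esub> \<one>\<^bsub>TU\<^esub> = tens_pure K T U t \<one>\<^bsub>U\<^esub> \<otimes>\<^bsub>TU\<^esub> \<one>\<^bsub>TU\<^esub>"
    using t by (simp add: tens_smult)
  then show ?thesis using t by (simp add: unit_map_def tens_pure_closed)
qed

lemma tens_pure_eq:
  "t \<in> carrier T \<Longrightarrow> u \<in> carrier U \<Longrightarrow>
    tens_pure K T U t u = t \<odot>\<^bsub>TU\<^esub> tens_pure K T U \<one>\<^bsub>T\<^esub> u"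
  by (simp add: unit_map_mult[OF comm_alg_tens, symmetric] unit_map_tens tens_pure_mult tens_pure_closed)

lemma tens_inr:
  "(\<lambda>u\<in>carrier U. tens_pure K T U \<one>\<^bsub>T\<^esub> u)
    \<in> alg_hom K U (restrict_scalars K (unit_map K T) TU)"
proof (rule alg_homI)
  show "comm_alg K (restrict_scalars K (unit_map K T) TU)"
    using T comm_alg_tens by (rule comm_alg_restrict_unit)
  show "(\<lambda>u\<in>carrier U. tens_pure K T U \<one>\<^bsub>T\<^esub> u)
      \<in> ring_hom U (restrict_scalars K (unit_map K T) TU)"
    by (rule ring_hom_memI)
       (simp_all add: tens_pure_closed tens_pure_mult tens_pure_add tens_pure_one)
  fix a assume a: "a \<in> carrier K"
  have "unit_map K (restrict_scalars K (unit_map K T) TU) a = unit_map T TU (unit_map K T a)"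
    using T comm_alg_tens a by (rule unit_map_restrict_scalars)
  also have "\<dots> = tens_pure K T U (a \<odot>\<^bsub>T\<^esub> \<one>\<^bsub>T\<^esub>) \<one>\<^bsub>U\<^esub>"
    using a T by (simp add: unit_map_tens) (simp add: unit_map_def)
  also have "\<dots> = tens_pure K T U \<one>\<^bsub>T\<^esub> (unit_map K U a)"
    using a by (simp add: tens_pure_smult unit_map_def)
  finally show "(\<lambda>u\<in>carrier U. tens_pure K T U \<one>\<^bsub>T\<^esub> u) (unit_map K U a) =
    unit_map K (restrict_scalars K (unit_map K T) TU) a"
    using a U by simp
qed (use U in auto)

text \<open>
  The tensor product is the base change of \<open>U\<close> to \<open>T\<close>: a \<open>K\<close>-algebra map \<open>\<psi>\<close> to a \<open>T\<close>-algebra extends to a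
  \<open>T\<close>-algebra map. Multiplicativity is checked on pairs of pure tensors.
\<close>

lemma tens_alg_hom:
  assumes B: "comm_alg T B" and \<psi>: "\<psi> \<in> ring_hom U B"
    and lin: "\<And>a. a \<in> carrier K \<Longrightarrow> \<psi> (unit_map K U a) = unit_map T B (unit_map K T a)"
  obtains h where "h \<in> alg_hom T TU B"
    "\<And>t u. t \<in> carrier T \<Longrightarrow> u \<in> carrier U \<Longrightarrow> h (tens_pure K T U t u) = t \<odot>\<^bsub>B\<^esub> \<psi> u"
proof -
  interpret B: algebra T B using B by (rule comm_algD)
  have [simp]: "\<psi> u \<in> carrier B" if "u \<in> carrier U" for u using \<psi> that by (rule ring_hom_closed)
  have bal: "(a \<odot>\<^bsub>T\<^esub> t) \<odot>\<^bsub>B\<^esub> \<psi> u = t \<odot>\<^bsub>B\<^esub> \<psi> (a \<odot>\<^bsub>U\<^esub> u)"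
    if "a \<in> carrier K" "t \<in> carrier T" "u \<in> carrier U" for a t u
  proof -
    have "\<psi> (a \<odot>\<^bsub>U\<^esub> u) = \<psi> (unit_map K U a) \<otimes>\<^bsub>B\<^esub> \<psi> u"
      using that U \<psi> by (simp add: unit_map_mult[symmetric] ring_hom_mult)
    also have "\<dots> = unit_map K T a \<odot>\<^bsub>B\<^esub> \<psi> u"
      using that T B by (simp add: lin unit_map_mult)
    finally have 1: "\<psi> (a \<odot>\<^bsub>U\<^esub> u) = unit_map K T a \<odot>\<^bsub>B\<^esub> \<psi> u" .
    have "(a \<odot>\<^bsub>T\<^esub> t) = t \<otimes>\<^bsub>T\<^esub> unit_map K T a"
      using that T T.m_comm[of t "unit_map K T a"] by (simp add: unit_map_mult)
    then show ?thesis using 1 that T by (simp add: B.smult_assoc1)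
  qed
  obtain h where h: "\<And>x. x \<in> carrier TU \<Longrightarrow> h x \<in> carrier B"
    "\<And>x y. x \<in> carrier TU \<Longrightarrow> y \<in> carrier TU \<Longrightarrow>
      h (x \<oplus>\<^bsub>TU\<^esub> y) = h x \<oplus>\<^bsub>B\<^esub> h y"
    "\<And>t u. t \<in> carrier T \<Longrightarrow> u \<in> carrier U \<Longrightarrow> h (tens_pure K T U t u) = t \<odot>\<^bsub>B\<^esub> \<psi> u"
    by (rule tens_universal[OF B.abelian_group_axioms, of "\<lambda>t u. t \<odot>\<^bsub>B\<^esub> \<psi> u"])
       (auto simp: B.smult_l_distr B.smult_r_distr ring_hom_add[OF \<psi>] bal)
  have mult: "h (x \<otimes>\<^bsub>TU\<^esub> y) = h x \<otimes>\<^bsub>B\<^esub> h y"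
    if x: "x \<in> carrier TU" and y: "y \<in> carrier TU" for x y
    using x
  proof (rule tens_induct)
    fix t u assume t: "t \<in> carrier T" "u \<in> carrier U"
    show "h (tens_pure K T U t u \<otimes>\<^bsub>TU\<^esub> y) = h (tens_pure K T U t u) \<otimes>\<^bsub>B\<^esub> h y"
      using y
    proof (rule tens_induct)
      fix t' u' assume t': "t' \<in> carrier T" "u' \<in> carrier U"
      have "(t \<otimes>\<^bsub>T\<^esub> t') \<odot>\<^bsub>B\<^esub> (\<psi> u \<otimes>\<^bsub>B\<^esub> \<psi> u') = (t \<odot>\<^bsub>B\<^esub> \<psi> u) \<otimes>\<^bsub>B\<^esub> (t' \<odot>\<^bsub>B\<^esub> \<psi> u')"
        using t t' B.m_comm[of "\<psi> u" "t' \<odot>\<^bsub>B\<^esub> \<psi> u'"] B.m_comm[of "\<psi> u" "\<psi> u'"]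
        by (simp add: B.smult_assoc1 B.smult_assoc2)
      then show "h (tens_pure K T U t u \<otimes>\<^bsub>TU\<^esub> tens_pure K T U t' u') =
        h (tens_pure K T U t u) \<otimes>\<^bsub>B\<^esub> h (tens_pure K T U t' u')"
        using t t' by (simp add: tens_pure_mult h ring_hom_mult[OF \<psi>])
    next
      fix x y assume "x \<in> carrier TU" "y \<in> carrier TU"
        "h (tens_pure K T U t u \<otimes>\<^bsub>TU\<^esub> x) = h (tens_pure K T U t u) \<otimes>\<^bsub>B\<^esub> h x"
        "h (tens_pure K T U t u \<otimes>\<^bsub>TU\<^esub> y) = h (tens_pure K T U t u) \<otimes>\<^bsub>B\<^esub> h y"
      then show "h (tens_pure K T U t u \<otimes>\<^bsub>TU\<^esub> (x \<oplus>\<^bsub>TU\<^esub> y)) =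
        h (tens_pure K T U t u) \<otimes>\<^bsub>B\<^esub> h (x \<oplus>\<^bsub>TU\<^esub> y)"
        using t h(1)[OF tens_pure_closed[OF t]] by (simp add: A.r_distr B.r_distr tens_pure_closed h(1,2))
    qed
  next
    fix x z assume "x \<in> carrier TU" "z \<in> carrier TU"
      "h (x \<otimes>\<^bsub>TU\<^esub> y) = h x \<otimes>\<^bsub>B\<^esub> h y" "h (z \<otimes>\<^bsub>TU\<^esub> y) = h z \<otimes>\<^bsub>B\<^esub> h y"
    then show "h ((x \<oplus>\<^bsub>TU\<^esub> z) \<otimes>\<^bsub>TU\<^esub> y) = h (x \<oplus>\<^bsub>TU\<^esub> z) \<otimes>\<^bsub>B\<^esub> h y"
      using y by (simp add: A.l_distr B.l_distr h)
  qed
  have one: "h \<one>\<^bsub>TU\<^esub> = \<one>\<^bsub>B\<^esub>"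
    using h(3)[of "\<one>\<^bsub>T\<^esub>" "\<one>\<^bsub>U\<^esub>"] by (simp add: tens_pure_one ring_hom_one[OF \<psi>])
  have unit: "h (unit_map T TU t) = unit_map T B t" if "t \<in> carrier T" for t
    using h(3)[of t "\<one>\<^bsub>U\<^esub>"] that by (simp add: unit_map_tens ring_hom_one[OF \<psi>]) (simp add: unit_map_def)
  show thesis
  proof (rule that[of "restrict h (carrier TU)"])
    show "restrict h (carrier TU) \<in> alg_hom T TU B"
    proof (rule alg_homI)
      show "restrict h (carrier TU) \<in> ring_hom TU B"
        by (rule ring_hom_memI) (simp_all add: h mult one)
    qed (use B comm_alg_tens in \<open>auto simp: unit\<close>)
  qed (simp add: h tens_pure_closed)
qed

end

section \<open>Separating tensors by linear functionals\<close>

definition is_functional :: "('u, 'b) ring_scheme \<Rightarrow> ('u, 'v) module \<Rightarrow> ('v \<Rightarrow> 'u) \<Rightarrow> bool" where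
  "is_functional K V \<phi> \<longleftrightarrow> (\<forall>v\<in>carrier V. \<phi> v \<in> carrier K) \<and>
     (\<forall>v\<in>carrier V. \<forall>v'\<in>carrier V. \<phi> (v \<oplus>\<^bsub>V\<^esub> v') = \<phi> v \<oplus>\<^bsub>K\<^esub> \<phi> v') \<and>
     (\<forall>a\<in>carrier K. \<forall>v\<in>carrier V. \<phi> (a \<odot>\<^bsub>V\<^esub> v) = a \<otimes>\<^bsub>K\<^esub> \<phi> v)"

text \<open>
  Zorn's lemma gives a subspace \<open>M\<close> that is maximal among those that contain \<open>W\<close> and avoid \<open>v\<close>.
  Maximality makes it a complement of the line through \<open>v\<close>, and \<open>\<phi>\<close> reads off the coefficient of \<open>v\<close>.
\<close>

lemma exists_functional:
  fixes V (structure)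
  assumes K: "field K" and V: "module K V" and W: "submodule W K V"
    and v: "v \<in> carrier V" "v \<notin> W"
  obtains \<phi> where "is_functional K V \<phi>" "\<phi> v = \<one>\<^bsub>K\<^esub>" "\<And>w. w \<in> W \<Longrightarrow> \<phi> w = \<zero>\<^bsub>K\<^esub>"
proof -
  interpret K: field K by fact
  interpret V: module K V by fact
  define Fam where "Fam = {P. submodule P K V \<and> W \<subseteq> P \<and> v \<notin> P}"
  have "\<exists>M\<in>Fam. \<forall>P\<in>Fam. M \<subseteq> P \<longrightarrow> P = M"
  proof (rule subset_Zorn_nonempty)
    show "Fam \<noteq> {}" using W v by (auto simp: Fam_def)
    fix Ch assume ne: "Ch \<noteq> {}" and ch: "subset.chain Fam Ch"
    have sub: "submodule P K V" "W \<subseteq> P" "v \<notin> P" if "P \<in> Ch" for P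
      using ch that by (auto simp: subset.chain_def Fam_def)
    have two: "\<exists>P\<in>Ch. a \<in> P \<and> b \<in> P" if ab: "a \<in> (\<Union>Ch)" "b \<in> (\<Union>Ch)" for a b
    proof -
      obtain P Q where "P \<in> Ch" "a \<in> P" "Q \<in> Ch" "b \<in> Q" using ab by blast
      moreover from this have "P \<subseteq> Q \<or> Q \<subseteq> P" using ch by (auto simp: subset.chain_def)
      ultimately show ?thesis by blast
    qed
    have "submodule ((\<Union>Ch)) K V"
    proof (rule V.submoduleI)
      show "(\<Union>Ch) \<subseteq> carrier V" using V.submoduleE(1)[OF sub(1)] by blast
      show "\<zero> \<in> (\<Union>Ch)"
        using ne sub(1) subgroup.one_closed submodule.axioms(1) by fastforce
      show "\<ominus> a \<in> (\<Union>Ch)" if "a \<in> (\<Union>Ch)" for a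
        using that V.submoduleE(3)[OF sub(1)] by blast
      show "a \<oplus> b \<in> (\<Union>Ch)" if "a \<in> (\<Union>Ch)" "b \<in> (\<Union>Ch)" for a b
        using two[OF that] V.submoduleE(5)[OF sub(1)] by blast
      show "a \<odot> b \<in> (\<Union>Ch)" if "a \<in> carrier K" "b \<in> (\<Union>Ch)" for a b
        using that V.submoduleE(4)[OF sub(1)] by blast
    qed
    moreover have "W \<subseteq> \<Union>Ch" using sub(2) ne by (meson Sup_upper2 ex_in_conv)
    ultimately show "(\<Union>Ch) \<in> Fam" using sub(3) by (auto simp: Fam_def)
  qed
  then obtain M where M: "submodule M K V" "W \<subseteq> M" "v \<notin> M"
    and max: "\<And>P. submodule P K V \<Longrightarrow> M \<subseteq> P \<Longrightarrow> v \<notin> P \<Longrightarrow> P = M"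
    by (auto simp: Fam_def)
  note Mc = V.submoduleE(1)[OF M(1), THEN subsetD]
  note Mneg = V.submoduleE(3)[OF M(1)] and Msm = V.submoduleE(4)[OF M(1)] and Madd = V.submoduleE(5)[OF M(1)]
  have M0: "\<zero> \<in> M" using subgroup.one_closed[OF submodule.axioms(1)[OF M(1)]] by simp
  have ex: "\<exists>a\<in>carrier K. \<exists>m\<in>M. u = a \<odot> v \<oplus> m" if u: "u \<in> carrier V" for u
  proof (cases "u \<in> M")
    case True
    then show ?thesis using v u by (intro bexI[of _ "\<zero>\<^bsub>K\<^esub>"] bexI[of _ u]) auto
  next
    case False
    \<comment> \<open>The span of \<open>M\<close> and \<open>u\<close>. It is larger than \<open>M\<close> and so contains \<open>v\<close>, which expresses \<open>u\<close> by \<open>v\<close> modulo \<open>M\<close>.\<close>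
    define P where "P = {b \<odot> u \<oplus> m | b m. b \<in> carrier K \<and> m \<in> M}"
    have PI: "b \<odot> u \<oplus> m \<in> P" if "b \<in> carrier K" "m \<in> M" for b m using that by (auto simp: P_def)
    have "submodule P K V"
    proof (rule V.submoduleI)
      show "P \<subseteq> carrier V" using u Mc by (auto simp: P_def)
      show "\<zero> \<in> P" using PI[OF K.zero_closed M0] u by simp
      show "\<ominus> x \<in> P" if x: "x \<in> P" for x
      proof -
        obtain b m where b: "b \<in> carrier K" "m \<in> M" "x = b \<odot> u \<oplus> m" using x by (auto simp: P_def)
        then have "\<ominus> x = (\<ominus>\<^bsub>K\<^esub> b) \<odot> u \<oplus> \<ominus> m"
          using u Mc by (simp add: V.smult_l_minus V.minus_add)
        then show ?thesis using PI b Mneg by simp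
      qed
      show "x \<oplus> y \<in> P" if x: "x \<in> P" and y: "y \<in> P" for x y
      proof -
        obtain b m where b: "b \<in> carrier K" "m \<in> M" "x = b \<odot> u \<oplus> m" using x by (auto simp: P_def)
        obtain c n where c: "c \<in> carrier K" "n \<in> M" "y = c \<odot> u \<oplus> n" using y by (auto simp: P_def)
        have "x \<oplus> y = (b \<oplus>\<^bsub>K\<^esub> c) \<odot> u \<oplus> (m \<oplus> n)"
          using b c u Mc by (simp add: V.smult_l_distr V.M.a_ac)
        then show ?thesis using PI b c Madd by simp
      qed
      show "a \<odot> x \<in> P" if a: "a \<in> carrier K" and x: "x \<in> P" for a x
      proof -
        obtain b m where b: "b \<in> carrier K" "m \<in> M" "x = b \<odot> u \<oplus> m" using x by (auto simp: P_def)
        then have "a \<odot> x = (a \<otimes>\<^bsub>K\<^esub> b) \<odot> u \<oplus> (a \<odot> m)"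
          using a u Mc by (simp add: V.smult_r_distr V.smult_assoc1)
        then show ?thesis using PI a b Msm by simp
      qed
    qed
    moreover have "M \<subseteq> P"
    proof
      fix m assume "m \<in> M" then show "m \<in> P" using PI[OF K.zero_closed, of m] u Mc by simp
    qed
    moreover have "u \<in> P" using PI[OF K.one_closed M0] u by simp
    ultimately have "v \<in> P" using max False by blast
    then obtain b m where b: "b \<in> carrier K" "m \<in> M" "v = b \<odot> u \<oplus> m" by (auto simp: P_def)
    have "b \<noteq> \<zero>\<^bsub>K\<^esub>" using b u M(3) Mc by auto
    then have bu: "b \<in> Units K" using b K.field_Units by simp
    let ?c = "inv\<^bsub>K\<^esub> b"
    have c: "?c \<in> carrier K" using bu by simp
    have "b \<odot> u = v \<oplus> \<ominus> m"
      using b u Mc by (simp add: V.M.a_assoc V.M.r_neg)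
    then have "?c \<odot> (b \<odot> u) = ?c \<odot> v \<oplus> ?c \<odot> (\<ominus> m)"
      using c v(1) Mc[OF b(2)] by (simp only: V.smult_r_distr V.M.a_inv_closed)
    moreover have "?c \<odot> (b \<odot> u) = u"
      using bu b c u by (simp add: V.smult_assoc1[symmetric])
    ultimately show ?thesis
      by (intro bexI[of _ ?c] bexI[of _ "?c \<odot> (\<ominus> m)"] Msm Mneg b(2) c) simp
  qed
  \<comment> \<open>The coefficient of \<open>v\<close> modulo \<open>M\<close> is unique, since otherwise a unit times \<open>v\<close> would lie in \<open>M\<close>.\<close>
  have uniq: "a = b" if "a \<in> carrier K" "b \<in> carrier K" "m \<in> M" "n \<in> M"
    "a \<odot> v \<oplus> m = b \<odot> v \<oplus> n" for a b m n
  proof (rule ccontr)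
    assume ne: "a \<noteq> b"
    let ?d = "a \<ominus>\<^bsub>K\<^esub> b"
    have d: "?d \<in> Units K" using that ne by (simp add: K.field_Units)
    have "?d \<odot> v = n \<oplus> \<ominus> m"
    proof -
      have "?d \<odot> v = a \<odot> v \<oplus> \<ominus> (b \<odot> v)"
        using that v by (simp add: a_minus_def V.smult_l_distr V.smult_l_minus)
      also have "a \<odot> v = b \<odot> v \<oplus> n \<oplus> \<ominus> m"
      proof -
        have "a \<odot> v = (a \<odot> v \<oplus> m) \<oplus> \<ominus> m"
          using that(1) v(1) Mc[OF that(3)] by (simp add: V.M.a_assoc V.M.r_neg)
        then show ?thesis by (simp only: that(5))
      qed
      finally show ?thesis
        using that(2) v(1) Mc[OF that(3)] Mc[OF that(4)] by (simp add: V.M.a_ac V.M.r_neg)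
    qed
    then have "inv\<^bsub>K\<^esub> ?d \<odot> (?d \<odot> v) \<in> M"
      using Msm Madd Mneg that d by simp
    then have "v \<in> M"
      using d v that by (simp add: V.smult_assoc1[symmetric])
    then show False using M(3) by simp
  qed
  define \<phi> where "\<phi> u = (SOME a. a \<in> carrier K \<and> (\<exists>m\<in>M. u = a \<odot> v \<oplus> m))" for u
  have \<phi>: "\<phi> u \<in> carrier K" "\<exists>m\<in>M. u = \<phi> u \<odot> v \<oplus> m" if "u \<in> carrier V" for u
    using someI_ex[of "\<lambda>a. a \<in> carrier K \<and> (\<exists>m\<in>M. u = a \<odot> v \<oplus> m)"] ex[OF that]
    unfolding \<phi>_def by blast+
  have \<phi>_eq: "\<phi> u = a" if "a \<in> carrier K" "m \<in> M" "u = a \<odot> v \<oplus> m" for u a m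
  proof -
    have u: "u \<in> carrier V" using that v Mc by simp
    obtain n where "n \<in> M" "u = \<phi> u \<odot> v \<oplus> n" using \<phi>(2)[OF u] by blast
    then show ?thesis using uniq[OF \<phi>(1)[OF u] that(1) _ that(2), of n] that(3) by simp
  qed
  show thesis
  proof (rule that[of \<phi>])
    show "\<phi> v = \<one>\<^bsub>K\<^esub>" by (rule \<phi>_eq[OF K.one_closed M0]) (use v in simp)
    show "\<phi> w = \<zero>\<^bsub>K\<^esub>" if "w \<in> W" for w
    proof (rule \<phi>_eq[OF K.zero_closed])
      show "w \<in> M" using that M by blast
      then show "w = \<zero>\<^bsub>K\<^esub> \<odot> v \<oplus> w" using v Mc by simp
    qed
    show "is_functional K V \<phi>"
      unfolding is_functional_def
    proof (intro conjI ballI)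
      fix x y assume x: "x \<in> carrier V" and y: "y \<in> carrier V"
      obtain m where m: "m \<in> M" "x = \<phi> x \<odot> v \<oplus> m" using \<phi>(2)[OF x] by blast
      obtain n where n: "n \<in> M" "y = \<phi> y \<odot> v \<oplus> n" using \<phi>(2)[OF y] by blast
      show "\<phi> (x \<oplus> y) = \<phi> x \<oplus>\<^bsub>K\<^esub> \<phi> y"
      proof (rule \<phi>_eq)
        have "x \<oplus> y = (\<phi> x \<odot> v \<oplus> m) \<oplus> (\<phi> y \<odot> v \<oplus> n)"
          using m(2) n(2) by metis
        also have "\<dots> = (\<phi> x \<oplus>\<^bsub>K\<^esub> \<phi> y) \<odot> v \<oplus> (m \<oplus> n)"
          using \<phi>(1)[OF x] \<phi>(1)[OF y] v Mc[OF m(1)] Mc[OF n(1)] by (simp add: V.smult_l_distr V.M.a_ac)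
        finally show "x \<oplus> y = (\<phi> x \<oplus>\<^bsub>K\<^esub> \<phi> y) \<odot> v \<oplus> (m \<oplus> n)" .
      qed (use \<phi>(1)[OF x] \<phi>(1)[OF y] Madd m n in auto)
    next
      fix a x assume a: "a \<in> carrier K" and x: "x \<in> carrier V"
      obtain m where m: "m \<in> M" "x = \<phi> x \<odot> v \<oplus> m" using \<phi>(2)[OF x] by blast
      show "\<phi> (a \<odot> x) = a \<otimes>\<^bsub>K\<^esub> \<phi> x"
      proof (rule \<phi>_eq)
        have "a \<odot> x = a \<odot> (\<phi> x \<odot> v \<oplus> m)" using m(2) by simp
        also have "\<dots> = (a \<otimes>\<^bsub>K\<^esub> \<phi> x) \<odot> v \<oplus> (a \<odot> m)"
          using \<phi>(1)[OF x] a v Mc[OF m(1)] by (simp add: V.smult_r_distr V.smult_assoc1)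
        finally show "a \<odot> x = (a \<otimes>\<^bsub>K\<^esub> \<phi> x) \<odot> v \<oplus> (a \<odot> m)" .
      qed (use \<phi>(1)[OF x] a Msm m in auto)
    qed (rule \<phi>)
  qed
qed

text \<open>
  The map \<open>\<phi> \<otimes> id\<close> from \<open>T \<otimes> U\<close> to \<open>U\<close>, for a functional \<open>\<phi>\<close> on \<open>T\<close>.
\<close>

definition contract ::
    "('u, 'b) ring_scheme \<Rightarrow> ('u, 'u) module \<Rightarrow> ('u \<Rightarrow> 'u) \<Rightarrow> ('u, 'u) module \<Rightarrow> 'u \<Rightarrow> 'u" where
  "contract K T \<phi> U = (SOME h. (\<forall>x\<in>carrier (tens K T U). h x \<in> carrier U) \<and>
     (\<forall>x\<in>carrier (tens K T U). \<forall>y\<in>carrier (tens K T U). h (x \<oplus>\<^bsub>tens K T U\<^esub> y) = h x \<oplus>\<^bsub>U\<^esub> h y) \<and>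
     (\<forall>t\<in>carrier T. \<forall>u\<in>carrier U. h (tens_pure K T U t u) = \<phi> t \<odot>\<^bsub>U\<^esub> u))"

primrec lin_span :: "('u, 'b) ring_scheme \<Rightarrow> ('u, 'v) module \<Rightarrow> 'v list \<Rightarrow> 'v set" where
  "lin_span K V [] = {\<zero>\<^bsub>V\<^esub>}"
| "lin_span K V (v # vs) = {a \<odot>\<^bsub>V\<^esub> v \<oplus>\<^bsub>V\<^esub> w | a w. a \<in> carrier K \<and> w \<in> lin_span K V vs}"

text \<open>
  The tensors that can be written as a sum of pure tensors whose first factors are the members
  of the list. The list is the induction parameter of \<open>contract_separates\<close>.
\<close>

primrec tens_span ::
    "('u, 'b) ring_scheme \<Rightarrow> ('u, 'u) module \<Rightarrow> ('u, 'u) module \<Rightarrow> 'u list \<Rightarrow> 'u set" where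
  "tens_span K T U [] = {\<zero>\<^bsub>tens K T U\<^esub>}"
| "tens_span K T U (t # ts) =
     {tens_pure K T U t u \<oplus>\<^bsub>tens K T U\<^esub> y | u y. u \<in> carrier U \<and> y \<in> tens_span K T U ts}"

lemma lin_span_subset:
  fixes V (structure)
  assumes "module K V"
  shows "set vs \<subseteq> carrier V \<Longrightarrow> lin_span K V vs \<subseteq> carrier V"
proof -
  interpret module K V by fact
  show "set vs \<subseteq> carrier V \<Longrightarrow> lin_span K V vs \<subseteq> carrier V"
    by (induction vs) auto
qed

lemma submodule_lin_span:
  fixes V (structure)
  assumes "module K V" "set vs \<subseteq> carrier V"
  shows "submodule (lin_span K V vs) K V"
proof -
  interpret module K V by fact
  have sm: "a \<odot> x \<in> lin_span K V vs" if "a \<in> carrier K" "x \<in> lin_span K V vs" for a x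
    using assms(2) that
  proof (induction vs arbitrary: x)
    case (Cons v vs)
    obtain b w where x: "b \<in> carrier K" "w \<in> lin_span K V vs" "x = b \<odot> v \<oplus> w"
      using Cons.prems by auto
    have c: "v \<in> carrier V" "w \<in> carrier V" using x Cons.prems lin_span_subset[OF assms(1), of vs] by auto
    have "a \<odot> x = (a \<otimes>\<^bsub>K\<^esub> b) \<odot> v \<oplus> a \<odot> w"
      using c x(1,3) Cons.prems by (simp add: smult_r_distr smult_assoc1)
    moreover have "a \<odot> w \<in> lin_span K V vs" using Cons.IH[of w] Cons.prems x by simp
    ultimately show ?case using x(1) Cons.prems by auto
  qed simp
  have neg: "\<ominus> x \<in> lin_span K V vs" if "x \<in> lin_span K V vs" for x
    using sm[of "\<ominus>\<^bsub>K\<^esub> \<one>\<^bsub>K\<^esub>" x] that lin_span_subset[OF assms] by (auto simp: smult_l_minus)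
  have add: "x \<oplus> y \<in> lin_span K V vs" if "x \<in> lin_span K V vs" "y \<in> lin_span K V vs" for x y
    using assms(2) that
  proof (induction vs arbitrary: x y)
    case (Cons v vs)
    obtain b w where x: "b \<in> carrier K" "w \<in> lin_span K V vs" "x = b \<odot> v \<oplus> w"
      using Cons.prems by auto
    obtain c z where y: "c \<in> carrier K" "z \<in> lin_span K V vs" "y = c \<odot> v \<oplus> z"
      using Cons.prems by auto
    have c: "v \<in> carrier V" "w \<in> carrier V" "z \<in> carrier V"
      using x y Cons.prems lin_span_subset[OF assms(1), of vs] by auto
    have "x \<oplus> y = (b \<oplus>\<^bsub>K\<^esub> c) \<odot> v \<oplus> (w \<oplus> z)"
      using c x(1,3) y(1,3) by (simp add: smult_l_distr M.a_ac)
    moreover have "w \<oplus> z \<in> lin_span K V vs" using Cons x y by simp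
    ultimately show ?case using x(1) y(1) by auto
  qed simp
  have zero: "\<zero> \<in> lin_span K V vs"
    using assms(2)
  proof (induction vs)
    case (Cons v vs)
    then have "\<zero> = \<zero>\<^bsub>K\<^esub> \<odot> v \<oplus> \<zero>" by simp
    moreover have "\<zero> \<in> lin_span K V vs" using Cons by simp
    ultimately show ?case unfolding lin_span.simps using R.zero_closed by blast
  qed simp
  show ?thesis
    using lin_span_subset[OF assms] zero neg add sm by (intro submoduleI) auto
qed

lemma set_subset_lin_span:
  fixes V (structure)
  assumes "module K V" "set vs \<subseteq> carrier V"
  shows "set vs \<subseteq> lin_span K V vs"
  using assms(2)
proof (induction vs)
  case (Cons v vs)
  interpret module K V by fact
  have z: "\<zero> \<in> lin_span K V vs"
    using subgroup.one_closed[OF submodule.axioms(1)[OF submodule_lin_span[OF assms(1), of vs]]] Cons by simp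
  have "v = \<one>\<^bsub>K\<^esub> \<odot> v \<oplus> \<zero>" using Cons by simp
  then have "v \<in> lin_span K V (v # vs)" using z by auto
  moreover have "x \<in> lin_span K V (v # vs)" if "x \<in> lin_span K V vs" for x
  proof -
    have "x = \<zero>\<^bsub>K\<^esub> \<odot> v \<oplus> x" using Cons that lin_span_subset[OF assms(1), of vs] by auto
    then show ?thesis using that by auto
  qed
  ultimately show ?case using Cons by auto
qed simp

context
  fixes K :: "('u, 'b) ring_scheme" and T :: "('u, 'u) module"
  assumes inf: "infinite (UNIV :: 'u set)" and T: "comm_alg K T"
begin

lemma contract_hom:
  assumes U: "comm_alg K U" and \<phi>: "is_functional K T \<phi>"
  shows "x \<in> carrier (tens K T U) \<Longrightarrow> contract K T \<phi> U x \<in> carrier U"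
    "x \<in> carrier (tens K T U) \<Longrightarrow> y \<in> carrier (tens K T U) \<Longrightarrow>
      contract K T \<phi> U (x \<oplus>\<^bsub>tens K T U\<^esub> y) = contract K T \<phi> U x \<oplus>\<^bsub>U\<^esub> contract K T \<phi> U y"
    "t \<in> carrier T \<Longrightarrow> u \<in> carrier U \<Longrightarrow> contract K T \<phi> U (tens_pure K T U t u) = \<phi> t \<odot>\<^bsub>U\<^esub> u"
proof -
  interpret U: algebra K U using U by (rule comm_algD)
  interpret T: algebra K T using T by (rule comm_algD)
  have bal: "(a \<otimes>\<^bsub>K\<^esub> \<phi> t) \<odot>\<^bsub>U\<^esub> u = \<phi> t \<odot>\<^bsub>U\<^esub> (a \<odot>\<^bsub>U\<^esub> u)"
    if "a \<in> carrier K" "t \<in> carrier T" "u \<in> carrier U" for a t u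
    using that \<phi> U.R.m_comm[of a "\<phi> t"] by (simp add: is_functional_def U.smult_assoc1)
  obtain h where "\<And>x. x \<in> carrier (tens K T U) \<Longrightarrow> h x \<in> carrier U"
    "\<And>x y. x \<in> carrier (tens K T U) \<Longrightarrow> y \<in> carrier (tens K T U) \<Longrightarrow>
      h (x \<oplus>\<^bsub>tens K T U\<^esub> y) = h x \<oplus>\<^bsub>U\<^esub> h y"
    "\<And>t u. t \<in> carrier T \<Longrightarrow> u \<in> carrier U \<Longrightarrow> h (tens_pure K T U t u) = \<phi> t \<odot>\<^bsub>U\<^esub> u"
    by (rule tens_universal[OF inf T U U.abelian_group_axioms, of "\<lambda>t u. \<phi> t \<odot>\<^bsub>U\<^esub> u"])
       (use \<phi> bal in \<open>auto simp: is_functional_def U.smult_l_distr U.smult_r_distr\<close>)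
  then have ex: "\<exists>h. (\<forall>x\<in>carrier (tens K T U). h x \<in> carrier U) \<and>
     (\<forall>x\<in>carrier (tens K T U). \<forall>y\<in>carrier (tens K T U). h (x \<oplus>\<^bsub>tens K T U\<^esub> y) = h x \<oplus>\<^bsub>U\<^esub> h y) \<and>
     (\<forall>t\<in>carrier T. \<forall>u\<in>carrier U. h (tens_pure K T U t u) = \<phi> t \<odot>\<^bsub>U\<^esub> u)"
    by (intro exI[of _ h]) simp
  note s = someI_ex[OF ex, folded contract_def]
  show "x \<in> carrier (tens K T U) \<Longrightarrow> contract K T \<phi> U x \<in> carrier U"
    "x \<in> carrier (tens K T U) \<Longrightarrow> y \<in> carrier (tens K T U) \<Longrightarrow>
      contract K T \<phi> U (x \<oplus>\<^bsub>tens K T U\<^esub> y) = contract K T \<phi> U x \<oplus>\<^bsub>U\<^esub> contract K T \<phi> U y"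
    "t \<in> carrier T \<Longrightarrow> u \<in> carrier U \<Longrightarrow> contract K T \<phi> U (tens_pure K T U t u) = \<phi> t \<odot>\<^bsub>U\<^esub> u"
    using s by simp_all
qed

text \<open>
  Linearity over \<open>U\<close>: this and \<open>contract_natural\<close> let contraction turn natural maps into \<open>T \<otimes> U\<close> into
  morphisms of functors of modules.
\<close>

lemma contract_mult:
  assumes U: "comm_alg K U" and \<phi>: "is_functional K T \<phi>" and u: "u \<in> carrier U"
    and x: "x \<in> carrier (tens K T U)"
  shows "contract K T \<phi> U (tens_pure K T U \<one>\<^bsub>T\<^esub> u \<otimes>\<^bsub>tens K T U\<^esub> x) = u \<otimes>\<^bsub>U\<^esub> contract K T \<phi> U x"
proof -
  interpret U: algebra K U using U by (rule comm_algD)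
  interpret T: algebra K T using T by (rule comm_algD)
  interpret A: cring "tens K T U" using inf T U by (rule cring_tens)
  note c = contract_hom[OF U \<phi>]
  have p: "tens_pure K T U \<one>\<^bsub>T\<^esub> u \<in> carrier (tens K T U)"
    using u by (simp add: tens_pure_closed[OF inf T U])
  show ?thesis
    using x
  proof (rule tens_induct[OF inf T U])
    fix t v assume "t \<in> carrier T" "v \<in> carrier U"
    then show "contract K T \<phi> U (tens_pure K T U \<one>\<^bsub>T\<^esub> u \<otimes>\<^bsub>tens K T U\<^esub> tens_pure K T U t v) =
      u \<otimes>\<^bsub>U\<^esub> contract K T \<phi> U (tens_pure K T U t v)"
      using u \<phi> U.m_comm[of u "\<phi> t \<odot>\<^bsub>U\<^esub> v"] U.m_comm[of u v]
      by (simp add: tens_pure_mult[OF inf T U] c(3) is_functional_def U.smult_assoc2)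
  qed (use p u in \<open>simp add: A.r_distr U.r_distr c\<close>)
qed

lemma contract_natural:
  assumes U: "comm_alg K U" and U': "comm_alg K U'" and \<phi>: "is_functional K T \<phi>"
    and f: "f \<in> alg_hom K U U'" and h: "h \<in> alg_hom T (tens K T U) (tens K T U')"
    and hf: "\<And>t u. t \<in> carrier T \<Longrightarrow> u \<in> carrier U \<Longrightarrow> h (tens_pure K T U t u) = tens_pure K T U' t (f u)"
    and x: "x \<in> carrier (tens K T U)"
  shows "contract K T \<phi> U' (h x) = f (contract K T \<phi> U x)"
  using x
  by (rule tens_induct[OF inf T U])
     (use \<phi> in \<open>simp_all add: hf contract_hom[OF U \<phi>] contract_hom[OF U' \<phi>] alg_homD[OF f] alg_homD(3)[OF h]
        ring_hom_add[OF alg_homD(1)[OF h]] ring_hom_add[OF alg_homD(1)[OF f]] is_functional_def\<close>)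

context
  fixes U :: "('u, 'u) module"
  assumes U: "comm_alg K U"
begin

interpretation T: algebra K T using T by (rule comm_algD)
interpretation U: algebra K U using U by (rule comm_algD)
interpretation A: cring "tens K T U" using inf T U by (rule cring_tens)

lemma tens_pure_zero: "t \<in> carrier T \<Longrightarrow> tens_pure K T U t \<zero>\<^bsub>U\<^esub> = \<zero>\<^bsub>tens K T U\<^esub>"
  using tens_pure_add(2)[OF inf T U, of t "\<zero>\<^bsub>U\<^esub>" "\<zero>\<^bsub>U\<^esub>"] tens_pure_closed[OF inf T U, of t "\<zero>\<^bsub>U\<^esub>"]
  by simp

lemma tens_span_subset: "set ts \<subseteq> carrier T \<Longrightarrow> tens_span K T U ts \<subseteq> carrier (tens K T U)"
  by (induction ts) (auto simp: tens_pure_closed[OF inf T U])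

lemma tens_span_zero: "set ts \<subseteq> carrier T \<Longrightarrow> \<zero>\<^bsub>tens K T U\<^esub> \<in> tens_span K T U ts"
proof (induction ts)
  case (Cons t ts)
  then have "\<zero>\<^bsub>tens K T U\<^esub> = tens_pure K T U t \<zero>\<^bsub>U\<^esub> \<oplus>\<^bsub>tens K T U\<^esub> \<zero>\<^bsub>tens K T U\<^esub>"
    by (simp add: tens_pure_zero)
  then show ?case using Cons by auto
qed simp

lemma tens_span_Cons_mono:
  assumes "set (t # ts) \<subseteq> carrier T" "x \<in> tens_span K T U ts"
  shows "x \<in> tens_span K T U (t # ts)"
proof -
  have "x = tens_pure K T U t \<zero>\<^bsub>U\<^esub> \<oplus>\<^bsub>tens K T U\<^esub> x"
    using assms tens_span_subset[of ts] by (auto simp: tens_pure_zero)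
  then show ?thesis using assms by auto
qed

lemma tens_span_add:
  "\<lbrakk>set ts \<subseteq> carrier T; x \<in> tens_span K T U ts; y \<in> tens_span K T U ts\<rbrakk> \<Longrightarrow>
    x \<oplus>\<^bsub>tens K T U\<^esub> y \<in> tens_span K T U ts"
proof (induction ts arbitrary: x y)
  case (Cons t ts)
  obtain u z where x: "u \<in> carrier U" "z \<in> tens_span K T U ts" "x = tens_pure K T U t u \<oplus>\<^bsub>tens K T U\<^esub> z"
    using Cons.prems by auto
  obtain u' z' where y: "u' \<in> carrier U" "z' \<in> tens_span K T U ts" "y = tens_pure K T U t u' \<oplus>\<^bsub>tens K T U\<^esub> z'"
    using Cons.prems by auto
  have "z \<in> carrier (tens K T U)" "z' \<in> carrier (tens K T U)"
    using x y tens_span_subset[of ts] Cons.prems by auto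
  then have "x \<oplus>\<^bsub>tens K T U\<^esub> y = tens_pure K T U t (u \<oplus>\<^bsub>U\<^esub> u') \<oplus>\<^bsub>tens K T U\<^esub> (z \<oplus>\<^bsub>tens K T U\<^esub> z')"
    using x(1,3) y(1,3) Cons.prems tens_pure_closed[OF inf T U, of t]
    by (simp add: tens_pure_add[OF inf T U] A.a_ac)
  moreover have "z \<oplus>\<^bsub>tens K T U\<^esub> z' \<in> tens_span K T U ts" using Cons x y by simp
  ultimately show ?case using x(1) y(1) by auto
qed simp

lemma tens_pure_in_tens_span:
  "\<lbrakk>set ts \<subseteq> carrier T; t \<in> lin_span K T ts; u \<in> carrier U\<rbrakk> \<Longrightarrow> tens_pure K T U t u \<in> tens_span K T U ts"
proof (induction ts arbitrary: t)
  case Nil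
  have "tens_pure K T U \<zero>\<^bsub>T\<^esub> u = \<zero>\<^bsub>tens K T U\<^esub>"
    using tens_pure_add(1)[OF inf T U, of "\<zero>\<^bsub>T\<^esub>" "\<zero>\<^bsub>T\<^esub>" u] tens_pure_closed[OF inf T U, of "\<zero>\<^bsub>T\<^esub>" u] Nil by simp
  then show ?case using Nil by simp
next
  case (Cons s ts)
  obtain a w where t: "a \<in> carrier K" "w \<in> lin_span K T ts" "t = a \<odot>\<^bsub>T\<^esub> s \<oplus>\<^bsub>T\<^esub> w" using Cons.prems by auto
  have "w \<in> carrier T" using t lin_span_subset[OF T.module, of ts] Cons.prems by auto
  then have "tens_pure K T U t u = tens_pure K T U s (a \<odot>\<^bsub>U\<^esub> u) \<oplus>\<^bsub>tens K T U\<^esub> tens_pure K T U w u"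
    using t(1,3) Cons.prems by (simp add: tens_pure_add[OF inf T U] tens_pure_smult[OF inf T U])
  moreover have "tens_pure K T U w u \<in> tens_span K T U ts" using Cons t by simp
  ultimately show ?case using t(1) Cons.prems by auto
qed

lemma tens_in_tens_span:
  assumes "x \<in> carrier (tens K T U)"
  shows "\<exists>ts. set ts \<subseteq> carrier T \<and> x \<in> tens_span K T U ts"
  using assms
proof (rule tens_induct[OF inf T U])
  fix t u assume t: "t \<in> carrier T" "u \<in> carrier U"
  have "tens_pure K T U t u = tens_pure K T U t u \<oplus>\<^bsub>tens K T U\<^esub> \<zero>\<^bsub>tens K T U\<^esub>"
    using t by (simp add: tens_pure_closed[OF inf T U])
  then show "\<exists>ts. set ts \<subseteq> carrier T \<and> tens_pure K T U t u \<in> tens_span K T U ts"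
    using t by (intro exI[of _ "[t]"]) auto
next
  fix x y assume "\<exists>ts. set ts \<subseteq> carrier T \<and> x \<in> tens_span K T U ts"
    "\<exists>ts. set ts \<subseteq> carrier T \<and> y \<in> tens_span K T U ts"
  then obtain ts ss where ts: "set ts \<subseteq> carrier T" "x \<in> tens_span K T U ts"
    and ss: "set ss \<subseteq> carrier T" "y \<in> tens_span K T U ss" by blast
  have l: "z \<in> tens_span K T U (rs @ ss)" if "set rs \<subseteq> carrier T" "z \<in> tens_span K T U ss" for z rs
    using that(1)
  proof (induction rs)
    case (Cons r rs) then show ?case using ss tens_span_Cons_mono[of r "rs @ ss" z] by simp
  qed (simp add: that)
  have r: "z \<in> tens_span K T U (rs @ ss)" if "set rs \<subseteq> carrier T" "z \<in> tens_span K T U rs" for z rs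
    using that
  proof (induction rs arbitrary: z)
    case Nil then show ?case using tens_span_zero[of ss] ss by simp
  qed auto
  show "\<exists>ts. set ts \<subseteq> carrier T \<and> x \<oplus>\<^bsub>tens K T U\<^esub> y \<in> tens_span K T U ts"
    using tens_span_add[of "ts @ ss" x y] l[OF ts(1) ss(2)] r[OF ts] ts ss
    by (intro exI[of _ "ts @ ss"]) simp
qed

lemma contract_tens_span_zero:
  assumes \<phi>: "is_functional K T \<phi>"
  shows "\<lbrakk>set ts \<subseteq> carrier T; \<And>t. t \<in> set ts \<Longrightarrow> \<phi> t = \<zero>\<^bsub>K\<^esub>; x \<in> tens_span K T U ts\<rbrakk> \<Longrightarrow>
    contract K T \<phi> U x = \<zero>\<^bsub>U\<^esub>"
proof (induction ts arbitrary: x)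
  note c = contract_hom[OF U \<phi>]
  case Nil
  then show ?case using c(2)[of "\<zero>\<^bsub>tens K T U\<^esub>" "\<zero>\<^bsub>tens K T U\<^esub>"] c(1)[of "\<zero>\<^bsub>tens K T U\<^esub>"] by simp
next
  note c = contract_hom[OF U \<phi>]
  case (Cons t ts)
  then obtain u z where x: "u \<in> carrier U" "z \<in> tens_span K T U ts" "x = tens_pure K T U t u \<oplus>\<^bsub>tens K T U\<^esub> z"
    by auto
  have "z \<in> carrier (tens K T U)" using x tens_span_subset[of ts] Cons.prems by auto
  moreover have "contract K T \<phi> U z = \<zero>\<^bsub>U\<^esub>" using Cons x by simp
  ultimately show ?case using x(1,3) Cons.prems by (simp add: c tens_pure_closed[OF inf T U])
qed

text \<open>
  Induction on the number of first factors. If the leading factor \<open>t\<close> is a combination of the others,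
  it can be absorbed into them. Otherwise some \<open>\<phi>\<close> takes the value 1 at \<open>t\<close> and vanishes on the others;
  contracting with \<open>\<phi>\<close> gives the second factor that belongs to \<open>t\<close>, which is therefore zero. This is
  where \<open>K\<close> has to be a field.
\<close>

lemma contract_separates:
  assumes K: "field K" and x: "x \<in> carrier (tens K T U)"
    and zero: "\<And>\<phi>. is_functional K T \<phi> \<Longrightarrow> contract K T \<phi> U x = \<zero>\<^bsub>U\<^esub>"
  shows "x = \<zero>\<^bsub>tens K T U\<^esub>"
proof -
  have "x = \<zero>\<^bsub>tens K T U\<^esub>" if "set ts \<subseteq> carrier T" "x \<in> tens_span K T U ts" for ts
    using that
  proof (induction ts)
    case (Cons t ts)
    then obtain u y where u: "u \<in> carrier U" "y \<in> tens_span K T U ts" "x = tens_pure K T U t u \<oplus>\<^bsub>tens K T U\<^esub> y"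
      by auto
    have ts: "set ts \<subseteq> carrier T" "t \<in> carrier T" using Cons.prems by auto
    have y: "y \<in> carrier (tens K T U)" using u(2) tens_span_subset[OF ts(1)] by auto
    show ?case
    proof (cases "t \<in> lin_span K T ts")
      case True
      then have "x \<in> tens_span K T U ts"
        using tens_span_add[OF ts(1)] tens_pure_in_tens_span[OF ts(1)] u by simp
      then show ?thesis using Cons.IH ts(1) by simp
    next
      case False
      obtain \<phi> where \<phi>: "is_functional K T \<phi>" "\<phi> t = \<one>\<^bsub>K\<^esub>" "\<And>w. w \<in> lin_span K T ts \<Longrightarrow> \<phi> w = \<zero>\<^bsub>K\<^esub>"
        using exists_functional[OF K T.module submodule_lin_span[OF T.module ts(1)] ts(2) False] by blast
      have "contract K T \<phi> U y = \<zero>\<^bsub>U\<^esub>"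
        using contract_tens_span_zero[OF \<phi>(1) ts(1) _ u(2)] \<phi>(3) set_subset_lin_span[OF T.module ts(1)] by blast
      then have "contract K T \<phi> U x = u"
        using u ts y \<phi>(2) by (simp add: contract_hom[OF U \<phi>(1)] tens_pure_closed[OF inf T U])
      then have "u = \<zero>\<^bsub>U\<^esub>" using zero[OF \<phi>(1)] by simp
      then have "x = y" using u(3) y ts by (simp add: tens_pure_zero)
      then show ?thesis using Cons.IH ts(1) u(2) by simp
    qed
  qed simp
  then show ?thesis using tens_in_tens_span[OF x] by blast
qed

lemma contract_separates_points:
  assumes K: "field K" and x: "x \<in> carrier (tens K T U)" and y: "y \<in> carrier (tens K T U)" and "x \<noteq> y"
  obtains \<phi> where "is_functional K T \<phi>" "contract K T \<phi> U x \<noteq> contract K T \<phi> U y"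
proof -
  let ?d = "x \<ominus>\<^bsub>tens K T U\<^esub> y"
  have d: "?d \<in> carrier (tens K T U)" using x y by simp
  have "?d \<noteq> \<zero>\<^bsub>tens K T U\<^esub>" using x y \<open>x \<noteq> y\<close> by simp
  then obtain \<phi> where \<phi>: "is_functional K T \<phi>" "contract K T \<phi> U ?d \<noteq> \<zero>\<^bsub>U\<^esub>"
    using contract_separates[OF K d] by blast
  have "x = ?d \<oplus>\<^bsub>tens K T U\<^esub> y" using x y by (simp add: a_minus_def A.a_assoc A.l_neg)
  then have "contract K T \<phi> U x = contract K T \<phi> U ?d \<oplus>\<^bsub>U\<^esub> contract K T \<phi> U y"
    using contract_hom(2)[OF U \<phi>(1) d y] by simp
  then have "contract K T \<phi> U x \<noteq> contract K T \<phi> U y"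
    using \<phi>(2) contract_hom(1)[OF U \<phi>(1) d] contract_hom(1)[OF U \<phi>(1) y] by simp
  then show thesis using \<phi>(1) that by blast
qed

end

end

section \<open>Descending separating functionals to the base field\<close>

text \<open>
  The core of the proof. An element \<open>w\<close> of \<open>M\<^sup>*(T)\<close> gives maps \<open>M(U) \<rightarrow> T \<otimes> U\<close>, natural in the \<open>K\<close>-algebra \<open>U\<close>, by
  pushing \<open>m\<close> to \<open>M(T \<otimes> U)\<close> and applying \<open>w\<close>. Composed with \<open>\<phi> \<otimes> id\<close> for a functional \<open>\<phi>\<close> on \<open>T\<close>, they become
  elements of \<open>M\<^sup>*(K)\<close>. For \<open>U = S\<close> the algebra map \<open>T \<otimes> S \<rightarrow> T\<close>, \<open>t \<otimes> s \<mapsto> t g(s)\<close>, recovers \<open>w(m)\<close>, so the two points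
  already differ in \<open>T \<otimes> S\<close>, and functionals separate the points of \<open>T \<otimes> S\<close>.
\<close>

lemma dual_separates_over_base:
  fixes K :: "('u, 'b) ring_scheme" and S T :: "('u, 'u) module" and M :: "('u, 'm) alg_functor"
  assumes inf: "infinite (UNIV :: 'u set)" and K: "field K" and M: "module_functor K M"
    and S: "comm_alg K S" and T: "comm_alg K T" and g: "g \<in> alg_hom K S T"
    and w: "w \<in> functor_hom T (restrict_functor K T M) base_functor"
    and m: "m \<in> carrier (fobj M S)" and n: "n \<in> carrier (fobj M S)"
    and ne: "w (self_alg T) (farr M S T g m) \<noteq> w (self_alg T) (farr M S T g n)"
  shows "\<exists>w'\<in>functor_hom K M base_functor. w' S m \<noteq> w' S n"
proof -
  interpret T: algebra K T using T by (rule comm_algD)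
  let ?r = "restrict_scalars K (unit_map K T)" and ?A = "\<lambda>U. tens K T U"
  define j where "j U = (\<lambda>u\<in>carrier U. tens_pure K T U \<one>\<^bsub>T\<^esub> u)" for U
  \<comment> \<open>The natural map \<open>M(U) \<rightarrow> T \<otimes> U\<close> induced by \<open>w\<close>; \<open>j U\<close> is \<open>u \<mapsto> 1 \<otimes> u\<close>.\<close>
  define y where "y U m = w (?A U) (farr M U (?r (?A U)) (j U) m)" for U m
  have A: "comm_alg T (?A U)" if "comm_alg K U" for U
    using comm_alg_tens[OF inf T that] .
  have rA: "comm_alg K (?r (?A U))" if "comm_alg K U" for U
    using comm_alg_restrict_unit[OF T A[OF that]] .
  have j: "j U \<in> alg_hom K U (?r (?A U))" if "comm_alg K U" for U
    unfolding j_def using tens_inr[OF inf T that] .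
  have jm: "farr M U (?r (?A U)) (j U) m \<in> carrier (fobj (restrict_functor K T M) (?A U))"
    if "comm_alg K U" "m \<in> carrier (fobj M U)" for U m
    using module_functor_arr(1)[OF M that(1) rA[OF that(1)] j[OF that(1)] that(2)] by simp
  have y: "y U m \<in> carrier (?A U)" if "comm_alg K U" "m \<in> carrier (fobj M U)" for U m
    unfolding y_def using base_homD(1)[OF w A[OF that(1)] jm[OF that]] .
  have y_add: "y U (m \<oplus>\<^bsub>fobj M U\<^esub> n) = y U m \<oplus>\<^bsub>?A U\<^esub> y U n"
    if U: "comm_alg K U" and "m \<in> carrier (fobj M U)" "n \<in> carrier (fobj M U)" for U m n
    unfolding y_def module_functor_arr(2)[OF M U rA[OF U] j[OF U] that(2,3)]
    using base_homD(2)[OF w A[OF U] jm[OF U that(2)] jm[OF U that(3)]] by simp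
  have y_smult: "y U (u \<odot>\<^bsub>fobj M U\<^esub> m) = tens_pure K T U \<one>\<^bsub>T\<^esub> u \<otimes>\<^bsub>?A U\<^esub> y U m"
    if U: "comm_alg K U" and "u \<in> carrier U" "m \<in> carrier (fobj M U)" for U m u
    unfolding y_def module_functor_arr(3)[OF M U rA[OF U] j[OF U] that(2,3)]
    using base_homD(3)[OF w A[OF U] _ jm[OF U that(3)], of "j U u"] that(2)
    by (simp add: j_def tens_pure_closed[OF inf T U])
  \<comment> \<open>Naturality: \<open>h\<close> is \<open>id \<otimes> f\<close>, and \<open>h j = j f\<close>.\<close>
  have y_nat: "\<exists>h. h \<in> alg_hom T (?A U) (?A U') \<and>
      (\<forall>t\<in>carrier T. \<forall>u\<in>carrier U. h (tens_pure K T U t u) = tens_pure K T U' t (f u)) \<and>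
      (\<forall>m\<in>carrier (fobj M U). y U' (farr M U U' f m) = h (y U m))"
    if U: "comm_alg K U" and U': "comm_alg K U'" and f: "f \<in> alg_hom K U U'" for U U' f
  proof -
    interpret U: algebra K U using U by (rule comm_algD)
    have jf: "compose (carrier U) (j U') f \<in> alg_hom K U (?r (?A U'))"
      using U f j[OF U'] by (rule alg_hom_compose)
    obtain h where h: "h \<in> alg_hom T (?A U) (?A U')"
      and hp: "\<And>t u. t \<in> carrier T \<Longrightarrow> u \<in> carrier U \<Longrightarrow>
        h (tens_pure K T U t u) = t \<odot>\<^bsub>?A U'\<^esub> compose (carrier U) (j U') f u"
    proof (rule tens_alg_hom[OF inf T U A[OF U'], of "compose (carrier U) (j U') f"])
      show "compose (carrier U) (j U') f \<in> ring_hom U (?A U')"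
        using alg_homD(1)[OF jf] by (simp add: ring_hom_def)
      fix a assume a: "a \<in> carrier K"
      show "compose (carrier U) (j U') f (unit_map K U a) = unit_map T (?A U') (unit_map K T a)"
        using alg_hom_unit_map[OF U rA[OF U'] jf a] unit_map_restrict_scalars[OF T A[OF U'] a] by simp
    qed blast
    have hp': "h (tens_pure K T U t u) = tens_pure K T U' t (f u)" if "t \<in> carrier T" "u \<in> carrier U" for t u
      using that hp alg_homD(3)[OF f] by (simp add: compose_eq j_def tens_pure_eq[OF inf T U', symmetric])
    have hK: "h \<in> alg_hom K (?r (?A U)) (?r (?A U'))"
      using alg_hom_restrict_scalars[OF T.R_cring unit_map_hom[OF T] A[OF U] A[OF U'] h] .
    have comp: "compose (carrier U) h (j U) = compose (carrier U) (j U') f"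
      using alg_homD(3)[OF f] by (auto simp: compose_def j_def hp' intro!: restrict_ext)
    have "y U' (farr M U U' f m) = h (y U m)" if m: "m \<in> carrier (fobj M U)" for m
    proof -
      have "y U' (farr M U U' f m) = w (?A U') (farr M U (?r (?A U')) (compose (carrier U) (j U') f) m)"
        unfolding y_def using module_functor_comp[OF M U U' rA[OF U'] f j[OF U'] m] by simp
      also have "\<dots> = w (?A U') (farr M (?r (?A U)) (?r (?A U')) h
          (farr M U (?r (?A U)) (j U) m))"
        unfolding comp[symmetric] using module_functor_comp[OF M U rA[OF U] rA[OF U'] j[OF U] hK m] by simp
      also have "\<dots> = h (y U m)"
        unfolding y_def using functor_hom_natural[OF w A[OF U] A[OF U'] h jm[OF U m]] by simp
      finally show ?thesis .
    qed
    then show ?thesis using h hp' by blast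
  qed
  have hom: "(\<lambda>U\<in>{U. comm_alg K U}. \<lambda>m\<in>carrier (fobj M U). contract K T \<phi> U (y U m))
      \<in> functor_hom K M base_functor" if \<phi>: "is_functional K T \<phi>" for \<phi>
  proof (rule base_homI[OF M], goal_cases)
    case (1 U m)
    then show ?case using contract_hom(1)[OF inf T _ \<phi>] y by blast
  next
    case (2 U m n)
    then show ?case using contract_hom(2)[OF inf T 2(1) \<phi>] y by (simp add: y_add)
  next
    case (3 U u m)
    then show ?case using contract_mult[OF inf T 3(1) \<phi>] y by (simp add: y_smult)
  next
    case (4 U U' f m)
    then obtain h where h: "h \<in> alg_hom T (?A U) (?A U')"
      "\<And>t u. t \<in> carrier T \<Longrightarrow> u \<in> carrier U \<Longrightarrow> h (tens_pure K T U t u) = tens_pure K T U' t (f u)"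
      "y U' (farr M U U' f m) = h (y U m)"
      using y_nat[OF 4(1-3)] by blast
    show ?case
      unfolding h(3) using contract_natural[OF inf T 4(1,2) \<phi> 4(3) h(1,2) y[OF 4(1,4)]] by simp
  qed
  have "y S m \<noteq> y S n"
  proof -
    have T': "comm_alg T (self_alg T)" by (rule comm_alg_self_alg[OF T.M_cring])
    \<comment> \<open>\<open>\<mu>\<close> is the multiplication \<open>t \<otimes> s \<mapsto> t g(s)\<close>. It satisfies \<open>\<mu> j = g\<close>.\<close>
    obtain \<mu> where \<mu>: "\<mu> \<in> alg_hom T (?A S) (self_alg T)"
      and \<mu>p: "\<And>t s. t \<in> carrier T \<Longrightarrow> s \<in> carrier S \<Longrightarrow> \<mu> (tens_pure K T S t s) = t \<odot>\<^bsub>self_alg T\<^esub> g s"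
    proof (rule tens_alg_hom[OF inf T S T', of g])
      show "g \<in> ring_hom S (self_alg T)" using alg_homD(1)[OF g] by (simp add: ring_hom_def)
      show "g (unit_map K S a) = unit_map T (self_alg T) (unit_map K T a)" if "a \<in> carrier K" for a
        using alg_hom_unit_map[OF S T g that] that T by (simp add: unit_map_self_alg[OF T.M_cring])
    qed blast
    have \<mu>K: "\<mu> \<in> alg_hom K (?r (?A S)) T"
      using alg_hom_restrict_scalars[OF T.R_cring unit_map_hom[OF T] A[OF S] T' \<mu>] T by simp
    have comp: "compose (carrier S) \<mu> (j S) = g"
      using alg_homD(2,3)[OF g]
      by (intro extensionalityI[where A="carrier S"]) (auto simp: compose_def j_def \<mu>p)
    have "\<mu> (y S m) = w (self_alg T) (farr M S T g m)" if m: "m \<in> carrier (fobj M S)" for m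
    proof -
      have "farr M S T g m = farr M (?r (?A S)) T \<mu> (farr M S (?r (?A S)) (j S) m)"
        unfolding comp[symmetric] using module_functor_comp[OF M S rA[OF S] T j[OF S] \<mu>K m] by simp
      then show ?thesis
        unfolding y_def using functor_hom_natural[OF w A[OF S] T' \<mu> jm[OF S m]] T by simp
    qed
    then show ?thesis using ne m n by metis
  qed
  then obtain \<phi> where "is_functional K T \<phi>" "contract K T \<phi> S (y S m) \<noteq> contract K T \<phi> S (y S n)"
    using contract_separates_points[OF inf T S K y[OF S m] y[OF S n]] by blast
  then show ?thesis
    using S m n by (intro bexI[OF _ hom]) simp_all
qed

text \<open>
  An \<open>S\<close>-algebra \<open>T\<close> is also a \<open>K\<close>-algebra, so one direction is \<open>dual_separates_over_base\<close> along the unit map.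
  For the other one, take \<open>T = S\<close> and restrict \<open>w\<close> from \<open>K\<close>-algebras to \<open>S\<close>-algebras.
\<close>

lemma separated_iff:
  fixes K :: "('u, 'b) ring_scheme" and M :: "('u, 'm) alg_functor"
  assumes inf: "infinite (UNIV :: 'u set)" and K: "field K" and M: "module_functor K M"
  shows "separated K M \<longleftrightarrow> (\<forall>S. comm_alg K S \<longrightarrow>
    (\<forall>m\<in>carrier (fobj M S). \<forall>n\<in>carrier (fobj M S).
       m \<noteq> n \<longrightarrow> (\<exists>w\<in>functor_hom K M base_functor. w S m \<noteq> w S n)))"
    (is "_ \<longleftrightarrow> ?sep")
proof
  assume sep: "separated K M"
  show ?sep
  proof (intro allI impI ballI)
    fix S m n
    assume S: "comm_alg K S" and m: "m \<in> carrier (fobj M S)" and n: "n \<in> carrier (fobj M S)"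
      and "m \<noteq> n"
    then have "bidual_map K M S m \<noteq> bidual_map K M S n"
      using sep by (auto simp: separated_def functor_inj_def inj_on_def)
    then obtain T w where T: "comm_alg S T"
      and w: "w \<in> carrier (fobj (restrict_functor K S (dual K M)) T)"
      and ne: "w (self_alg T) (farr M S (restrict_scalars K (unit_map K S) T) (unit_map S T) m) \<noteq>
        w (self_alg T) (farr M S (restrict_scalars K (unit_map K S) T) (unit_map S T) n)"
      using S m n unfolding bidual_map_def
      by (simp del: dual_simps restrict_functor_simps) (metis (mono_tags, lifting) restrict_ext mem_Collect_eq)
    let ?T = "restrict_scalars K (unit_map K S) T"
    have w': "w \<in> functor_hom ?T (restrict_functor K ?T M) base_functor"
      using w unfolding restrict_functor_simps(1)[of K S "dual K M"] dual_simps by simp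
    have ne': "w (self_alg ?T) (farr M S ?T (unit_map S T) m) \<noteq> w (self_alg ?T) (farr M S ?T (unit_map S T) n)"
      using ne by simp
    show "\<exists>w\<in>functor_hom K M base_functor. w S m \<noteq> w S n"
      by (rule dual_separates_over_base[OF inf K M S comm_alg_restrict_unit[OF S T]
            unit_map_alg_hom[OF S T] w' m n ne'])
  qed
next
  assume sep: ?sep
  show "separated K M"
    unfolding separated_def functor_inj_def
  proof (intro allI impI inj_onI)
    fix S m n
    assume S: "comm_alg K S" and m: "m \<in> carrier (fobj M S)" and n: "n \<in> carrier (fobj M S)"
      and eq: "bidual_map K M S m = bidual_map K M S n"
    show "m = n"
    proof (rule ccontr)
      assume "m \<noteq> n"
      then obtain w where w: "w \<in> functor_hom K M base_functor" "w S m \<noteq> w S n"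
        using sep S m n by blast
      have cK: "cring K" and cS: "cring S" using S by (simp_all add: comm_algD)
      have w0: "w \<in> functor_hom (self_alg K) (restrict_functor K (self_alg K) M) base_functor"
        using w(1) carrier_dual_space[of K M] by (simp add: dual_space_def)
      let ?u = "unit_map K S"
      have u: "?u \<in> alg_hom K (self_alg K) S"
        using S by (rule unit_map_alg_hom_self)
      define v where "v = (\<lambda>T\<in>{T. comm_alg S T}. w (restrict_scalars (self_alg K) ?u T))"
      have v: "v \<in> functor_hom S (restrict_functor K S M) base_functor"
        unfolding v_def using dual_arr_closed[OF comm_alg_self_alg[OF cK] S u M w0] .
      have S1: "comm_alg S (self_alg S)" using cS by (rule comm_alg_self_alg)
      have r: "restrict_scalars (self_alg K) ?u (self_alg S) = S"
        using restrict_scalars_unit_self_alg[OF S] by (simp add: restrict_scalars_def)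
      have id: "farr M S S (unit_map S (self_alg S)) m = m" if "m \<in> carrier (fobj M S)" for m
        unfolding unit_map_self_alg[OF cS] using module_functorD(2)[OF M S that] .
      have "bidual_map K M S m (self_alg S) v = w S m" if "m \<in> carrier (fobj M S)" for m
        using S S1 that v id[OF that] r by (simp add: bidual_map_def v_def[symmetric]) (simp add: v_def)
      then show False using eq m n w(2) by metis
    qed
  qed
qed

section \<open>Module schemes represent linear maps\<close>

lemma mod_hom_lin:
  assumes "h \<in> mod_hom K V S"
  shows "v \<in> carrier V \<Longrightarrow> h v \<in> carrier S"
    "v \<in> carrier V \<Longrightarrow> v' \<in> carrier V \<Longrightarrow> h (v \<oplus>\<^bsub>V\<^esub> v') = h v \<oplus>\<^bsub>S\<^esub> h v'"
    "a \<in> carrier K \<Longrightarrow> v \<in> carrier V \<Longrightarrow> h (a \<odot>\<^bsub>V\<^esub> v) = a \<odot>\<^bsub>S\<^esub> h v"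
    "h \<in> extensional (carrier V)"
  using assms by (auto simp: mod_hom_def)

lemma lin_functor_simps [simp]:
  "carrier (fobj (lin_functor K V) S) = mod_hom K V S"
  "h \<oplus>\<^bsub>fobj (lin_functor K V) S\<^esub> h' = (\<lambda>v\<in>carrier V. h v \<oplus>\<^bsub>S\<^esub> h' v)"
  "s \<odot>\<^bsub>fobj (lin_functor K V) S\<^esub> h = (\<lambda>v\<in>carrier V. s \<otimes>\<^bsub>S\<^esub> h v)"
  "farr (lin_functor K V) S T f h = (\<lambda>v\<in>carrier V. f (h v))"
  by (simp_all add: lin_functor_def)

context
  fixes K :: "('u, 'b) ring_scheme" and V :: "('u, 'v) module"
  assumes V: "module K V"
begin

interpretation V: module K V by (rule V)

private abbreviation (input) "QC \<equiv> quasi_coherent K V"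
private abbreviation (input) "QR S \<equiv> restrict_functor K S QC"

lemma carrier_module_scheme:
  "carrier (fobj (module_scheme K V) S) = functor_hom S (QR S) base_functor"
  by (simp add: module_scheme_def)

lemma restrict_QC [simp]:
  "fobj (QR S) T = tensor_module K V (restrict_scalars K (unit_map K S) T)"
  "farr (QR S) T T' f = tensor_map K V (restrict_scalars K (unit_map K S) T') f"
  using quasi_coherent_simps[OF V] by simp_all

(* Restrictions of QC are unfolded by restrict_QC, which keeps the base change visible. *)
declare restrict_functor_simps [simp del]

text \<open>
  An element \<open>\<phi>\<close> of the dual is determined by the values of its first component at the tensors \<open>v \<otimes> 1\<close>:
  linearity over \<open>T\<close> reduces \<open>v \<otimes> t\<close> to \<open>v \<otimes> 1\<close>, and naturality along \<open>S \<rightarrow> T\<close> reduces \<open>T\<close> to \<open>S\<close>.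
\<close>

lemma scheme_hom_pure:
  assumes S: "comm_alg K S" and T: "comm_alg S T"
    and \<phi>: "\<phi> \<in> functor_hom S (QR S) base_functor"
    and v: "v \<in> carrier V" and t: "t \<in> carrier T"
  shows "\<phi> T (pure_tensor K V (restrict_scalars K (unit_map K S) T) v t) =
    \<phi> (self_alg S) (pure_tensor K V S v \<one>\<^bsub>S\<^esub>) \<odot>\<^bsub>T\<^esub> t"
proof -
  interpret T: algebra S T using T by (rule comm_algD)
  let ?r = "restrict_scalars K (unit_map K S)"
  have rT: "comm_alg K (?r T)" using S T by (rule comm_alg_restrict_unit)
  have S1: "comm_alg S (self_alg S)" by (rule comm_alg_self_alg[OF T.R_cring])
  have p1: "pure_tensor K V S v \<one>\<^bsub>S\<^esub> \<in> carrier (fobj (QR S) (self_alg S))"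
    using S v pure_tensor_closed[OF V comm_algD(2)[OF S] v T.R.one_closed] by simp
  have p1T: "pure_tensor K V (?r T) v \<one>\<^bsub>T\<^esub> \<in> carrier (fobj (QR S) T)"
    using pure_tensor_closed[OF V comm_algD(2)[OF rT] v, of "\<one>\<^bsub>T\<^esub>"] by simp
  have c: "\<phi> (self_alg S) (pure_tensor K V S v \<one>\<^bsub>S\<^esub>) \<in> carrier S"
    using base_homD(1)[OF \<phi> S1 p1] by simp
  have "\<phi> T (tensor_map K V (?r T) (unit_map S T) (pure_tensor K V S v \<one>\<^bsub>S\<^esub>)) =
      unit_map S T (\<phi> (self_alg S) (pure_tensor K V S v \<one>\<^bsub>S\<^esub>))"
    using functor_hom_natural[OF \<phi> S1 T unit_map_alg_hom_self[OF T] p1] by simp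
  also have "tensor_map K V (?r T) (unit_map S T) (pure_tensor K V S v \<one>\<^bsub>S\<^esub>) = pure_tensor K V (?r T) v \<one>\<^bsub>T\<^esub>"
    using tensor_map_alg_hom(3)[OF V S rT unit_map_alg_hom[OF S T] v T.R.one_closed]
    by (simp add: ring_hom_one[OF unit_map_hom[OF T]])
  finally have 1: "\<phi> T (pure_tensor K V (?r T) v \<one>\<^bsub>T\<^esub>) =
      unit_map S T (\<phi> (self_alg S) (pure_tensor K V S v \<one>\<^bsub>S\<^esub>))" .
  have "pure_tensor K V (?r T) v t = t \<odot>\<^bsub>tensor_module K V (?r T)\<^esub> pure_tensor K V (?r T) v \<one>\<^bsub>T\<^esub>"
    using tensor_smult(3)[OF V rT, of t v "\<one>\<^bsub>T\<^esub>"] t v by simp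
  then have "\<phi> T (pure_tensor K V (?r T) v t) = t \<otimes>\<^bsub>T\<^esub> \<phi> T (pure_tensor K V (?r T) v \<one>\<^bsub>T\<^esub>)"
    using base_homD(3)[OF \<phi> T t p1T] by simp
  also have "\<dots> = unit_map S T (\<phi> (self_alg S) (pure_tensor K V S v \<one>\<^bsub>S\<^esub>)) \<otimes>\<^bsub>T\<^esub> t"
    unfolding 1 using t c T by (simp add: T.m_comm)
  also have "\<dots> = \<phi> (self_alg S) (pure_tensor K V S v \<one>\<^bsub>S\<^esub>) \<odot>\<^bsub>T\<^esub> t"
    using T c t by (rule unit_map_mult)
  finally show ?thesis .
qed

lemma scheme_to_lin_hom: "scheme_to_lin K V \<in> functor_hom K (module_scheme K V) (lin_functor K V)"
proof (rule functor_homI, goal_cases)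
  case (1 S \<phi>)
  interpret S: algebra K S using 1(1) by (rule comm_algD)
  have \<phi>: "\<phi> \<in> functor_hom S (QR S) base_functor"
    using 1(2) by (simp add: carrier_module_scheme)
  have S1: "comm_alg S (self_alg S)" by (rule comm_alg_self_alg[OF S.M_cring])
  have p: "pure_tensor K V S v s \<in> carrier (tensor_module K V S)" if "v \<in> carrier V" "s \<in> carrier S" for v s
    using pure_tensor_closed[OF V S.module that] .
  note d = base_homD[OF \<phi> S1, simplified, unfolded restrict_scalars_unit_self_alg[OF 1(1)]]
  have "\<phi> (self_alg S) (pure_tensor K V S (a \<odot>\<^bsub>V\<^esub> v) \<one>\<^bsub>S\<^esub>) =
      a \<odot>\<^bsub>S\<^esub> \<phi> (self_alg S) (pure_tensor K V S v \<one>\<^bsub>S\<^esub>)" if "a \<in> carrier K" "v \<in> carrier V" for a v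
  proof -
    have "pure_tensor K V S (a \<odot>\<^bsub>V\<^esub> v) \<one>\<^bsub>S\<^esub> =
        (a \<odot>\<^bsub>S\<^esub> \<one>\<^bsub>S\<^esub>) \<odot>\<^bsub>tensor_module K V S\<^esub> pure_tensor K V S v \<one>\<^bsub>S\<^esub>"
      using that by (simp add: pure_tensor_smult[OF V S.module] tensor_smult(3)[OF V 1(1)])
    then show ?thesis using that by (simp add: d(1,3) p S.smult_assoc2)
  qed
  then show ?case
    using 1 by (auto simp: scheme_to_lin_def mod_hom_def d p pure_tensor_add_left[OF V S.module])
next
  case (2 S \<phi> \<phi>')
  interpret S: algebra K S using 2(1) by (rule comm_algD)
  interpret X: module S "fobj (module_scheme K V) S"
    unfolding module_scheme_def
    using 2(1) module_functor_quasi_coherent[OF V] by (rule module_dual)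
  have S1: "comm_alg S (self_alg S)" by (rule comm_alg_self_alg[OF S.M_cring])
  have "\<phi> \<oplus>\<^bsub>fobj (module_scheme K V) S\<^esub> \<phi>' \<in> carrier (fobj (module_scheme K V) S)"
    using 2(2,3) by simp
  then show ?case
    using 2 dual_apply(2)[OF S1, of _ QC K \<phi> \<phi>'] pure_tensor_closed[OF V S.module, of _ "\<one>\<^bsub>S\<^esub>"]
    by (auto simp: scheme_to_lin_def quasi_coherent_simps[OF V] simp flip: module_scheme_def intro!: restrict_ext)
next
  case (3 S s \<phi>)
  interpret S: algebra K S using 3(1) by (rule comm_algD)
  interpret X: module S "fobj (module_scheme K V) S"
    unfolding module_scheme_def
    using 3(1) module_functor_quasi_coherent[OF V] by (rule module_dual)
  have S1: "comm_alg S (self_alg S)" by (rule comm_alg_self_alg[OF S.M_cring])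
  have \<phi>: "\<phi> \<in> functor_hom S (QR S) base_functor"
    using 3(3) by (simp add: carrier_module_scheme)
  note d = base_homD[OF \<phi> S1, simplified, unfolded restrict_scalars_unit_self_alg[OF 3(1)]]
  have "s \<odot>\<^bsub>fobj (module_scheme K V) S\<^esub> \<phi> \<in> carrier (fobj (module_scheme K V) S)"
    using 3(2,3) by simp
  then show ?case
    using 3 dual_apply(3)[OF S1, of _ QC K s \<phi>] pure_tensor_closed[OF V S.module, of _ "\<one>\<^bsub>S\<^esub>"]
    by (auto simp: scheme_to_lin_def quasi_coherent_simps[OF V] d simp flip: module_scheme_def intro!: restrict_ext)
next
  case (4 S T f \<phi>)
  interpret S: algebra K S using 4(1) by (rule comm_algD)
  interpret T: algebra K T using 4(2) by (rule comm_algD)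
  have \<phi>: "\<phi> \<in> functor_hom S (QR S) base_functor"
    using 4(4) by (simp add: carrier_module_scheme)
  have T1: "comm_alg T (self_alg T)" by (rule comm_alg_self_alg[OF T.M_cring])
  have S1: "comm_alg S (self_alg S)" by (rule comm_alg_self_alg[OF S.M_cring])
  \<comment> \<open>\<open>?B\<close> is \<open>T\<close> as an \<open>S\<close>-algebra via \<open>f\<close>, so the claim is naturality of \<open>\<phi>\<close> along \<open>S \<rightarrow> ?B\<close>.\<close>
  let ?B = "restrict_scalars S f (self_alg T)"
  have B: "comm_alg S ?B"
    using comm_alg_restrict_scalars[OF S.M_cring alg_homD(1)[OF 4(3)] T1] .
  have rB: "restrict_scalars K (unit_map K S) ?B = T"
    using restrict_scalars_alg_hom[OF 4(1-3) T1] 4(2) by simp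
  have p: "\<phi> (self_alg S) (pure_tensor K V S v \<one>\<^bsub>S\<^esub>) \<in> carrier S" if "v \<in> carrier V" for v
    using base_homD(1)[OF \<phi> S1, of "pure_tensor K V S v \<one>\<^bsub>S\<^esub>"] 4(1) that
      pure_tensor_closed[OF V S.module that] by simp
  have "\<phi> ?B (pure_tensor K V T v \<one>\<^bsub>T\<^esub>) = f (\<phi> (self_alg S) (pure_tensor K V S v \<one>\<^bsub>S\<^esub>))"
    if "v \<in> carrier V" for v
    using scheme_hom_pure[OF 4(1) B \<phi> that, of "\<one>\<^bsub>T\<^esub>"] p[OF that] alg_homD(3)[OF 4(3)]
    by (simp add: rB)
  moreover have "farr (module_scheme K V) S T f \<phi> \<in> carrier (fobj (module_scheme K V) T)"
    unfolding module_scheme_def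
    using module_functor_arr(1)[OF module_functor_dual[OF module_functor_quasi_coherent[OF V]] 4(1-3)]
      4(4) unfolding module_scheme_def by blast
  ultimately show ?case
    using 4 T1 by (auto simp: scheme_to_lin_def intro!: restrict_ext) (simp add: module_scheme_def)
next
  case 5 then show ?case by (simp add: scheme_to_lin_def)
next
  case (6 S) then show ?case by (simp add: scheme_to_lin_def)
qed

lemma scheme_to_lin_inj:
  assumes S: "comm_alg K S"
  shows "inj_on (scheme_to_lin K V S) (carrier (fobj (module_scheme K V) S))"
proof (rule inj_onI)
  fix \<phi> \<phi>' assume *: "\<phi> \<in> carrier (fobj (module_scheme K V) S)" "\<phi>' \<in> carrier (fobj (module_scheme K V) S)"
    and eq: "scheme_to_lin K V S \<phi> = scheme_to_lin K V S \<phi>'"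
  have \<phi>: "\<phi> \<in> functor_hom S (QR S) base_functor"
    "\<phi>' \<in> functor_hom S (QR S) base_functor"
    using * by (simp_all add: carrier_module_scheme)
  have e: "\<phi> (self_alg S) (pure_tensor K V S v \<one>\<^bsub>S\<^esub>) = \<phi>' (self_alg S) (pure_tensor K V S v \<one>\<^bsub>S\<^esub>)"
    if "v \<in> carrier V" for v
    using fun_cong[OF eq, of v] S * that by (simp add: scheme_to_lin_def)
  show "\<phi> = \<phi>'"
  proof (rule functor_hom_eqI[OF \<phi>])
    fix T x assume T: "comm_alg S T" and x: "x \<in> carrier (fobj (QR S) T)"
    let ?r = "restrict_scalars K (unit_map K S) T"
    have rT: "comm_alg K ?r" using S T by (rule comm_alg_restrict_unit)
    show "\<phi> T x = \<phi>' T x"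
    proof (rule tensor_hom_eq[OF V comm_algD(2)[OF rT], where H=T and h="\<phi> T" and k="\<phi>' T"])
      show "x \<in> carrier (tensor_module K V ?r)" using x by simp
    qed (use scheme_hom_pure[OF S T \<phi>(1)] scheme_hom_pure[OF S T \<phi>(2)] e
        base_homD(2)[OF \<phi>(1) T] base_homD(2)[OF \<phi>(2) T] in simp_all)
  qed
qed

text \<open>
  The components of a preimage of \<open>h\<close> are the maps \<open>v \<otimes> t \<mapsto> h(v) t\<close>, which the universal property provides.
\<close>

lemma scheme_to_lin_surj:
  assumes S: "comm_alg K S" and h: "h \<in> mod_hom K V S"
  shows "\<exists>\<phi>\<in>carrier (fobj (module_scheme K V) S). scheme_to_lin K V S \<phi> = h"
proof -
  interpret S: algebra K S using S by (rule comm_algD)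
  let ?r = "restrict_scalars K (unit_map K S)"
  let ?X = "\<lambda>T. tensor_module K V (?r T)"
  have rT: "comm_alg K (?r T)" if "comm_alg S T" for T using S that by (rule comm_alg_restrict_unit)
  define P where "P T l \<longleftrightarrow> (\<forall>x\<in>carrier (?X T). l x \<in> carrier T) \<and>
     (\<forall>x\<in>carrier (?X T). \<forall>y\<in>carrier (?X T). l (x \<oplus>\<^bsub>?X T\<^esub> y) = l x \<oplus>\<^bsub>T\<^esub> l y) \<and>
     (\<forall>v\<in>carrier V. \<forall>t\<in>carrier T. l (pure_tensor K V (?r T) v t) = h v \<odot>\<^bsub>T\<^esub> t)"
    for T :: "('u, 'u) module" and l
  have ex: "\<exists>l. P T l"
    if T: "comm_alg S T" for T :: "('u, 'u) module"
  proof -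
    interpret T: algebra S T using T by (rule comm_algD)
    have bal: "(a \<odot>\<^bsub>S\<^esub> h v) \<odot>\<^bsub>T\<^esub> t = h v \<odot>\<^bsub>T\<^esub> (unit_map K S a \<odot>\<^bsub>T\<^esub> t)"
      if "a \<in> carrier K" "v \<in> carrier V" "t \<in> carrier T" for a v t
      using that S mod_hom_lin(1)[OF h] S.m_comm[of "h v" "unit_map K S a"]
      by (simp add: unit_map_mult[OF S, symmetric] T.smult_assoc1[symmetric])
    obtain l where "\<And>x. x \<in> carrier (?X T) \<Longrightarrow> l x \<in> carrier T"
      "\<And>x y. x \<in> carrier (?X T) \<Longrightarrow> y \<in> carrier (?X T) \<Longrightarrow> l (x \<oplus>\<^bsub>?X T\<^esub> y) = l x \<oplus>\<^bsub>T\<^esub> l y"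
      "\<And>v t. v \<in> carrier V \<Longrightarrow> t \<in> carrier T \<Longrightarrow> l (pure_tensor K V (?r T) v t) = h v \<odot>\<^bsub>T\<^esub> t"
      by (rule tensor_universal[OF V comm_algD(2)[OF rT[OF T]] T.abelian_group_axioms, of "\<lambda>v t. h v \<odot>\<^bsub>T\<^esub> t"])
         (use bal in \<open>auto simp: mod_hom_lin[OF h] T.smult_l_distr T.smult_r_distr\<close>)
    then show ?thesis by (intro exI[of _ l]) (simp add: P_def)
  qed
  define L where "L T = (SOME l. P T l)" for T
  have "P T (L T)" if "comm_alg S T" for T
    unfolding L_def using ex[OF that] by (rule someI_ex)
  then have L: "\<And>T x. comm_alg S T \<Longrightarrow> x \<in> carrier (?X T) \<Longrightarrow> L T x \<in> carrier T"
    "\<And>T x y. comm_alg S T \<Longrightarrow> x \<in> carrier (?X T) \<Longrightarrow> y \<in> carrier (?X T) \<Longrightarrow>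
      L T (x \<oplus>\<^bsub>?X T\<^esub> y) = L T x \<oplus>\<^bsub>T\<^esub> L T y"
    "\<And>T v t. comm_alg S T \<Longrightarrow> v \<in> carrier V \<Longrightarrow> t \<in> carrier T \<Longrightarrow>
      L T (pure_tensor K V (?r T) v t) = h v \<odot>\<^bsub>T\<^esub> t"
    by (simp_all add: P_def)
  have F: "module_functor S (QR S)"
    using S module_functor_quasi_coherent[OF V] by (rule module_functor_restrict)
  let ?\<phi> = "\<lambda>T\<in>{T. comm_alg S T}. \<lambda>x\<in>carrier (fobj (QR S) T). L T x"
  have \<phi>: "?\<phi> \<in> functor_hom S (QR S) base_functor"
  proof (rule base_homI[OF F], goal_cases)
    case (1 T x) then show ?case using L(1) by simp
  next
    case (2 T x y) then show ?case using L(2) by simp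
  next
    case (3 T s x)
    interpret T: algebra S T using 3(1) by (rule comm_algD)
    note rT = rT[OF 3(1)]
    have sm: "s \<odot>\<^bsub>?X T\<^esub> x \<in> carrier (?X T)"
      "s \<odot>\<^bsub>?X T\<^esub> (x \<oplus>\<^bsub>?X T\<^esub> y) = s \<odot>\<^bsub>?X T\<^esub> x \<oplus>\<^bsub>?X T\<^esub> s \<odot>\<^bsub>?X T\<^esub> y"
      if "x \<in> carrier (?X T)" "y \<in> carrier (?X T)" for x y
      using tensor_smult(1,2)[OF V rT, of s] that 3(2) by simp_all
    have "L T (s \<odot>\<^bsub>?X T\<^esub> x) = s \<otimes>\<^bsub>T\<^esub> L T x"
    proof (rule tensor_hom_eq[OF V comm_algD(2)[OF rT], where H=T and h="\<lambda>x. L T (s \<odot>\<^bsub>?X T\<^esub> x)"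
          and k="\<lambda>x. s \<otimes>\<^bsub>T\<^esub> L T x"])
      show "x \<in> carrier (?X T)" using 3 by simp
      fix v t assume vt: "v \<in> carrier V" "t \<in> carrier (?r T)"
      have "h v \<odot>\<^bsub>T\<^esub> (s \<otimes>\<^bsub>T\<^esub> t) = s \<otimes>\<^bsub>T\<^esub> (h v \<odot>\<^bsub>T\<^esub> t)"
        using vt 3(2) mod_hom_lin(1)[OF h] T.m_comm[of s "h v \<odot>\<^bsub>T\<^esub> t"] T.m_comm[of s t]
        by (simp add: T.smult_assoc2)
      then show "L T (s \<odot>\<^bsub>?X T\<^esub> pure_tensor K V (?r T) v t) = s \<otimes>\<^bsub>T\<^esub> L T (pure_tensor K V (?r T) v t)"
        using vt 3(1,2) tensor_smult(3)[OF V rT, of s v t] by (simp add: L(3))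
    qed (use 3(1,2) L(1)[OF 3(1)] in \<open>simp_all add: sm L(2) T.r_distr\<close>)
    then show ?case by simp
  next
    case (4 T U f x)
    note h4 = tensor_map_alg_hom[OF V rT[OF 4(1)] rT[OF 4(2)]
        alg_hom_restrict_scalars[OF S.R_cring unit_map_hom[OF S] 4(1-3)]]
    have "L U (tensor_map K V (?r U) f x) = f (L T x)"
    proof (rule tensor_hom_eq[OF V comm_algD(2)[OF rT[OF 4(1)]], where H=U
          and h="\<lambda>x. L U (tensor_map K V (?r U) f x)" and k="\<lambda>x. f (L T x)"])
      show "x \<in> carrier (?X T)" using 4(4) by simp
    qed (use 4(1,2) alg_homD[OF 4(3)] mod_hom_lin(1)[OF h] ring_hom_add[OF alg_homD(1)[OF 4(3)]]
        in \<open>simp_all add: h4 L\<close>)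
    then show ?case by simp
  qed
  have S1: "comm_alg S (self_alg S)" by (rule comm_alg_self_alg[OF S.M_cring])
  have "scheme_to_lin K V S ?\<phi> = h"
  proof (rule extensionalityI[where A="carrier V"])
    show "scheme_to_lin K V S ?\<phi> \<in> extensional (carrier V)"
      using S \<phi> by (simp add: scheme_to_lin_def carrier_module_scheme)
    show "scheme_to_lin K V S ?\<phi> v = h v" if v: "v \<in> carrier V" for v
    proof -
      have "scheme_to_lin K V S ?\<phi> v = L (self_alg S) (pure_tensor K V S v \<one>\<^bsub>S\<^esub>)"
        using S \<phi> v S1 pure_tensor_closed[OF V S.module v, of "\<one>\<^bsub>S\<^esub>"]
        by (simp add: scheme_to_lin_def carrier_module_scheme)
      also have "\<dots> = h v"
        using L(3)[OF S1 v, of "\<one>\<^bsub>S\<^esub>"] S mod_hom_lin(1)[OF h v] by simp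
      finally show ?thesis .
    qed
  qed (rule mod_hom_lin(4)[OF h])
  then show ?thesis using \<phi> carrier_module_scheme by blast
qed

lemma scheme_to_lin_iso: "scheme_to_lin K V \<in> functor_iso K (module_scheme K V) (lin_functor K V)"
proof -
  have "bij_betw (scheme_to_lin K V S) (carrier (fobj (module_scheme K V) S)) (mod_hom K V S)"
    if S: "comm_alg K S" for S
    unfolding bij_betw_def
  proof
    show "scheme_to_lin K V S ` carrier (fobj (module_scheme K V) S) = mod_hom K V S"
      using functor_homD(1)[OF scheme_to_lin_hom S] scheme_to_lin_surj[OF S] by (auto simp: image_iff)
  qed (rule scheme_to_lin_inj[OF S])
  then show ?thesis using scheme_to_lin_hom by (simp add: functor_iso_def)
qed

lemma module_functor_scheme: "module_functor K (module_scheme K V)"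
  unfolding module_scheme_def by (rule module_functor_dual[OF module_functor_quasi_coherent[OF V]])

end

section \<open>Separated functors as submodules of module schemes\<close>

text \<open>
  The inverse of a natural bijection is again linear and natural, by injectivity. Applied to
  \<^const>\<open>scheme_to_lin\<close>, this turns the evaluation maps into \<^const>\<open>bar_map\<close>.
\<close>

lemma functor_hom_lift:
  assumes F: "module_functor K F" and G: "module_functor K G"
    and \<sigma>: "\<sigma> \<in> functor_iso K G L" and e: "e \<in> functor_hom K F L"
  shows "(\<lambda>S\<in>{S. comm_alg K S}. \<lambda>m\<in>carrier (fobj F S). inv_into (carrier (fobj G S)) (\<sigma> S) (e S m))
      \<in> functor_hom K F G" (is "?b \<in> _")
    and "comm_alg K S \<Longrightarrow> m \<in> carrier (fobj F S) \<Longrightarrow>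
      \<sigma> S (inv_into (carrier (fobj G S)) (\<sigma> S) (e S m)) = e S m"
proof -
  have \<sigma>h: "\<sigma> \<in> functor_hom K G L" and bij: "\<And>S. comm_alg K S \<Longrightarrow> bij_betw (\<sigma> S) (carrier (fobj G S)) (carrier (fobj L S))"
    using \<sigma> by (auto simp: functor_iso_def)
  define c where "c S m = inv_into (carrier (fobj G S)) (\<sigma> S) (e S m)" for S m
  have i: "c S m \<in> carrier (fobj G S)" "\<sigma> S (c S m) = e S m"
    if "comm_alg K S" "m \<in> carrier (fobj F S)" for S m
    using bij_betw_imp_surj_on[OF bij[OF that(1)]] functor_homD(1)[OF e that]
    by (auto simp: c_def intro: inv_into_into f_inv_into_f)
  then show "comm_alg K S \<Longrightarrow> m \<in> carrier (fobj F S) \<Longrightarrow>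
      \<sigma> S (inv_into (carrier (fobj G S)) (\<sigma> S) (e S m)) = e S m" by (simp add: c_def)
  have inj: "x = y" if "comm_alg K S" "x \<in> carrier (fobj G S)" "y \<in> carrier (fobj G S)" "\<sigma> S x = \<sigma> S y" for S x y
    using bij_betw_imp_inj_on[OF bij[OF that(1)]] that(2-) by (auto dest: inj_onD)
  have "(\<lambda>S\<in>{S. comm_alg K S}. \<lambda>m\<in>carrier (fobj F S). c S m) \<in> functor_hom K F G"
  proof (rule functor_homI, goal_cases)
    case (1 S m)
    then show ?case using i by simp
  next
    case (2 S m n)
    interpret F: module S "fobj F S" using module_functorD(1)[OF F 2(1)] .
    interpret G: module S "fobj G S" using module_functorD(1)[OF G 2(1)] .
    have "c S (m \<oplus>\<^bsub>fobj F S\<^esub> n) = c S m \<oplus>\<^bsub>fobj G S\<^esub> c S n"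
      using 2 by (intro inj[OF 2(1)]) (simp_all add: i functor_homD(2)[OF \<sigma>h] functor_homD(2)[OF e])
    then show ?case using 2 by simp
  next
    case (3 S s m)
    interpret F: module S "fobj F S" using module_functorD(1)[OF F 3(1)] .
    interpret G: module S "fobj G S" using module_functorD(1)[OF G 3(1)] .
    have "c S (s \<odot>\<^bsub>fobj F S\<^esub> m) = s \<odot>\<^bsub>fobj G S\<^esub> c S m"
      using 3 by (intro inj[OF 3(1)]) (simp_all add: i functor_homD(3)[OF \<sigma>h] functor_homD(3)[OF e])
    then show ?case using 3 by simp
  next
    case (4 S T f m)
    note a = module_functor_arr(1)[OF F 4(1-3)] module_functor_arr(1)[OF G 4(1-3)]
    have "c T (farr F S T f m) = farr G S T f (c S m)"
      using 4 by (intro inj[OF 4(2)])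
        (simp_all add: i a functor_hom_natural[OF \<sigma>h 4(1-3)] functor_hom_natural[OF e 4(1-3)])
    then show ?case using 4 a by simp
  qed auto
  then show "?b \<in> functor_hom K F G" by (simp add: c_def)
qed

lemma functor_iso_image:
  assumes F: "module_functor K F" and G: "module_functor K G"
    and b: "b \<in> functor_hom K F G" and inj: "functor_inj K F b"
  defines "N \<equiv> \<lambda>S. b S ` carrier (fobj F S)"
  shows "submodule_functor K G N" "b \<in> functor_iso K F (sub_functor G N)"
proof -
  have nat: "farr G S T f (b S m) = b T (farr F S T f m)"
    if "comm_alg K S" "comm_alg K T" "f \<in> alg_hom K S T" "m \<in> carrier (fobj F S)" for S T f m
    using functor_hom_natural[OF b that] by simp
  have sub: "submodule (N S) S (fobj G S)" if S: "comm_alg K S" for S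
  proof -
    interpret F: module S "fobj F S" using module_functorD(1)[OF F S] .
    interpret G: module S "fobj G S" using module_functorD(1)[OF G S] .
    note d = functor_homD[OF b S]
    have sm: "s \<odot>\<^bsub>fobj G S\<^esub> x \<in> N S" if "s \<in> carrier S" "x \<in> N S" for s x
      using that d(3)[of s, symmetric] by (auto simp: N_def)
    have z: "\<zero>\<^bsub>fobj G S\<^esub> \<in> N S"
      using sm[of "\<zero>\<^bsub>S\<^esub>" "b S \<zero>\<^bsub>fobj F S\<^esub>"] d(1) by (auto simp: N_def)
    show ?thesis
    proof (rule G.submoduleI)
      show NS: "N S \<subseteq> carrier (fobj G S)" using d(1) by (auto simp: N_def)
      show "\<zero>\<^bsub>fobj G S\<^esub> \<in> N S" by (rule z)
      show "\<ominus>\<^bsub>fobj G S\<^esub> x \<in> N S" if "x \<in> N S" for x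
        using sm[of "\<ominus>\<^bsub>S\<^esub> \<one>\<^bsub>S\<^esub>" x] that NS by (auto simp: G.smult_l_minus)
      show "x \<oplus>\<^bsub>fobj G S\<^esub> y \<in> N S" if "x \<in> N S" "y \<in> N S" for x y
        using that d(2)[symmetric] by (auto simp: N_def)
      show "s \<odot>\<^bsub>fobj G S\<^esub> x \<in> N S" if "s \<in> carrier S" "x \<in> N S" for s x
        using that by (rule sm)
    qed
  qed
  show "submodule_functor K G N"
    unfolding submodule_functor_def
    using sub module_functor_arr(1)[OF F] by (auto simp: N_def nat)
  have "b \<in> functor_hom K F (sub_functor G N)"
    using functor_homD[OF b] functor_hom_natural[OF b] b
    by (intro functor_homI) (auto simp: sub_functor_def N_def functor_hom_def)
  moreover have "bij_betw (b S) (carrier (fobj F S)) (carrier (fobj (sub_functor G N) S))" if "comm_alg K S" for S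
    using inj that by (simp add: functor_inj_def bij_betw_def sub_functor_def N_def)
  ultimately show "b \<in> functor_iso K F (sub_functor G N)" by (simp add: functor_iso_def)
qed

text \<open>
  Two points of the module scheme of \<open>V\<close> are linear maps on \<open>V\<close>. If they differ, they differ at some \<open>v\<close>, and
  evaluation at \<open>v\<close> is an element of the dual over \<open>K\<close>.
\<close>

lemma submodule_of_scheme_separated:
  fixes K :: "('u, 'b) ring_scheme" and M :: "('u, 'm) alg_functor" and V :: "('u, 'v) module"
  assumes inf: "infinite (UNIV :: 'u set)" and K: "field K" and M: "module_functor K M"
    and V: "module K V" and sub: "submodule_of_scheme K M V"
  shows "separated K M"
  unfolding separated_iff[OF inf K M]
proof (intro allI impI ballI)
  obtain N i where N: "submodule_functor K (module_scheme K V) N"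
    and i: "i \<in> functor_iso K M (sub_functor (module_scheme K V) N)"
    using sub by (auto simp: submodule_of_scheme_def)
  note \<sigma> = scheme_to_lin_hom[OF V]
  have ih: "i \<in> functor_hom K M (sub_functor (module_scheme K V) N)"
    using i by (simp add: functor_iso_def)
  have N_sub: "N S \<subseteq> carrier (fobj (module_scheme K V) S)" if "comm_alg K S" for S
  proof -
    interpret G: module S "fobj (module_scheme K V) S"
      using module_functorD(1)[OF module_functor_scheme[OF V] that] .
    show ?thesis using N that by (intro G.submoduleE(1)) (simp add: submodule_functor_def)
  qed
  have ihc: "i S m \<in> carrier (fobj (module_scheme K V) S)" if "comm_alg K S" "m \<in> carrier (fobj M S)" for S m
    using functor_homD(1)[OF ih that] N_sub[OF that(1)] by (auto simp: sub_functor_def)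
  note ih_add = functor_homD(2)[OF ih, unfolded sub_functor_def, simplified]
  note ih_smult = functor_homD(3)[OF ih, unfolded sub_functor_def, simplified]
  note ih_nat = functor_hom_natural[OF ih, unfolded sub_functor_def, simplified]
  fix S m n
  assume S: "comm_alg K S" and m: "m \<in> carrier (fobj M S)" and n: "n \<in> carrier (fobj M S)" and "m \<noteq> n"
  have "i S m \<noteq> i S n"
    using i S m n \<open>m \<noteq> n\<close> by (auto simp: functor_iso_def bij_betw_def inj_on_def)
  then have ne: "scheme_to_lin K V S (i S m) \<noteq> scheme_to_lin K V S (i S n)"
    using inj_onD[OF scheme_to_lin_inj[OF V S]] ihc[OF S m] ihc[OF S n] by blast
  have lin: "scheme_to_lin K V U (i U x) \<in> mod_hom K V U" if "comm_alg K U" "x \<in> carrier (fobj M U)" for U x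
    using functor_homD(1)[OF \<sigma> that(1) ihc[OF that]] by simp
  obtain v where v: "v \<in> carrier V" "scheme_to_lin K V S (i S m) v \<noteq> scheme_to_lin K V S (i S n) v"
    using ne mod_hom_lin(4)[OF lin[OF S m]] mod_hom_lin(4)[OF lin[OF S n]] by (meson extensionalityI)
  have "(\<lambda>U\<in>{U. comm_alg K U}. \<lambda>x\<in>carrier (fobj M U). scheme_to_lin K V U (i U x) v)
      \<in> functor_hom K M base_functor"
  proof (rule base_homI[OF M], goal_cases)
    case (1 U x)
    show ?case using mod_hom_lin(1)[OF lin[OF 1] v(1)] .
  next
    case (2 U x y)
    then show ?case
      using functor_homD(2)[OF \<sigma> 2(1) ihc[OF 2(1,2)] ihc[OF 2(1,3)]] v(1) by (simp add: ih_add)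
  next
    case (3 U s x)
    then show ?case
      using functor_homD(3)[OF \<sigma> 3(1,2) ihc[OF 3(1,3)]] v(1) by (simp add: ih_smult)
  next
    case (4 U U' f x)
    then show ?case
      using functor_hom_natural[OF \<sigma> 4(1-3) ihc[OF 4(1,4)]] v(1) by (simp add: ih_nat)
  qed
  then show "\<exists>w\<in>functor_hom K M base_functor. w S m \<noteq> w S n"
    by (rule bexI[rotated]) (use v S m n in simp)
qed

lemma evaluation_hom:
  assumes M: "module_functor K M"
  shows "(\<lambda>S\<in>{S. comm_alg K S}. \<lambda>m\<in>carrier (fobj M S). \<lambda>w\<in>carrier (dual_space K M). w S m)
    \<in> functor_hom K M (lin_functor K (dual_space K M))"
proof -
  let ?V = "dual_space K M"
  have add: "w \<oplus>\<^bsub>?V\<^esub> w' \<in> carrier ?V" "a \<odot>\<^bsub>?V\<^esub> w \<in> carrier ?V"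
    if "w \<in> carrier ?V" "w' \<in> carrier ?V" "a \<in> carrier K" "cring K" for a w w'
  proof -
    interpret module K ?V using that(4) M by (rule module_dual_space)
    show "w \<oplus>\<^bsub>?V\<^esub> w' \<in> carrier ?V" "a \<odot>\<^bsub>?V\<^esub> w \<in> carrier ?V" using that by auto
  qed
  have w: "w \<in> functor_hom K M base_functor" if "w \<in> carrier ?V" for w
    using that by (simp add: carrier_dual_space)
  have lin: "(\<lambda>w\<in>carrier ?V. w S m) \<in> mod_hom K ?V S"
    if S: "comm_alg K S" and m: "m \<in> carrier (fobj M S)" for S m
  proof -
    have K: "cring K" using S by (rule comm_algD)
    interpret D: module K ?V using K M by (rule module_dual_space)
    show ?thesis
      using base_homD(1)[OF w S m]
      by (auto simp: mod_hom_def dual_space_apply[OF S m])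
  qed
  show ?thesis
  proof (rule functor_homI, goal_cases)
    case (1 S m) then show ?case using lin by simp
  next
    case (2 S m n)
    interpret F: module S "fobj M S" using module_functorD(1)[OF M 2(1)] .
    show ?case using 2 base_homD(2)[OF w 2] by (auto intro!: restrict_ext)
  next
    case (3 S s m)
    interpret F: module S "fobj M S" using module_functorD(1)[OF M 3(1)] .
    show ?case using 3 base_homD(3)[OF w 3] by (auto intro!: restrict_ext)
  next
    case (4 S T f m)
    show ?case using 4 functor_hom_natural[OF w 4] module_functor_arr(1)[OF M 4]
      by (auto intro!: restrict_ext)
  qed auto
qed

theorem proposition4p2:
  fixes K :: "'u ring" and M :: "('u, 'm) alg_functor"
  assumes "infinite (UNIV :: 'u set)"
    and "field K"
    and "module_functor K M"
  shows "scheme_to_lin K (dual_space K M)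
           \<in> functor_iso K (bar_functor K M) (lin_functor K (dual_space K M)) \<and>
         bar_map K M \<in> functor_hom K M (bar_functor K M) \<and>
         (separated K M \<longleftrightarrow> functor_inj K M (bar_map K M)) \<and>
         (separated K M \<longleftrightarrow>
           (\<exists>V :: ('u, ('u, 'u) module \<Rightarrow> 'm \<Rightarrow> 'u) module.
              module K V \<and> submodule_of_scheme K M V)) \<and>
         (\<forall>V :: ('u, 'v) module.
           module K V \<and> submodule_of_scheme K M V \<longrightarrow> separated K M)"
proof -
  note inf = assms(1) and K = assms(2) and M = assms(3)
  interpret K: field K by fact
  let ?V = "dual_space K M" and ?B = "bar_functor K M"
  let ?e = "\<lambda>S\<in>{S. comm_alg K S}. \<lambda>m\<in>carrier (fobj M S). \<lambda>w\<in>carrier ?V. w S m"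
  have V: "module K ?V" using K.cring_axioms M by (rule module_dual_space)
  have B: "module_functor K ?B" unfolding bar_functor_def by (rule module_functor_scheme[OF V])
  have iso: "scheme_to_lin K ?V \<in> functor_iso K ?B (lin_functor K ?V)"
    unfolding bar_functor_def by (rule scheme_to_lin_iso[OF V])
  note lift = functor_hom_lift[OF M B iso evaluation_hom[OF M]]
  have bar: "bar_map K M = (\<lambda>S\<in>{S. comm_alg K S}. \<lambda>m\<in>carrier (fobj M S).
      inv_into (carrier (fobj ?B S)) (scheme_to_lin K ?V S) (?e S m))"
    by (auto simp: bar_map_def intro!: restrict_ext)
  have hom: "bar_map K M \<in> functor_hom K M ?B" unfolding bar by (rule lift(1))
  have ev: "scheme_to_lin K ?V S (bar_map K M S m) = (\<lambda>w\<in>carrier ?V. w S m)"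
    if "comm_alg K S" "m \<in> carrier (fobj M S)" for S m
    using lift(2)[OF that] that by (simp add: bar_map_def)
  have bar_eq: "bar_map K M S m = bar_map K M S n \<longleftrightarrow> (\<forall>w\<in>functor_hom K M base_functor. w S m = w S n)"
    if "comm_alg K S" "m \<in> carrier (fobj M S)" "n \<in> carrier (fobj M S)" for S m n
  proof -
    have "bar_map K M S m = bar_map K M S n \<longleftrightarrow>
        scheme_to_lin K ?V S (bar_map K M S m) = scheme_to_lin K ?V S (bar_map K M S n)"
      using inj_on_eq_iff[OF bij_betw_imp_inj_on] iso that functor_homD(1)[OF hom that(1)]
      unfolding functor_iso_def by (metis (mono_tags, lifting) mem_Collect_eq)
    also have "\<dots> \<longleftrightarrow> (\<forall>w\<in>carrier ?V. w S m = w S n)"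
      unfolding ev[OF that(1,2)] ev[OF that(1,3)]
    proof
      assume eq: "(\<lambda>w\<in>carrier ?V. w S m) = (\<lambda>w\<in>carrier ?V. w S n)"
      show "\<forall>w\<in>carrier ?V. w S m = w S n"
      proof
        fix w assume "w \<in> carrier ?V"
        then show "w S m = w S n" using fun_cong[OF eq, of w] by simp
      qed
    qed (auto intro!: restrict_ext)
    finally show ?thesis by (simp add: carrier_dual_space)
  qed
  have inj: "separated K M \<longleftrightarrow> functor_inj K M (bar_map K M)"
    unfolding separated_iff[OF inf K M] functor_inj_def inj_on_def using bar_eq by blast
  have "submodule_of_scheme K M ?V" if "separated K M"
    using functor_iso_image[OF M B hom] that inj
    unfolding submodule_of_scheme_def bar_functor_def by blast
  then have sub: "separated K M \<longleftrightarrow>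
      (\<exists>V :: ('u, ('u, 'u) module \<Rightarrow> 'm \<Rightarrow> 'u) module. module K V \<and> submodule_of_scheme K M V)"
    using V submodule_of_scheme_separated[OF inf K M] by blast
  show ?thesis
    using iso hom inj sub submodule_of_scheme_separated[OF inf K M] by blast
qed

end
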